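(* Let $X_t=g(\varepsilon_t,\varepsilon_{t-1},\ldots)$, $t\in\mathbb Z$, be a real-valued Bernoulli shift, where $\{\varepsilon_t\}_{t\in\mathbb Z}$ is a sequence of iid random elements of a measurable space $S$ and $g:S^\infty\to\mathbb R$ is measurable. Assume that $\operatorname E X_0=0$, $\operatorname E|X_0|^4<\infty$, and that for some $\eta>3$, $$\|X_t-X_t^{(\ell)}\|_4=O(\ell^{-\eta})\quad\text{as }\ell\to\infty .$$ Let $f(0)>0$, where $f$ is the spectral density of $\{X_t\}$, and let $m=m_n$ be a sequence of positive integers with $m\to\infty$ and $m=o(n^{4/5})$ as $n\to\infty$. Then $$\frac{\sqrt m}{f(0)}\,[Q_n-f(0)]=\frac1{\sqrt m}\sum_{j=1}^m\Bigl(\frac{I_n(\omega_j)}{f(0)}-1\Bigr)\xrightarrow{d}\mathcal N(0,1)\quad\text{as }n\to\infty .$$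
   Context: $\|X\|_p=(\operatorname E|X|^p)^{1/p}$. Let $\{\varepsilon_t'\}_{t\in\mathbb Z}$ be an independent copy of $\{\varepsilon_t\}_{t\in\mathbb Z}$; for $\ell\ge1$, $X_t^{(\ell)}=g(\varepsilon_t,\ldots,\varepsilon_{t-\ell+1},\varepsilon'_{t-\ell},\varepsilon'_{t-\ell-1},\ldots)$. The autocovariances are $\gamma(h)=\operatorname{Cov}(X_h,X_0)$, and the spectral density is $f(\omega)=\frac1{2\pi}\sum_{h=-\infty}^\infty\gamma(h)e^{-ih\omega}$, $\omega\in[-\pi,\pi]$ (the autocovariances are absolutely summable under the stated assumptions). The Fourier frequencies are $\omega_j=2\pi j/n$, the periodogram of $X_1,\ldots,X_n$ is $I_n(\omega_j)=\bigl|\frac1{\sqrt{2\pi n}}\sum_{t=1}^nX_te^{-it\omega_j}\bigr|^2$, and $Q_n=\frac1m\sum_{j=1}^mI_n(\omega_j)$. $\xrightarrow{d}$ denotes convergence in distribution. *)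

theory Defs
  imports "HOL-Probability.Probability" "HOL-Library.Landau_Symbols"
begin

definition Lp_norm :: "'a measure \<Rightarrow> real \<Rightarrow> ('a \<Rightarrow> real) \<Rightarrow> real" where
  "Lp_norm M p Z = (\<integral>\<omega>. \<bar>Z \<omega>\<bar> powr p \<partial>M) powr (1 / p)"

definition covariance :: "'a measure \<Rightarrow> ('a \<Rightarrow> real) \<Rightarrow> ('a \<Rightarrow> real) \<Rightarrow> real" where
  "covariance M Y Z =
     (\<integral>\<omega>. (Y \<omega> - (\<integral>\<omega>'. Y \<omega>' \<partial>M)) * (Z \<omega> - (\<integral>\<omega>'. Z \<omega>' \<partial>M)) \<partial>M)"

definition iid_sequence :: "'a measure \<Rightarrow> 's measure \<Rightarrow> (int \<Rightarrow> 'a \<Rightarrow> 's) \<Rightarrow> bool" where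
  "iid_sequence M S e \<longleftrightarrow>
     prob_space.indep_vars M (\<lambda>_. S) e UNIV \<and> (\<forall>s t. distr M S (e s) = distr M S (e t))"

(* Both sequences are regarded as random elements of the product space over the integers. *)
definition independent_copy ::
  "'a measure \<Rightarrow> 's measure \<Rightarrow> (int \<Rightarrow> 'a \<Rightarrow> 's) \<Rightarrow> (int \<Rightarrow> 'a \<Rightarrow> 's) \<Rightarrow> bool" where
  "independent_copy M S e e' \<longleftrightarrow>
     prob_space.indep_var M (Pi\<^sub>M UNIV (\<lambda>_. S)) (\<lambda>\<omega> t. e t \<omega>) (Pi\<^sub>M UNIV (\<lambda>_. S)) (\<lambda>\<omega> t. e' t \<omega>) \<and>
     distr M (Pi\<^sub>M UNIV (\<lambda>_. S)) (\<lambda>\<omega> t. e' t \<omega>) = distr M (Pi\<^sub>M UNIV (\<lambda>_. S)) (\<lambda>\<omega> t. e t \<omega>)"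

(* The k-th argument of g, counted from 0, is the innovation at time t - k. *)
definition bernoulli_shift ::
  "((nat \<Rightarrow> 's) \<Rightarrow> real) \<Rightarrow> (int \<Rightarrow> 'a \<Rightarrow> 's) \<Rightarrow> int \<Rightarrow> 'a \<Rightarrow> real" where
  "bernoulli_shift g e t \<omega> = g (\<lambda>k. e (t - int k) \<omega>)"

(* The innovations at times t, ..., t - l + 1 are kept; those at times t - l, t - l - 1, ...
   are replaced by the independent copy. *)
definition coupled_shift ::
  "((nat \<Rightarrow> 's) \<Rightarrow> real) \<Rightarrow> (int \<Rightarrow> 'a \<Rightarrow> 's) \<Rightarrow> (int \<Rightarrow> 'a \<Rightarrow> 's) \<Rightarrow> nat \<Rightarrow> int \<Rightarrow> 'a \<Rightarrow> real" where
  "coupled_shift g e e' l t \<omega> =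
     g (\<lambda>k. if k < l then e (t - int k) \<omega> else e' (t - int k) \<omega>)"

definition autocovariance :: "'a measure \<Rightarrow> (int \<Rightarrow> 'a \<Rightarrow> real) \<Rightarrow> int \<Rightarrow> real" where
  "autocovariance M X h = covariance M (X h) (X 0)"

(* Unordered (absolute) summation over the integers. The series is real for a stationary process,
   since its autocovariance function is even, so taking the real part only changes the type. *)
definition spectral_density :: "'a measure \<Rightarrow> (int \<Rightarrow> 'a \<Rightarrow> real) \<Rightarrow> real \<Rightarrow> real" where
  "spectral_density M X w =
     Re (1 / (2 * of_real pi) *
         (\<Sum>\<^sub>\<infinity>h\<in>UNIV. of_real (autocovariance M X h) * exp (- \<i> * of_int h * of_real w)))"

definition fourier_frequency :: "nat \<Rightarrow> nat \<Rightarrow> real" where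
  "fourier_frequency n j = 2 * pi * real j / real n"

definition periodogram :: "(int \<Rightarrow> 'a \<Rightarrow> real) \<Rightarrow> nat \<Rightarrow> real \<Rightarrow> 'a \<Rightarrow> real" where
  "periodogram X n w \<omega> =
     (cmod (1 / of_real (sqrt (2 * pi * real n)) *
        (\<Sum>t = 1..n. of_real (X (int t) \<omega>) * exp (- \<i> * of_nat t * of_real w))))\<^sup>2"

(* Here k is the number of averaged frequencies. *)
definition averaged_periodogram :: "(int \<Rightarrow> 'a \<Rightarrow> real) \<Rightarrow> nat \<Rightarrow> nat \<Rightarrow> 'a \<Rightarrow> real" where
  "averaged_periodogram X n k \<omega> =
     1 / real k * (\<Sum>j = 1..k. periodogram X n (fourier_frequency n j) \<omega>)"

end

theory Submission
  imports Defs
begin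

text \<open>
  The statement only concerns distributions, so we work on the space of innovation sequences,
  where conditional expectation given the coordinates in a set is an integral over the others.
  With the projections $P_t = E[\cdot|\mathcal F_t] - E[\cdot|\mathcal F_{t-1}]$, the process splits into
  the martingale difference sequences $Y^k_t = P_t X_{t+k}$, $k \ge 0$, and the coupling condition gives
  $\|Y^k_t\|_4 = O(k^{-\eta})$. Now $\sqrt m\,Q_n$ is a quadratic form in $X$, hence a double sum over
  $(k, l)$ of bilinear forms in $Y^k$ and $Y^l$. The diagonal parts have variance $O(m/n)$. The off-diagonal
  parts are bounded in $L^2$ by $\|Y^k\|_4 \|Y^l\|_4$ times the norm of the coefficients, so by dominated
  convergence the time shifts by $k$ and $l$ may be ignored, and $Y^k$ may be summed over $k < L$ and
  replaced by a bounded martingale difference $D$ that depends on finitely many innovations.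

  For $D$ the quadratic form is cut into $N = \lfloor m^{1/4} \rfloor$ blocks of equal length. Parseval's identity
  and the decay of the Dirichlet kernel show that the terms linking different blocks are negligible,
  and the iid blocks satisfy a Lyapunov condition by a Burkholder inequality in $L^4$.
  The variance of $D$ approximates the sum of the autocovariances $2\pi f(0)$, and $m = o(n^{4/5})$
  makes the bias $\sqrt m\,(E Q_n - f(0)) = O(\sqrt m (1/n + m^2/n^2))$ vanish.
\<close>


section \<open>Moment bounds\<close>

text \<open>Only fourth moments are available, whereas a Lyapunov condition for blocks of a
  quadratic form asks for fourth moments of products of two differences. This forces the passage to
  a bounded difference before cutting into blocks. Until then every error is measured in L^2, where
  products of two L^4 functions live, and an L^2 error passes directly to characteristic functions.
  The diagonal parts are no martingale sums, since a product of two differences at the same time can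
  only be centred. They are handled by decorrelation: covariances at distance r are of order c k * c
  l * c r, with \<open>c\<close> the coupling rate. The square root of the variance leaves sqrt (c k
  * c l), so sqrt c has to be summable. The bias needs summability of (k + 1)^2 * c k, and there
  \<eta> > 3 is spent. Norm bounds are kept as a predicate \<open>Lp_le\<close> instead of values of
  a norm, so that integrability travels with the bound and the triangle and product inequalities act
  as introduction rules.\<close>

definition Lp_le :: "'a measure \<Rightarrow> nat \<Rightarrow> ('a \<Rightarrow> real) \<Rightarrow> real \<Rightarrow> bool" where
  "Lp_le M p f a \<longleftrightarrow> f \<in> borel_measurable M \<and> integrable M (\<lambda>x. \<bar>f x\<bar> ^ p) \<and> 0 \<le> a \<and>
     (\<integral>x. \<bar>f x\<bar> ^ p \<partial>M) \<le> a ^ p"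

lemma Lp_le_measurable [measurable_dest]: "Lp_le M p f a \<Longrightarrow> f \<in> borel_measurable M"
  and Lp_le_nonneg: "Lp_le M p f a \<Longrightarrow> 0 \<le> a"
  and Lp_le_integrable: "Lp_le M p f a \<Longrightarrow> integrable M (\<lambda>x. \<bar>f x\<bar> ^ p)"
  and Lp_le_integral: "Lp_le M p f a \<Longrightarrow> (\<integral>x. \<bar>f x\<bar> ^ p \<partial>M) \<le> a ^ p"
  by (auto simp: Lp_le_def)

lemma Lp_le_mono: "Lp_le M p f a \<Longrightarrow> a \<le> b \<Longrightarrow> Lp_le M p f b"
  unfolding Lp_le_def using power_mono[of a b p] by fastforce

text \<open>The proof of the triangle inequality below divides by the bounds. This limit extends it
  to bounds that may vanish.\<close>

lemma Lp_le_epsilon: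
  assumes "0 \<le> a" "\<And>e. e > 0 \<Longrightarrow> Lp_le M p f (a + e)"
  shows "Lp_le M p f a"
proof -
  have "((\<lambda>e. (a + e) ^ p) \<longlongrightarrow> (a + 0) ^ p) (at_right 0)"
    by (intro tendsto_intros)
  moreover have "eventually (\<lambda>e. (\<integral>x. \<bar>f x\<bar> ^ p \<partial>M) \<le> (a + e) ^ p) (at_right 0)"
    using assms(2) by (auto simp: eventually_at_right_less Lp_le_def intro: eventually_mono[OF eventually_at_right_less])
  ultimately have "(\<integral>x. \<bar>f x\<bar> ^ p \<partial>M) \<le> (a + 0) ^ p"
    by (intro tendsto_lowerbound) auto
  then show ?thesis using assms(1) assms(2)[of 1] by (auto simp: Lp_le_def)
qed

lemma Lp_le_cong_AE:
  assumes "Lp_le M p f a" "AE x in M. f x = g x" "g \<in> borel_measurable M"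
  shows "Lp_le M p g a"
proof -
  note [measurable] = Lp_le_measurable[OF assms(1)] assms(3)
  have ae: "AE x in M. \<bar>f x\<bar> ^ p = \<bar>g x\<bar> ^ p" using assms(2) by eventually_elim simp
  have "integrable M (\<lambda>x. \<bar>f x\<bar> ^ p) \<longleftrightarrow> integrable M (\<lambda>x. \<bar>g x\<bar> ^ p)"
    using ae by (intro integrable_cong_AE) auto
  moreover have "(\<integral>x. \<bar>f x\<bar> ^ p \<partial>M) = (\<integral>x. \<bar>g x\<bar> ^ p \<partial>M)"
    using ae by (intro integral_cong_AE) auto
  ultimately show ?thesis using assms by (auto simp: Lp_le_def)
qed

lemma Lp_le_cong:
  assumes "Lp_le M p f a" "\<And>x. x \<in> space M \<Longrightarrow> f x = g x"
  shows "Lp_le M p g a"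
proof (rule Lp_le_cong_AE[OF assms(1)])
  show "AE x in M. f x = g x" using assms(2) by auto
  show "g \<in> borel_measurable M"
    using assms(2) Lp_le_measurable[OF assms(1)] by (metis measurable_cong)
qed

section \<open>Triangle inequality in L^p\<close>

lemma convex_abs_power:
  fixes x y t :: real
  assumes "0 \<le> t" "t \<le> 1" "p \<ge> 1"
  shows "\<bar>t * x + (1 - t) * y\<bar> ^ p \<le> t * \<bar>x\<bar> ^ p + (1 - t) * \<bar>y\<bar> ^ p"
proof -
  have "\<bar>t * x + (1 - t) * y\<bar> \<le> t * \<bar>x\<bar> + (1 - t) * \<bar>y\<bar>"
    using assms abs_triangle_ineq[of "t * x" "(1 - t) * y"] by (simp add: abs_mult)
  then have "\<bar>t * x + (1 - t) * y\<bar> ^ p \<le> (t * \<bar>x\<bar> + (1 - t) * \<bar>y\<bar>) ^ p"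
    by (intro power_mono) auto
  also have "\<dots> \<le> t * \<bar>x\<bar> ^ p + (1 - t) * \<bar>y\<bar> ^ p"
  proof -
    \<comment> \<open>Odd powers are convex on the half-line only, which is why absolute values are
      taken first.\<close>
    have c: "convex_on {0::real..} (\<lambda>x. x ^ p)"
    proof (cases "even p")
      case True
      then show ?thesis using convex_power_even[of p] convex_on_subset by blast
    next
      case False
      then show ?thesis using convex_power_odd[of p] by simp
    qed
    show ?thesis
      using convex_onD[OF c, of "1 - t" "\<bar>x\<bar>" "\<bar>y\<bar>"] assms by (simp add: algebra_simps)
  qed
  finally show ?thesis .
qed

text \<open>Convexity suffices: f + g is a + b times the convex combination of f / a and g / b with
  weights a / (a + b) and b / (a + b), and each of these quotients has p-th moment at most
  1.\<close>

lemma Lp_le_add_pos: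
  assumes f: "Lp_le M p f a" and g: "Lp_le M p g b" and pos: "a > 0" "b > 0" and p: "p \<ge> 1"
  shows "Lp_le M p (\<lambda>x. f x + g x) (a + b)"
proof -
  note [measurable] = Lp_le_measurable[OF f] Lp_le_measurable[OF g]
  define t where "t = a / (a + b)"
  have t: "0 < t" "t < 1" "1 - t = b / (a + b)" using pos by (auto simp: t_def field_simps)
  define w where "w x = (a + b) ^ p * (t / a ^ p) * \<bar>f x\<bar> ^ p + (a + b) ^ p * ((1 - t) / b ^ p) * \<bar>g x\<bar> ^ p" for x
  have le: "\<bar>f x + g x\<bar> ^ p \<le> w x" for x
  proof -
    have "f x + g x = (a + b) * (t * (f x / a) + (1 - t) * (g x / b))"
    proof -
      have "(a + b) * (t * (f x / a)) = f x" "(a + b) * ((1 - t) * (g x / b)) = g x"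
        unfolding t(3) using pos by (simp_all add: t_def)
      then show ?thesis by (simp only: distrib_left)
    qed
    then have "\<bar>f x + g x\<bar> ^ p = (a + b) ^ p * \<bar>t * (f x / a) + (1 - t) * (g x / b)\<bar> ^ p"
      using pos by (simp add: abs_mult power_mult_distrib)
    also have "\<dots> \<le> (a + b) ^ p * (t * \<bar>f x / a\<bar> ^ p + (1 - t) * \<bar>g x / b\<bar> ^ p)"
      using pos t p by (intro mult_left_mono convex_abs_power) auto
    also have "\<dots> = w x"
      using pos by (simp add: w_def power_divide abs_divide algebra_simps)
    finally show ?thesis .
  qed
  have int_w: "integrable M (\<lambda>x. w x)"
    unfolding w_def using f g by (auto simp: Lp_le_def)
  have int: "integrable M (\<lambda>x. \<bar>f x + g x\<bar> ^ p)"
    by (rule Bochner_Integration.integrable_bound[OF int_w]) (use le in \<open>auto intro!: order_trans[OF le]\<close>)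
  have "(\<integral>x. \<bar>f x + g x\<bar> ^ p \<partial>M) \<le> (\<integral>x. w x \<partial>M)"
    by (rule integral_mono[OF int int_w le])
  also have "\<dots> = (a + b) ^ p * (t / a ^ p) * (\<integral>x. \<bar>f x\<bar> ^ p \<partial>M) + (a + b) ^ p * ((1 - t) / b ^ p) * (\<integral>x. \<bar>g x\<bar> ^ p \<partial>M)"
    unfolding w_def using f g by (subst Bochner_Integration.integral_add) (auto simp: Lp_le_def)
  also have "\<dots> \<le> (a + b) ^ p * (t / a ^ p) * a ^ p + (a + b) ^ p * ((1 - t) / b ^ p) * b ^ p"
    using f g t pos by (intro add_mono mult_left_mono) (auto simp: Lp_le_def)
  also have "\<dots> = (a + b) ^ p * t + (a + b) ^ p * (1 - t)" using pos by simp
  also have "\<dots> = (a + b) ^ p" by (simp add: algebra_simps)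
  finally show ?thesis using int pos by (auto simp: Lp_le_def)
qed

lemma Lp_le_add:
  assumes f: "Lp_le M p f a" and g: "Lp_le M p g b" and p: "p \<ge> 1"
  shows "Lp_le M p (\<lambda>x. f x + g x) (a + b)"
proof (rule Lp_le_epsilon)
  show "0 \<le> a + b" using f g by (auto simp: Lp_le_def)
  fix e :: real assume "e > 0"
  then have "Lp_le M p (\<lambda>x. f x + g x) ((a + e / 2) + (b + e / 2))"
    using f g by (intro Lp_le_add_pos Lp_le_mono[OF f] Lp_le_mono[OF g] p) (auto simp: Lp_le_def)
  then show "Lp_le M p (\<lambda>x. f x + g x) (a + b + e)" by (simp add: algebra_simps)
qed

lemma Lp_le_zero: "p \<ge> 1 \<Longrightarrow> Lp_le M p (\<lambda>x. 0) 0"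
  by (auto simp: Lp_le_def power_0_left)

lemma Lp_le_sum:
  assumes "p \<ge> 1" "\<And>i. i \<in> I \<Longrightarrow> Lp_le M p (f i) (a i)"
  shows "Lp_le M p (\<lambda>x. \<Sum>i\<in>I. f i x) (\<Sum>i\<in>I. a i)"
  using assms(2)
proof (induction I rule: infinite_finite_induct)
  case (insert i I)
  then show ?case using Lp_le_add[of M p "f i" "a i" "\<lambda>x. \<Sum>i\<in>I. f i x" "\<Sum>i\<in>I. a i"] assms(1) by simp
qed (use Lp_le_zero[OF assms(1)] in auto)

lemma Lp_le_cmult:
  assumes "Lp_le M p f a"
  shows "Lp_le M p (\<lambda>x. c * f x) (\<bar>c\<bar> * a)"
  using assms by (auto simp: Lp_le_def abs_mult power_mult_distrib intro!: mult_left_mono)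

lemma Lp_le_minus: "Lp_le M p f a \<Longrightarrow> Lp_le M p (\<lambda>x. - f x) a"
  by (auto simp: Lp_le_def)

lemma Lp_le_diff:
  assumes f: "Lp_le M p f a" and g: "Lp_le M p g b" and p: "p \<ge> 1"
  shows "Lp_le M p (\<lambda>x. f x - g x) (a + b)"
  using Lp_le_add[OF f Lp_le_minus[OF g] p] by simp

lemma Lp_le_dominated:
  assumes g: "Lp_le M p g a" and "f \<in> borel_measurable M" and le: "\<And>x. x \<in> space M \<Longrightarrow> \<bar>f x\<bar> \<le> \<bar>g x\<bar>"
  shows "Lp_le M p f a"
proof -
  note [measurable] = assms(2) Lp_le_measurable[OF g]
  have le': "x \<in> space M \<Longrightarrow> \<bar>f x\<bar> ^ p \<le> \<bar>g x\<bar> ^ p" for x using le by (intro power_mono) auto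
  have int: "integrable M (\<lambda>x. \<bar>f x\<bar> ^ p)"
    by (rule Bochner_Integration.integrable_bound[OF Lp_le_integrable[OF g]]) (use le' in auto)
  moreover have "(\<integral>x. \<bar>f x\<bar> ^ p \<partial>M) \<le> (\<integral>x. \<bar>g x\<bar> ^ p \<partial>M)"
    by (rule integral_mono[OF int Lp_le_integrable[OF g] le'])
  ultimately show ?thesis using g by (auto simp: Lp_le_def)
qed

text \<open>The weighted inequality |f g| \<le> (b / 2a) f^2 + (a / 2b) g^2 has the weights for
  which the right side integrates to at most a b.\<close>

lemma L2_mult_pos:
  assumes f: "Lp_le M 2 f a" and g: "Lp_le M 2 g b" and pos: "a > 0" "b > 0"
  shows "Lp_le M 1 (\<lambda>x. f x * g x) (a * b)"
proof -
  note [measurable] = Lp_le_measurable[OF f] Lp_le_measurable[OF g]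
  define w where "w x = (b / (2 * a)) * \<bar>f x\<bar>\<^sup>2 + (a / (2 * b)) * \<bar>g x\<bar>\<^sup>2" for x
  have le: "\<bar>f x * g x\<bar> \<le> w x" for x
  proof -
    have "0 \<le> (b * \<bar>f x\<bar> - a * \<bar>g x\<bar>)\<^sup>2" by simp
    then have "2 * a * b * \<bar>f x * g x\<bar> \<le> b\<^sup>2 * \<bar>f x\<bar>\<^sup>2 + a\<^sup>2 * \<bar>g x\<bar>\<^sup>2"
      by (simp add: power2_eq_square algebra_simps abs_mult)
    moreover have "2 * a * b * w x = b\<^sup>2 * \<bar>f x\<bar>\<^sup>2 + a\<^sup>2 * \<bar>g x\<bar>\<^sup>2"
      using pos by (simp add: w_def power2_eq_square field_simps)
    ultimately have "(2 * a * b) * \<bar>f x * g x\<bar> \<le> (2 * a * b) * w x" by simp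
    moreover have "0 < 2 * a * b" using pos by simp
    ultimately show ?thesis by (rule mult_left_le_imp_le)
  qed
  have int_w: "integrable M (\<lambda>x. w x)" unfolding w_def using f g by (auto simp: Lp_le_def)
  have int: "integrable M (\<lambda>x. \<bar>f x * g x\<bar>)"
    by (rule Bochner_Integration.integrable_bound[OF int_w]) (auto intro!: order_trans[OF le])
  have "(\<integral>x. \<bar>f x * g x\<bar> \<partial>M) \<le> (\<integral>x. w x \<partial>M)" by (rule integral_mono[OF int int_w le])
  also have "\<dots> = (b / (2 * a)) * (\<integral>x. \<bar>f x\<bar>\<^sup>2 \<partial>M) + (a / (2 * b)) * (\<integral>x. \<bar>g x\<bar>\<^sup>2 \<partial>M)"
    unfolding w_def using f g by (subst Bochner_Integration.integral_add) (auto simp: Lp_le_def)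
  also have "\<dots> \<le> (b / (2 * a)) * a\<^sup>2 + (a / (2 * b)) * b\<^sup>2"
    using f g pos by (intro add_mono mult_left_mono) (auto simp: Lp_le_def)
  also have "\<dots> = a * b" using pos by (simp add: power2_eq_square field_simps)
  finally show ?thesis using int pos by (auto simp: Lp_le_def)
qed

lemma L2_mult:
  assumes f: "Lp_le M 2 f a" and g: "Lp_le M 2 g b"
  shows "Lp_le M 1 (\<lambda>x. f x * g x) (a * b)"
proof -
  have nn: "0 \<le> a" "0 \<le> b" using f g by (auto simp: Lp_le_def)
  have *: "Lp_le M 1 (\<lambda>x. f x * g x) ((a + e) * (b + e))" if "e > 0" for e
    using nn that by (intro L2_mult_pos Lp_le_mono[OF f] Lp_le_mono[OF g]) auto
  have "((\<lambda>e. (a + e) * (b + e)) \<longlongrightarrow> (a + 0) * (b + 0)) (at_right 0)"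
    by (intro tendsto_intros)
  moreover have "eventually (\<lambda>e. (\<integral>x. \<bar>f x * g x\<bar> \<partial>M) \<le> (a + e) * (b + e)) (at_right 0)"
    using * by (auto simp: Lp_le_def intro: eventually_mono[OF eventually_at_right_less])
  ultimately have "(\<integral>x. \<bar>f x * g x\<bar> \<partial>M) \<le> (a + 0) * (b + 0)"
    by (intro tendsto_lowerbound) auto
  then show ?thesis using nn *[of 1] by (auto simp: Lp_le_def)
qed

text \<open>Cauchy-Schwarz for the squares of the two functions.\<close>

lemma L4_mult:
  assumes f: "Lp_le M 4 f a" and g: "Lp_le M 4 g b"
  shows "Lp_le M 2 (\<lambda>x. f x * g x) (a * b)"
proof -
  have sq: "Lp_le M 2 (\<lambda>x. (h x)\<^sup>2) (c\<^sup>2)" if "Lp_le M 4 h c" for h c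
    using that by (auto simp: Lp_le_def simp flip: power_mult)
  have "Lp_le M 1 (\<lambda>x. (f x)\<^sup>2 * (g x)\<^sup>2) (a\<^sup>2 * b\<^sup>2)"
    by (intro L2_mult sq f g)
  then show ?thesis using f g
    by (auto simp: Lp_le_def power_mult_distrib)
qed

context prob_space
begin

lemma Lp_le_const: "Lp_le M p (\<lambda>x. c) \<bar>c\<bar>"
  by (auto simp: Lp_le_def prob_space)

lemma Lp_le_bounded:
  "f \<in> borel_measurable M \<Longrightarrow> (\<And>x. x \<in> space M \<Longrightarrow> \<bar>f x\<bar> \<le> B) \<Longrightarrow> 0 \<le> B \<Longrightarrow> Lp_le M p f B"
  by (rule Lp_le_dominated[OF Lp_le_mono[OF Lp_le_const[of p B]]]) auto

lemma L4_L2: assumes "Lp_le M 4 f a" shows "Lp_le M 2 f a"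
  using L4_mult[OF assms Lp_le_const[of 4 1]] by simp

lemma L2_L1: assumes "Lp_le M 2 f a" shows "Lp_le M 1 f a"
  using L2_mult[OF assms Lp_le_const[of 2 1]] by simp

lemma L1_integrable: "Lp_le M 1 f a \<Longrightarrow> integrable M f"
  unfolding Lp_le_def power_one_right by (rule integrable_abs_cancel) blast+

lemma L2_integrable: "Lp_le M 2 f a \<Longrightarrow> integrable M f"
  by (rule L1_integrable[OF L2_L1])

lemma L4_integrable: "Lp_le M 4 f a \<Longrightarrow> integrable M f"
  by (rule L2_integrable[OF L4_L2])

lemma L1_abs_integral:
  assumes "Lp_le M 1 f a" shows "\<bar>\<integral>x. f x \<partial>M\<bar> \<le> a"
  using order_trans[OF integral_abs_bound[of M f], of a] assms by (auto simp: Lp_le_def)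

lemma L2_abs_integral: "Lp_le M 2 f a \<Longrightarrow> \<bar>\<integral>x. f x \<partial>M\<bar> \<le> a"
  using L1_abs_integral L2_L1 by blast

lemma L2_mult_integrable: "Lp_le M 2 f a \<Longrightarrow> Lp_le M 2 g b \<Longrightarrow> integrable M (\<lambda>x. f x * g x)"
  by (rule L1_integrable[OF L2_mult])

lemma L4_mult_integrable: "Lp_le M 4 f a \<Longrightarrow> Lp_le M 4 g b \<Longrightarrow> integrable M (\<lambda>x. f x * g x)"
  by (rule L2_integrable[OF L4_mult])

lemma L4_mult4_integrable:
  assumes "Lp_le M 4 f a" "Lp_le M 4 g b" "Lp_le M 4 h c" "Lp_le M 4 k d"
  shows "integrable M (\<lambda>x. f x * g x * (h x * k x))"
  by (rule L2_mult_integrable[OF L4_mult[OF assms(1,2)] L4_mult[OF assms(3,4)]])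

lemma Lp_le_center:
  assumes "Lp_le M 2 f a"
  shows "Lp_le M 2 (\<lambda>x. f x - (\<integral>y. f y \<partial>M)) (2 * a)"
proof -
  have "Lp_le M 2 (\<lambda>x. f x - (\<integral>y. f y \<partial>M)) (a + a)"
    using L2_abs_integral[OF assms] by (intro Lp_le_diff assms Lp_le_mono[OF Lp_le_const]) auto
  then show ?thesis by simp
qed

lemma L2_prod_bound:
  assumes "Lp_le M 2 f a" "Lp_le M 2 g b"
  shows "\<bar>\<integral>x. f x * g x \<partial>M\<bar> \<le> a * b"
  by (rule L1_abs_integral[OF L2_mult[OF assms]])

end

lemma Lp_leI_root:
  assumes "f \<in> borel_measurable M" "integrable M (\<lambda>x. \<bar>f x\<bar> ^ p)" "p \<ge> 1"
  shows "Lp_le M p f (root p (\<integral>x. \<bar>f x\<bar> ^ p \<partial>M))"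
  using assms by (auto simp: Lp_le_def integral_nonneg_AE)

lemma L2_leI:
  assumes "f \<in> borel_measurable M" "integrable M (\<lambda>x. (f x)\<^sup>2)" "(\<integral>x. (f x)\<^sup>2 \<partial>M) \<le> v"
  shows "Lp_le M 2 f (sqrt v)"
proof -
  have "0 \<le> v" using order_trans[OF integral_nonneg_AE[of "\<lambda>x. (f x)\<^sup>2" M] assms(3)] by simp
  then show ?thesis using assms by (auto simp: Lp_le_def)
qed

section \<open>Conditional expectations on the space of innovations\<close>

text \<open>Resampling outside \<open>A\<close>. For \<open>A = {- int l<..}\<close> and two
  independent sequences this is the argument of the coupled process at time 0.\<close>

definition mix :: "'i set \<Rightarrow> ('i \<Rightarrow> 's) \<Rightarrow> ('i \<Rightarrow> 's) \<Rightarrow> 'i \<Rightarrow> 's" where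
  "mix A x y i = (if i \<in> A then x i else y i)"

definition shift :: "int \<Rightarrow> (int \<Rightarrow> 's) \<Rightarrow> int \<Rightarrow> 's" where
  "shift t x i = x (i + t)"

text \<open>Stands in for measurability with respect to the coordinates in \<open>A\<close>. The
  pointwise form avoids null sets, and conditional expectations satisfy it exactly because they are
  explicit integrals.\<close>

definition dep :: "'i set \<Rightarrow> (('i \<Rightarrow> 's) \<Rightarrow> 'b) \<Rightarrow> bool" where
  "dep A f \<longleftrightarrow> (\<forall>x y. (\<forall>i\<in>A. x i = y i) \<longrightarrow> f x = f y)"

lemma dep_mono: "dep A f \<Longrightarrow> A \<subseteq> B \<Longrightarrow> dep B f"
  unfolding dep_def by blast

lemma depD: "dep A f \<Longrightarrow> (\<And>i. i \<in> A \<Longrightarrow> x i = y i) \<Longrightarrow> f x = f y"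
  unfolding dep_def by blast

lemma dep_const: "dep A (\<lambda>x. c)"
  by (simp add: dep_def)

lemma dep_comp: "dep A f \<Longrightarrow> dep A (\<lambda>x. h (f x))"
  unfolding dep_def by metis

lemma dep_sum: "(\<And>i. i \<in> I \<Longrightarrow> dep A (f i)) \<Longrightarrow> dep A (\<lambda>x. \<Sum>i\<in>I. f i x)"
  unfolding dep_def by (intro allI impI sum.cong refl) blast

lemma dep_shift: "dep A f \<Longrightarrow> dep ((\<lambda>i. i + t) ` A) (\<lambda>x. f (shift t x))"
  unfolding dep_def shift_def by auto

lemma mix_eq: "dep A f \<Longrightarrow> f (mix A x y) = f x"
  by (rule depD) (auto simp: mix_def)

lemma mix_eq': "dep B f \<Longrightarrow> A \<inter> B = {} \<Longrightarrow> f (mix A x y) = f y"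
  by (rule depD) (auto simp: mix_def)

lemma mix_mix: "mix B (mix A x y) z = mix (A \<inter> B) x (mix B y z)"
  by (auto simp: mix_def fun_eq_iff)

lemma mix_shift: "mix A (shift t x) (shift t y) = shift t (mix ((\<lambda>i. i + t) ` A) x y)"
  by (auto simp: mix_def shift_def fun_eq_iff)

lemma shift_shift: "shift s (shift t x) = shift (s + t) x"
  by (auto simp: shift_def fun_eq_iff algebra_simps)

lemma shift_0 [simp]: "shift 0 x = x"
  by (auto simp: shift_def fun_eq_iff)

locale iid_space =
  fixes \<mu> :: "'s measure"
  assumes prob_\<mu>: "prob_space \<mu>"
begin

abbreviation P :: "(int \<Rightarrow> 's) measure" where "P \<equiv> Pi\<^sub>M UNIV (\<lambda>_. \<mu>)"

sublocale prob_space P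
  by (rule prob_space_PiM) (rule prob_\<mu>)

sublocale PP: product_prob_space "\<lambda>_::int. \<mu>" UNIV
  by (rule product_prob_spaceI) (rule prob_\<mu>)

sublocale P2: pair_prob_space P P ..

text \<open>As the coordinates are independent, this is the conditional expectation given those in \<open>A\<close>.\<close>
definition cexp :: "int set \<Rightarrow> ((int \<Rightarrow> 's) \<Rightarrow> real) \<Rightarrow> (int \<Rightarrow> 's) \<Rightarrow> real" where
  "cexp A f x = (\<integral>y. f (mix A x y) \<partial>P)"

section \<open>Invariance of the product law under resampling and shifts\<close>

lemma measurable_mix [measurable (raw)]:
  assumes "f \<in> N \<rightarrow>\<^sub>M P" "g \<in> N \<rightarrow>\<^sub>M P"
  shows "(\<lambda>z. mix A (f z) (g z)) \<in> N \<rightarrow>\<^sub>M P"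
proof (rule measurable_PiM_single')
  fix i :: int
  note [measurable] = assms
  show "(\<lambda>z. mix A (f z) (g z) i) \<in> N \<rightarrow>\<^sub>M \<mu>"
    unfolding mix_def by (cases "i \<in> A") simp_all
next
  show "(\<lambda>z. mix A (f z) (g z)) \<in> space N \<rightarrow> (\<Pi>\<^sub>E i\<in>UNIV. space \<mu>)"
    using assms[THEN measurable_space] by (auto simp: mix_def space_PiM PiE_iff)
qed

lemma measurable_shift [measurable (raw)]:
  assumes "f \<in> N \<rightarrow>\<^sub>M P"
  shows "(\<lambda>z. shift t (f z)) \<in> N \<rightarrow>\<^sub>M P"
proof (rule measurable_PiM_single')
  fix i :: int
  note [measurable] = assms
  show "(\<lambda>z. shift t (f z) i) \<in> N \<rightarrow>\<^sub>M \<mu>"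
    unfolding shift_def by simp
next
  show "(\<lambda>z. shift t (f z)) \<in> space N \<rightarrow> (\<Pi>\<^sub>E i\<in>UNIV. space \<mu>)"
    using assms[THEN measurable_space] by (auto simp: shift_def space_PiM PiE_iff)
qed

text \<open>A cylinder condition on \<open>J\<close> splits into one on \<open>J \<inter> A\<close>
  for the first copy and one on \<open>J - A\<close> for the second. The two products of
  probabilities multiply to the one over \<open>J\<close>.\<close>

lemma distr_mix: "distr (P \<Otimes>\<^sub>M P) P (\<lambda>z. mix A (fst z) (snd z)) = P"
proof (rule PP.PiM_eq)
  show "sets (distr (P \<Otimes>\<^sub>M P) P (\<lambda>z. mix A (fst z) (snd z))) = sets P" by simp
  fix J :: "int set" and F assume J: "finite J" and F: "\<And>j. j \<in> J \<Longrightarrow> F j \<in> sets \<mu>"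
  let ?E = "\<lambda>K. {x\<in>space P. \<forall>i\<in>K. x i \<in> F i}"
  have E: "?E K \<in> sets P" "emeasure P (?E K) = (\<Prod>i\<in>K. emeasure \<mu> (F i))" if "K \<subseteq> J" for K
  proof -
    have fK: "finite K" using that J finite_subset by blast
    show "?E K \<in> sets P"
      using that F fK by (intro sets.sets_Collect_finite_All sets_Collect_single') (auto simp: Collect_mem_eq)
    show "emeasure P (?E K) = (\<Prod>i\<in>K. emeasure \<mu> (F i))"
      using that F fK by (intro PP.emeasure_PiM_Collect) auto
  qed
  have emb: "prod_emb UNIV (\<lambda>_. \<mu>) J (Pi\<^sub>E J F) = ?E J"
    using F[THEN sets.sets_into_space] by (auto simp: prod_emb_def space_PiM PiE_iff)
  have "emeasure (distr (P \<Otimes>\<^sub>M P) P (\<lambda>z. mix A (fst z) (snd z))) (?E J) =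
    emeasure (P \<Otimes>\<^sub>M P) ((\<lambda>z. mix A (fst z) (snd z)) -` ?E J \<inter> space (P \<Otimes>\<^sub>M P))"
    by (rule emeasure_distr) (use E(1)[of J] in measurable)
  also have "(\<lambda>z. mix A (fst z) (snd z)) -` ?E J \<inter> space (P \<Otimes>\<^sub>M P) = ?E (J \<inter> A) \<times> ?E (J - A)"
    by (auto simp: mix_def space_pair_measure space_PiM PiE_iff split: if_splits)
  also have "emeasure (P \<Otimes>\<^sub>M P) \<dots> = emeasure P (?E (J \<inter> A)) * emeasure P (?E (J - A))"
    by (intro emeasure_pair_measure_Times E) auto
  also have "\<dots> = (\<Prod>i\<in>J. emeasure \<mu> (F i))"
    using J by (subst (1 2) E(2)) (auto simp: prod.Int_Diff[of J _ A])
  finally show "emeasure (distr (P \<Otimes>\<^sub>M P) P (\<lambda>z. mix A (fst z) (snd z)))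
      (prod_emb UNIV (\<lambda>_. \<mu>) J (Pi\<^sub>E J F)) = (\<Prod>j\<in>J. emeasure \<mu> (F j))"
    by (simp only: emb)
qed

lemma distr_shift: "distr P P (shift t) = P"
proof (rule PP.PiM_eq)
  show "sets (distr P P (shift t)) = sets P" by simp
  fix J :: "int set" and F assume J: "finite J" and F: "\<And>j. j \<in> J \<Longrightarrow> F j \<in> sets \<mu>"
  have emb: "prod_emb UNIV (\<lambda>_. \<mu>) J (Pi\<^sub>E J F) = {x\<in>space P. \<forall>i\<in>J. x i \<in> F i}"
    using F[THEN sets.sets_into_space] by (auto simp: prod_emb_def space_PiM PiE_iff)
  have "emeasure (distr P P (shift t)) (prod_emb UNIV (\<lambda>_. \<mu>) J (Pi\<^sub>E J F)) =
    emeasure P (shift t -` {x\<in>space P. \<forall>i\<in>J. x i \<in> F i} \<inter> space P)"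
    unfolding emb
  proof (rule emeasure_distr)
    show "{x\<in>space P. \<forall>i\<in>J. x i \<in> F i} \<in> sets P"
      using F J by (intro sets.sets_Collect_finite_All sets_Collect_single') (auto simp: Collect_mem_eq)
  qed measurable
  also have "shift t -` {x\<in>space P. \<forall>i\<in>J. x i \<in> F i} \<inter> space P =
    {x\<in>space P. \<forall>i\<in>(\<lambda>i. i + t) ` J. x i \<in> F (i - t)}"
    by (auto simp: shift_def space_PiM PiE_iff)
  also have "emeasure P \<dots> = (\<Prod>i\<in>(\<lambda>i. i + t) ` J. emeasure \<mu> (F (i - t)))"
    using F J by (intro PP.emeasure_PiM_Collect) auto
  also have "\<dots> = (\<Prod>j\<in>J. emeasure \<mu> (F j))"
    by (subst prod.reindex) (auto simp: inj_on_def)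
  finally show "emeasure (distr P P (shift t)) (prod_emb UNIV (\<lambda>_. \<mu>) J (Pi\<^sub>E J F)) = (\<Prod>j\<in>J. emeasure \<mu> (F j))" .
qed

lemma integral_mix:
  fixes f :: "_ \<Rightarrow> 'b::{banach, second_countable_topology}"
  assumes "f \<in> borel_measurable P"
  shows "(\<integral>z. f (mix A (fst z) (snd z)) \<partial>(P \<Otimes>\<^sub>M P)) = (\<integral>x. f x \<partial>P)"
  using integral_distr[of "\<lambda>z. mix A (fst z) (snd z)" "P \<Otimes>\<^sub>M P" P f] assms by (simp add: distr_mix)

lemma integrable_mix:
  fixes f :: "_ \<Rightarrow> 'b::{banach, second_countable_topology}"
  assumes "integrable P f"
  shows "integrable (P \<Otimes>\<^sub>M P) (\<lambda>z. f (mix A (fst z) (snd z)))"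
  using integrable_distr[of "\<lambda>z. mix A (fst z) (snd z)" "P \<Otimes>\<^sub>M P" P f] assms by (simp add: distr_mix)

lemma integral_shift:
  fixes f :: "_ \<Rightarrow> 'b::{banach, second_countable_topology}"
  assumes "f \<in> borel_measurable P"
  shows "(\<integral>x. f (shift t x) \<partial>P) = (\<integral>x. f x \<partial>P)"
  using integral_distr[of "shift t" P P f] assms by (simp add: distr_shift)

lemma integrable_shift:
  fixes f :: "_ \<Rightarrow> 'b::{banach, second_countable_topology}"
  assumes "integrable P f"
  shows "integrable P (\<lambda>x. f (shift t x))"
  using integrable_distr[of "shift t" P P f] assms by (simp add: distr_shift)

lemma Lp_le_shift: 
  assumes "Lp_le P p f a" shows "Lp_le P p (\<lambda>x. f (shift t x)) a"
proof -
  note [measurable] = Lp_le_measurable[OF assms]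
  show ?thesis
    using assms integrable_shift[of "\<lambda>x. \<bar>f x\<bar> ^ p" t] integral_shift[of "\<lambda>x. \<bar>f x\<bar> ^ p" t]
    by (auto simp: Lp_le_def)
qed

section \<open>Tower property, contraction and independence\<close>

lemma cexp_measurable [measurable]:
  assumes [measurable]: "f \<in> borel_measurable P"
  shows "cexp A f \<in> borel_measurable P"
  unfolding cexp_def[abs_def] by measurable

lemma dep_cexp: "dep A (cexp A f)"
  unfolding dep_def cexp_def mix_def by (auto intro!: Bochner_Integration.integral_cong arg_cong[of _ _ f])

lemma cexp_dep: "dep A f \<Longrightarrow> cexp A f x = f x"
  by (simp add: cexp_def mix_eq prob_space)

lemma cexp_empty: "cexp {} f x = (\<integral>y. f y \<partial>P)"
  by (simp add: cexp_def mix_def[abs_def])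

lemma AE_integrable_mix:
  fixes f :: "_ \<Rightarrow> real"
  assumes "integrable P f" shows "AE x in P. integrable P (\<lambda>y. f (mix A x y))"
  using P2.AE_integrable_fst'[OF integrable_mix[OF assms, of A]] by simp

lemma integrable_cexp:
  assumes "integrable P f" shows "integrable P (cexp A f)"
  using P2.integrable_fst'[OF integrable_mix[OF assms, of A]] by (simp add: cexp_def[abs_def])

lemma cexp_diff:
  assumes "integrable P f" "integrable P g"
  shows "AE x in P. cexp A (\<lambda>x. f x - g x) x = cexp A f x - cexp A g x"
  using AE_integrable_mix[OF assms(1), of A] AE_integrable_mix[OF assms(2), of A]
  by eventually_elim (simp add: cexp_def)

text \<open>By \<open>mix_mix\<close> two successive resamplings draw, on the complement of
  \<open>A \<inter> B\<close>, a mixture of two independent copies, which has the law of one copy.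
  The identity is only almost sure since the section of \<open>f\<close> is integrable for almost
  every \<open>x\<close>.\<close>

lemma cexp_tower:
  assumes f: "integrable P f"
  shows "AE x in P. cexp A (cexp B f) x = cexp (A \<inter> B) f x"
  using AE_integrable_mix[OF f, of "A \<inter> B"] AE_space
proof eventually_elim
  fix x assume i: "integrable P (\<lambda>y. f (mix (A \<inter> B) x y))" and [simp]: "x \<in> space P"
  have [measurable]: "f \<in> borel_measurable P" using f by auto
  let ?h = "\<lambda>w. f (mix (A \<inter> B) x w)"
  have "(\<integral>y. (\<integral>z. ?h (mix B y z) \<partial>P) \<partial>P) = (\<integral>z. ?h (mix B (fst z) (snd z)) \<partial>(P \<Otimes>\<^sub>M P))"
    using P2.integral_fst'[OF integrable_mix[OF i, of B]] by simp
  also have "\<dots> = (\<integral>w. ?h w \<partial>P)"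
    by (rule integral_mix) (use i in auto)
  finally show "cexp A (cexp B f) x = cexp (A \<inter> B) f x"
    by (simp add: cexp_def mix_mix)
qed

lemma cexp_shift:
  assumes [measurable]: "f \<in> borel_measurable P" and x: "x \<in> space P"
  shows "cexp A f (shift t x) = cexp ((\<lambda>i. i + t) ` A) (\<lambda>x. f (shift t x)) x"
proof -
  have [measurable]: "shift t x \<in> space P"
    using x by (auto simp: shift_def space_PiM PiE_iff)
  have "cexp A f (shift t x) = (\<integral>y. f (mix A (shift t x) (shift t y)) \<partial>P)"
    unfolding cexp_def by (rule integral_shift[symmetric]) measurable
  then show ?thesis by (simp add: mix_shift cexp_def)
qed

lemma Lp_le_imp_integrable:
  assumes "Lp_le P p f a" "p \<ge> 1" shows "integrable P f"
proof -
  note [measurable] = Lp_le_measurable[OF assms(1)]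
  have "\<bar>f x\<bar> \<le> 1 + \<bar>f x\<bar> ^ p" for x
  proof (cases "\<bar>f x\<bar> \<le> 1")
    case False
    then show ?thesis using power_increasing[of 1 p "\<bar>f x\<bar>"] assms(2) by simp
  qed (simp add: add_increasing2)
  then show ?thesis
    using assms(1) by (intro Bochner_Integration.integrable_bound[of P "\<lambda>x. 1 + \<bar>f x\<bar> ^ p" f]) (auto simp: Lp_le_def)
qed

lemma convex_on_abs_power: "p \<ge> 1 \<Longrightarrow> convex_on UNIV (\<lambda>x::real. \<bar>x\<bar> ^ p)"
proof (rule convex_onI)
  fix t x y :: real assume "p \<ge> 1" "0 < t" "t < 1"
  then show "\<bar>(1 - t) *\<^sub>R x + t *\<^sub>R y\<bar> ^ p \<le> (1 - t) * \<bar>x\<bar> ^ p + t * \<bar>y\<bar> ^ p"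
    using convex_abs_power[of "1 - t" p x y] by simp
qed simp

text \<open>Jensen's inequality for each fixed first argument, then Fubini. Conditional expectations
  are marginals of this kind, hence contractions in L^p.\<close>

lemma Lp_le_marginal:
  fixes F :: "(int \<Rightarrow> 's) \<times> (int \<Rightarrow> 's) \<Rightarrow> real"
  assumes F: "Lp_le (P \<Otimes>\<^sub>M P) p F a" and p: "p \<ge> 1"
  shows "Lp_le P p (\<lambda>x. \<integral>y. F (x, y) \<partial>P) a"
proof -
  note [measurable] = Lp_le_measurable[OF F]
  note int = Lp_le_integrable[OF F]
  have le: "AE x in P. \<bar>\<integral>y. F (x, y) \<partial>P\<bar> ^ p \<le> (\<integral>y. \<bar>F (x, y)\<bar> ^ p \<partial>P)"
    using P2.AE_integrable_fst'[OF int] AE_space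
  proof eventually_elim
    fix x assume i: "integrable P (\<lambda>y. \<bar>F (x, y)\<bar> ^ p)" and [simp]: "x \<in> space P"
    have "Lp_le P p (\<lambda>y. F (x, y)) (root p (\<integral>y. \<bar>F (x, y)\<bar> ^ p \<partial>P))"
      using i p by (intro Lp_leI_root) auto
    then have "integrable P (\<lambda>y. F (x, y))" by (rule Lp_le_imp_integrable[OF _ p])
    then show "\<bar>\<integral>y. F (x, y) \<partial>P\<bar> ^ p \<le> (\<integral>y. \<bar>F (x, y)\<bar> ^ p \<partial>P)"
      using jensens_inequality[of "\<lambda>y. F (x, y)" UNIV 0 0 "\<lambda>z. \<bar>z\<bar> ^ p"] i convex_on_abs_power[OF p]
      by simp
  qed
  have i1: "integrable P (\<lambda>x. \<integral>y. \<bar>F (x, y)\<bar> ^ p \<partial>P)"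
    by (rule P2.integrable_fst'[OF int])
  have i2: "integrable P (\<lambda>x. \<bar>\<integral>y. F (x, y) \<partial>P\<bar> ^ p)"
    by (rule Bochner_Integration.integrable_bound[OF i1]) (use le in \<open>auto elim!: eventually_mono\<close>)
  have "(\<integral>x. \<bar>\<integral>y. F (x, y) \<partial>P\<bar> ^ p \<partial>P) \<le> (\<integral>x. (\<integral>y. \<bar>F (x, y)\<bar> ^ p \<partial>P) \<partial>P)"
    by (rule integral_mono_AE[OF i2 i1 le])
  also have "\<dots> = (\<integral>z. \<bar>F z\<bar> ^ p \<partial>(P \<Otimes>\<^sub>M P))"
    by (rule P2.integral_fst'[OF int])
  also have "\<dots> \<le> a ^ p" by (rule Lp_le_integral[OF F])
  finally show ?thesis using i2 Lp_le_nonneg[OF F] by (simp add: Lp_le_def)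
qed

lemma Lp_le_mix: 
  assumes "Lp_le P p f a" shows "Lp_le (P \<Otimes>\<^sub>M P) p (\<lambda>z. f (mix A (fst z) (snd z))) a"
proof -
  note [measurable] = Lp_le_measurable[OF assms]
  show ?thesis
    using assms integrable_mix[of "\<lambda>x. \<bar>f x\<bar> ^ p" A] integral_mix[of "\<lambda>x. \<bar>f x\<bar> ^ p" A]
    by (auto simp: Lp_le_def)
qed

lemma Lp_le_cexp:
  assumes "Lp_le P p f a" "p \<ge> 1" shows "Lp_le P p (cexp A f) a"
  using Lp_le_marginal[OF Lp_le_mix[OF assms(1), of A] assms(2)] by (simp add: cexp_def[abs_def])

text \<open>The only way in which the coupling condition enters.\<close>
lemma Lp_le_cexp_diff:
  assumes f: "integrable P f" and c: "Lp_le (P \<Otimes>\<^sub>M P) p (\<lambda>z. f (fst z) - f (mix B (fst z) (snd z))) c"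
    and p: "p \<ge> 1"
  shows "Lp_le P p (\<lambda>x. cexp A f x - cexp (A \<inter> B) f x) c"
proof -
  have [measurable]: "f \<in> borel_measurable P" using f by auto
  \<comment> \<open>Integrating out the second copy turns the coupling difference into f minus its
    conditional expectation given \<open>B\<close>. Projecting onto \<open>A\<close> does not
    increase the norm.\<close>
  have "Lp_le P p (\<lambda>x. \<integral>y. f x - f (mix B x y) \<partial>P) c"
    using Lp_le_marginal[OF c p] by simp
  then have 1: "Lp_le P p (\<lambda>x. f x - cexp B f x) c"
  proof (rule Lp_le_cong_AE)
    show "AE x in P. (\<integral>y. f x - f (mix B x y) \<partial>P) = f x - cexp B f x"
      using AE_integrable_mix[OF f, of B] by eventually_elim (simp add: cexp_def prob_space)
  qed measurable
  have "AE x in P. cexp A (\<lambda>x. f x - cexp B f x) x = cexp A f x - cexp (A \<inter> B) f x"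
    using cexp_diff[OF f integrable_cexp[OF f, of B], of A] cexp_tower[OF f, of A B]
    by eventually_elim simp
  then show ?thesis
    by (rule Lp_le_cong_AE[OF Lp_le_cexp[OF 1 p, of A]]) measurable
qed

text \<open>The defining property of conditional expectation. As \<open>h\<close> ignores the
  resampled coordinates, it can be moved inside the inner integral.\<close>

lemma integral_mult_cexp:
  assumes h: "dep C h" and [measurable]: "h \<in> borel_measurable P" "f \<in> borel_measurable P"
    and i: "integrable P (\<lambda>x. h x * f x)"
  shows "(\<integral>x. h x * cexp C f x \<partial>P) = (\<integral>x. h x * f x \<partial>P)"
proof -
  have "(\<integral>x. h x * cexp C f x \<partial>P) = (\<integral>x. (\<integral>y. h (mix C x y) * f (mix C x y) \<partial>P) \<partial>P)"
    by (simp add: cexp_def mix_eq[OF h])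
  also have "\<dots> = (\<integral>z. h (mix C (fst z) (snd z)) * f (mix C (fst z) (snd z)) \<partial>(P \<Otimes>\<^sub>M P))"
    using P2.integral_fst'[OF integrable_mix[OF i, of C]] by simp
  also have "\<dots> = (\<integral>x. h x * f x \<partial>P)"
    using integral_mix[of "\<lambda>x. h x * f x" C] by simp
  finally show ?thesis .
qed

text \<open>Against a function of the coordinates in \<open>C\<close>, a further conditioning on
  \<open>C\<close> costs nothing, and the tower property intersects the two sets.\<close>

lemma integral_mult_cexp_Int:
  assumes h: "dep C h" and [measurable]: "h \<in> borel_measurable P" and f: "integrable P f"
    and i: "integrable P (\<lambda>x. h x * cexp A f x)"
  shows "(\<integral>x. h x * cexp A f x \<partial>P) = (\<integral>x. h x * cexp (A \<inter> C) f x \<partial>P)"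
proof -
  have [measurable]: "f \<in> borel_measurable P" using f by auto
  have "(\<integral>x. h x * cexp A f x \<partial>P) = (\<integral>x. h x * cexp C (cexp A f) x \<partial>P)"
    by (rule integral_mult_cexp[symmetric]) (use h i in auto)
  also have "\<dots> = (\<integral>x. h x * cexp (A \<inter> C) f x \<partial>P)"
  proof (rule integral_cong_AE)
    show "AE x in P. h x * cexp C (cexp A f) x = h x * cexp (A \<inter> C) f x"
      using cexp_tower[OF f, of C A] by eventually_elim (simp add: Int_commute)
  qed measurable
  finally show ?thesis .
qed

text \<open>In \<open>mix A x y\<close> the function \<open>f\<close> reads only \<open>x\<close>
  and \<open>h\<close> only \<open>y\<close>, so Fubini factorises the integral. The values lie in a
  general normed field because both second moments and complex exponentials are factorised.\<close>

lemma integral_mult_indep: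
  fixes f h :: "_ \<Rightarrow> 'b::{real_normed_field, banach, second_countable_topology}"
  assumes f: "dep A f" "integrable P f" and h: "dep B h" "integrable P h" and disj: "A \<inter> B = {}"
  shows "(\<integral>x. f x * h x \<partial>P) = (\<integral>x. f x \<partial>P) * (\<integral>x. h x \<partial>P)"
proof -
  have [measurable]: "f \<in> borel_measurable P" "h \<in> borel_measurable P" using f h by auto
  have eq: "f (mix A x y) * h (mix A x y) = f x * h y" for x y
    using mix_eq[OF f(1)] mix_eq'[OF h(1) disj] by metis
  have int: "integrable (P \<Otimes>\<^sub>M P) (\<lambda>z. f (fst z) * h (snd z))"
  proof (rule P2.Fubini_integrable)
    show "integrable P (\<lambda>x. \<integral>y. norm (f (fst (x, y)) * h (snd (x, y))) \<partial>P)"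
      using f by (auto simp: norm_mult)
    show "AE x in P. integrable P (\<lambda>y. f (fst (x, y)) * h (snd (x, y)))"
      using h by auto
  qed measurable
  have "(\<integral>x. f x * h x \<partial>P) = (\<integral>z. f (fst z) * h (snd z) \<partial>(P \<Otimes>\<^sub>M P))"
    using integral_mix[of "\<lambda>x. f x * h x" A] by (simp add: eq)
  also have "\<dots> = (\<integral>x. f x \<partial>P) * (\<integral>x. h x \<partial>P)"
    using P2.integral_fst'[OF int] f h by simp
  finally show "(\<integral>x. f x * h x \<partial>P) = (\<integral>x. f x \<partial>P) * (\<integral>x. h x \<partial>P)" .
qed

end

section \<open>Martingale differences and quadratic forms\<close>

lemma dep_add: "dep A f \<Longrightarrow> dep A g \<Longrightarrow> dep A (\<lambda>x. f x + g x)"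
  and dep_diff: "dep A f \<Longrightarrow> dep A g \<Longrightarrow> dep A (\<lambda>x. f x - g x)"
  and dep_mult: "dep A f \<Longrightarrow> dep A g \<Longrightarrow> dep A (\<lambda>x. f x * g x)"
  and dep_cmult: "dep A f \<Longrightarrow> dep A (\<lambda>x. c * f x)"
  unfolding dep_def by metis+

text \<open>With \<open>u < v\<close> the inner sum belongs to the past of \<open>v\<close>, so the
  summands over \<open>v\<close> are orthogonal for martingale differences. Two index sets and two
  processes are needed because the projections with different delays live on shifted time
  ranges.\<close>

definition quad :: "int set \<Rightarrow> int set \<Rightarrow> (int \<Rightarrow> int \<Rightarrow> real) \<Rightarrow> (int \<Rightarrow> 'c \<Rightarrow> real) \<Rightarrow> (int \<Rightarrow> 'c \<Rightarrow> real) \<Rightarrow> 'c \<Rightarrow> real" where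
  "quad I J c Y Z x = (\<Sum>v\<in>J. \<Sum>u | u \<in> I \<and> u < v. c u v * (Y u x * Z v x))"

definition offdiag :: "int set \<Rightarrow> int set \<Rightarrow> (int \<Rightarrow> int \<Rightarrow> real) \<Rightarrow> (int \<Rightarrow> 'c \<Rightarrow> real) \<Rightarrow> (int \<Rightarrow> 'c \<Rightarrow> real) \<Rightarrow> 'c \<Rightarrow> real" where
  "offdiag I J c Y Z x = (\<Sum>v\<in>J. \<Sum>u\<in>I - {v}. c u v * (Y u x * Z v x))"

text \<open>Terms with \<open>u > v\<close> become a triangle of the first kind once the two
  processes exchange their roles.\<close>

lemma offdiag_eq_quad:
  assumes fin: "finite I" "finite J"
  shows "offdiag I J c Y Z x = quad I J c Y Z x + quad J I (\<lambda>u v. c v u) Z Y x"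
proof -
  have "offdiag I J c Y Z x =
     (\<Sum>v\<in>J. (\<Sum>u | u \<in> I \<and> u < v. c u v * (Y u x * Z v x)) + (\<Sum>u | u \<in> I \<and> v < u. c u v * (Y u x * Z v x)))"
    unfolding offdiag_def using fin
    by (intro sum.cong refl, subst sum.union_disjoint[symmetric]) (auto intro!: sum.cong)
  also have "\<dots> = (\<Sum>v\<in>J. \<Sum>u | u \<in> I \<and> u < v. c u v * (Y u x * Z v x)) +
      (\<Sum>v\<in>J. \<Sum>u | u \<in> I \<and> v < u. c u v * (Y u x * Z v x))"
    by (rule sum.distrib)
  also have "(\<Sum>v\<in>J. \<Sum>u | u \<in> I \<and> v < u. c u v * (Y u x * Z v x)) = (\<Sum>u\<in>I. \<Sum>v | v \<in> J \<and> v < u. c u v * (Y u x * Z v x))"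
    by (rule sum.swap_restrict[OF fin(2,1)])
  finally show ?thesis by (simp add: quad_def mult.commute[of "Y _ x"])
qed

context iid_space
begin

section \<open>Martingale differences with fourth moments\<close>

definition L4 :: "((int \<Rightarrow> 's) \<Rightarrow> real) \<Rightarrow> bool" where
  "L4 f \<longleftrightarrow> (\<exists>a. Lp_le P 4 f a)"

lemma L4I: "Lp_le P 4 f a \<Longrightarrow> L4 f"
  by (auto simp: L4_def)

lemma L4E: "L4 f \<Longrightarrow> (\<And>a. Lp_le P 4 f a \<Longrightarrow> thesis) \<Longrightarrow> thesis"
  by (auto simp: L4_def)

lemma L4_measurable [measurable_dest]: "L4 f \<Longrightarrow> f \<in> borel_measurable P"
  by (auto simp: L4_def Lp_le_def)

lemma L4_add: "L4 f \<Longrightarrow> L4 g \<Longrightarrow> L4 (\<lambda>x. f x + g x)"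
  by (elim L4E) (rule L4I, rule Lp_le_add, auto)

lemma L4_diff: "L4 f \<Longrightarrow> L4 g \<Longrightarrow> L4 (\<lambda>x. f x - g x)"
  by (elim L4E) (rule L4I, rule Lp_le_diff, auto)

lemma L4_cmult: "L4 f \<Longrightarrow> L4 (\<lambda>x. c * f x)"
  by (elim L4E) (rule L4I, rule Lp_le_cmult)

lemma L4_const: "L4 (\<lambda>x. c)"
  by (rule L4I, rule Lp_le_const)

lemma L4_mult_bounded:
  assumes "L4 f" "g \<in> borel_measurable P" "\<And>x. x \<in> space P \<Longrightarrow> \<bar>g x\<bar> \<le> B"
  shows "L4 (\<lambda>x. g x * f x)"
proof -
  obtain a where a: "Lp_le P 4 f a" using assms(1) by (rule L4E)
  note [measurable] = assms(2) Lp_le_measurable[OF a]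
  have "Lp_le P 4 (\<lambda>x. g x * f x) (\<bar>B\<bar> * a)"
    by (rule Lp_le_dominated[OF Lp_le_cmult[OF a]])
       (use assms(3) in \<open>auto simp: abs_mult intro!: mult_right_mono order_trans[OF assms(3)]\<close>)
  then show ?thesis by (rule L4I)
qed

lemma L4_cexp: "L4 f \<Longrightarrow> L4 (cexp A f)"
  by (elim L4E) (rule L4I, rule Lp_le_cexp, auto)

lemma L4_shift: "L4 f \<Longrightarrow> L4 (\<lambda>x. f (shift t x))"
  by (elim L4E) (rule L4I, rule Lp_le_shift)

lemma L4_imp_integrable: "L4 f \<Longrightarrow> integrable P f"
  by (elim L4E) (rule L4_integrable)

lemma L4_integrable_mult: "L4 f \<Longrightarrow> L4 g \<Longrightarrow> integrable P (\<lambda>x. f x * g x)"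
  by (elim L4E) (rule L4_mult_integrable)

lemma L4_integrable_mult4:
  "L4 f \<Longrightarrow> L4 g \<Longrightarrow> L4 h \<Longrightarrow> L4 k \<Longrightarrow> integrable P (\<lambda>x. f x * g x * (h x * k x))"
  by (elim L4E) (rule L4_mult4_integrable)

text \<open>Everything is at most a product of four functions in $L^4$, so it suffices to require
  orthogonality to products of three such functions of the past.\<close>
definition mdiff :: "int \<Rightarrow> ((int \<Rightarrow> 's) \<Rightarrow> real) \<Rightarrow> bool" where
  "mdiff t d \<longleftrightarrow> dep {..t} d \<and> L4 d \<and>
     (\<forall>h1 h2 h3. L4 h1 \<and> L4 h2 \<and> L4 h3 \<and> dep {..<t} h1 \<and> dep {..<t} h2 \<and> dep {..<t} h3 \<longrightarrow>
        (\<integral>x. h1 x * h2 x * (h3 x * d x) \<partial>P) = 0)"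

lemma mdiff_dep: "mdiff t d \<Longrightarrow> dep {..t} d"
  and mdiff_L4: "mdiff t d \<Longrightarrow> L4 d"
  by (auto simp: mdiff_def)

lemma mdiff_orth3:
  "mdiff t d \<Longrightarrow> L4 h1 \<Longrightarrow> L4 h2 \<Longrightarrow> L4 h3 \<Longrightarrow> dep {..<t} h1 \<Longrightarrow> dep {..<t} h2 \<Longrightarrow> dep {..<t} h3 \<Longrightarrow>
    (\<integral>x. h1 x * h2 x * (h3 x * d x) \<partial>P) = 0"
  unfolding mdiff_def by blast

lemma mdiff_dep_less: "mdiff s d \<Longrightarrow> s < t \<Longrightarrow> dep {..<t} d"
  by (rule dep_mono[OF mdiff_dep]) auto

lemma mdiff_add:
  assumes "mdiff t d" "mdiff t d'" shows "mdiff t (\<lambda>x. d x + d' x)"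
  unfolding mdiff_def
proof (intro conjI allI impI)
  show "dep {..t} (\<lambda>x. d x + d' x)" by (intro dep_add mdiff_dep assms)
  show "L4 (\<lambda>x. d x + d' x)" using assms by (intro L4_add mdiff_L4)
  fix h1 h2 h3 :: "(int \<Rightarrow> 's) \<Rightarrow> real"
  assume h: "L4 h1 \<and> L4 h2 \<and> L4 h3 \<and> dep {..<t} h1 \<and> dep {..<t} h2 \<and> dep {..<t} h3"
  have "(\<integral>x. h1 x * h2 x * (h3 x * (d x + d' x)) \<partial>P) =
    (\<integral>x. h1 x * h2 x * (h3 x * d x) + h1 x * h2 x * (h3 x * d' x) \<partial>P)"
    by (simp add: algebra_simps)
  also have "\<dots> = 0"
    using h assms by (subst Bochner_Integration.integral_add) (auto simp: mdiff_orth3 intro!: L4_integrable_mult4 mdiff_L4)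
  finally show "(\<integral>x. h1 x * h2 x * (h3 x * (d x + d' x)) \<partial>P) = 0" .
qed

lemma mdiff_cmult:
  assumes "mdiff t d" shows "mdiff t (\<lambda>x. c * d x)"
  unfolding mdiff_def
proof (intro conjI allI impI)
  show "dep {..t} (\<lambda>x. c * d x)" by (intro dep_cmult mdiff_dep assms)
  show "L4 (\<lambda>x. c * d x)" using assms by (intro L4_cmult mdiff_L4)
  fix h1 h2 h3 :: "(int \<Rightarrow> 's) \<Rightarrow> real"
  assume h: "L4 h1 \<and> L4 h2 \<and> L4 h3 \<and> dep {..<t} h1 \<and> dep {..<t} h2 \<and> dep {..<t} h3"
  have "(\<integral>x. h1 x * h2 x * (h3 x * (c * d x)) \<partial>P) = (\<integral>x. c * (h1 x * h2 x * (h3 x * d x)) \<partial>P)"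
    by (simp add: algebra_simps)
  also have "\<dots> = 0"
    using h assms by (simp add: mdiff_orth3)
  finally show "(\<integral>x. h1 x * h2 x * (h3 x * (c * d x)) \<partial>P) = 0" .
qed

lemma mdiff_zero: "mdiff t (\<lambda>x. 0)"
  unfolding mdiff_def by (auto simp: dep_const L4_const)

lemma mdiff_sum: "(\<And>i. i \<in> I \<Longrightarrow> mdiff t (d i)) \<Longrightarrow> mdiff t (\<lambda>x. \<Sum>i\<in>I. d i x)"
proof (induction I rule: infinite_finite_induct)
  case (insert i I)
  then show ?case using mdiff_add[of t "d i" "\<lambda>x. \<Sum>i\<in>I. d i x"] by simp
qed (simp_all add: mdiff_zero)

lemma mdiff_diff: "mdiff t d \<Longrightarrow> mdiff t d' \<Longrightarrow> mdiff t (\<lambda>x. d x - d' x)"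
  using mdiff_add[of t d "\<lambda>x. (-1) * d' x"] mdiff_cmult[of t d' "-1"] by simp

text \<open>The factor \<open>g\<close> is absorbed into the test function \<open>h3\<close>, which
  stays in L^4 because \<open>g\<close> is bounded. For quadratic forms this is where truncation
  pays off.\<close>

lemma mdiff_mult_bounded:
  assumes d: "mdiff t d" and g: "dep {..<t} g" "g \<in> borel_measurable P" "\<And>x. x \<in> space P \<Longrightarrow> \<bar>g x\<bar> \<le> B"
  shows "mdiff t (\<lambda>x. g x * d x)"
  unfolding mdiff_def
proof (intro conjI allI impI)
  show "dep {..t} (\<lambda>x. g x * d x)"
    by (intro dep_mult mdiff_dep[OF d] dep_mono[OF g(1)]) auto
  show "L4 (\<lambda>x. g x * d x)" by (rule L4_mult_bounded[OF mdiff_L4[OF d] g(2,3)])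
  fix h1 h2 h3 :: "(int \<Rightarrow> 's) \<Rightarrow> real"
  assume h: "L4 h1 \<and> L4 h2 \<and> L4 h3 \<and> dep {..<t} h1 \<and> dep {..<t} h2 \<and> dep {..<t} h3"
  then have "L4 (\<lambda>x. g x * h3 x)" "dep {..<t} (\<lambda>x. g x * h3 x)"
    by (auto intro: L4_mult_bounded[OF _ g(2,3)] dep_mult g(1))
  with h have "(\<integral>x. h1 x * h2 x * ((g x * h3 x) * d x) \<partial>P) = 0"
    by (intro mdiff_orth3[OF d]) auto
  then show "(\<integral>x. h1 x * h2 x * (h3 x * (g x * d x)) \<partial>P) = 0"
    by (simp add: ac_simps)
qed

text \<open>For \<open>A = {..t}\<close> this is the projection P_t; a finite window
  \<open>A\<close> gives its local version, which is still a martingale difference.\<close>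

lemma mdiff_cexp:
  assumes f: "L4 f" and A: "A \<subseteq> {..t}"
  shows "mdiff t (\<lambda>x. cexp A f x - cexp (A \<inter> {..<t}) f x)"
  unfolding mdiff_def
proof (intro conjI allI impI)
  show "dep {..t} (\<lambda>x. cexp A f x - cexp (A \<inter> {..<t}) f x)"
    by (intro dep_diff; rule dep_mono[OF dep_cexp]) (use A in auto)
  show "L4 (\<lambda>x. cexp A f x - cexp (A \<inter> {..<t}) f x)"
    by (intro L4_diff L4_cexp f)
  fix h1 h2 h3 :: "(int \<Rightarrow> 's) \<Rightarrow> real"
  assume h: "L4 h1 \<and> L4 h2 \<and> L4 h3 \<and> dep {..<t} h1 \<and> dep {..<t} h2 \<and> dep {..<t} h3"
  note [measurable] = L4_measurable[of h1] L4_measurable[of h2] L4_measurable[of h3]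
  define k where "k x = h1 x * h2 x * h3 x" for x
  have k: "dep {..<t} k"
    unfolding k_def[abs_def] by (intro dep_mult) (use h in auto)
  have [measurable]: "k \<in> borel_measurable P" using h unfolding k_def[abs_def] by simp
  have i: "integrable P (\<lambda>x. k x * cexp B f x)" for B
    using L4_integrable_mult4[of h1 h2 h3 "cexp B f"] h L4_cexp[OF f] by (simp add: k_def mult.assoc)
  have "(\<integral>x. k x * cexp A f x \<partial>P) = (\<integral>x. k x * cexp (A \<inter> {..<t}) f x \<partial>P)"
    by (rule integral_mult_cexp_Int[OF k]) (use L4_imp_integrable[OF f] i in auto)
  then have "(\<integral>x. k x * cexp A f x - k x * cexp (A \<inter> {..<t}) f x \<partial>P) = 0"
    using i by simp
  then show "(\<integral>x. h1 x * h2 x * (h3 x * (cexp A f x - cexp (A \<inter> {..<t}) f x)) \<partial>P) = 0"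
    by (simp add: k_def algebra_simps)
qed

lemma mdiff_orth: 
  assumes "mdiff u Y" "mdiff v Z" "u \<noteq> v"
  shows "(\<integral>x. Y x * Z x \<partial>P) = 0"
proof (cases "u < v")
  case True
  then show ?thesis
    using mdiff_orth3[OF assms(2) L4_const[of 1] L4_const[of 1] mdiff_L4[OF assms(1)]] assms(1)
    by (auto simp: dep_const mdiff_dep_less)
next
  case False
  then show ?thesis
    using mdiff_orth3[OF assms(1) L4_const[of 1] L4_const[of 1] mdiff_L4[OF assms(2)]] assms
    by (auto simp: dep_const mdiff_dep_less mult.commute[of "Y _"])
qed

text \<open>Induction on the largest index. In the expansion of (M + d)^4 the term M^3 d integrates
  to 0, and the other terms are controlled by the L^4 bounds through products in L^2.\<close>

lemma burkholder4:
  assumes "finite I" "\<And>t. t \<in> I \<Longrightarrow> mdiff t (d t)" "\<And>t. t \<in> I \<Longrightarrow> Lp_le P 4 (d t) (\<delta> t)"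
  shows "Lp_le P 4 (\<lambda>x. \<Sum>t\<in>I. d t x) (2 * sqrt (\<Sum>t\<in>I. (\<delta> t)\<^sup>2))"
  using assms
proof (induction I rule: finite_linorder_max_induct)
  case empty
  then show ?case by (simp add: Lp_le_zero)
next
  case (insert b A)
  define M where "M x = (\<Sum>t\<in>A. d t x)" for x
  define v where "v = (\<Sum>t\<in>A. (\<delta> t)\<^sup>2)"
  have v0: "0 \<le> v" unfolding v_def by (intro sum_nonneg) auto
  have M: "Lp_le P 4 M (2 * sqrt v)" using insert unfolding M_def[abs_def] v_def by auto
  have d: "mdiff b (d b)" "Lp_le P 4 (d b) (\<delta> b)" using insert.prems by auto
  have dM: "dep {..<b} M"
    unfolding M_def[abs_def] using insert by (intro dep_sum mdiff_dep_less[of _ "d _"]) auto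
  note [measurable] = Lp_le_measurable[OF M] Lp_le_measurable[OF d(2)]
  have LM: "L4 M" and Ld: "L4 (d b)" using M d by (auto intro: L4I)
  have 0: "(\<integral>x. M x * M x * (M x * d b x) \<partial>P) = 0"
    by (rule mdiff_orth3[OF d(1)]) (auto intro: LM dM)
  have MM: "Lp_le P 2 (\<lambda>x. M x * d b x) (2 * sqrt v * \<delta> b)" by (rule L4_mult[OF M d(2)])
  have int: "integrable P (\<lambda>x. M x ^ 4)" "integrable P (\<lambda>x. d b x ^ 4)"
    "integrable P (\<lambda>x. M x * M x * (M x * d b x))" "integrable P (\<lambda>x. (M x * d b x)\<^sup>2)"
    "integrable P (\<lambda>x. M x * d b x * (d b x * d b x))"
    using M d MM LM Ld by (auto simp: Lp_le_def intro!: L4_integrable_mult4)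
  have pw: "(M x + d b x) ^ 4 = M x ^ 4 + 4 * (M x * M x * (M x * d b x)) + 6 * (M x * d b x)\<^sup>2
      + 4 * (M x * d b x * (d b x * d b x)) + d b x ^ 4" for x
    by (simp add: power4_eq_xxxx power2_eq_square algebra_simps)
  have int': "integrable P (\<lambda>x. (M x + d b x) ^ 4)"
    unfolding pw by (intro Bochner_Integration.integrable_add integrable_mult_right int)
  \<comment> \<open>The mixed term 4 M d^3 is at most 2 M^2 d^2 + 2 d^4, so only even powers
    remain.\<close>
  have le: "(M x + d b x) ^ 4 \<le> M x ^ 4 + 4 * (M x * M x * (M x * d b x)) + 8 * (M x * d b x)\<^sup>2 + 3 * d b x ^ 4" for x
  proof -
    have "0 \<le> 2 * (M x * d b x - d b x * d b x)\<^sup>2" by simp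
    then show ?thesis unfolding pw
      by (simp add: power4_eq_xxxx power2_eq_square algebra_simps)
  qed
  have "(\<integral>x. (M x + d b x) ^ 4 \<partial>P) \<le>
    (\<integral>x. M x ^ 4 + 4 * (M x * M x * (M x * d b x)) + 8 * (M x * d b x)\<^sup>2 + 3 * d b x ^ 4 \<partial>P)"
    by (rule integral_mono[OF int' _ le]) (intro Bochner_Integration.integrable_add integrable_mult_right int)
  also have "\<dots> = (\<integral>x. M x ^ 4 \<partial>P) + 8 * (\<integral>x. (M x * d b x)\<^sup>2 \<partial>P) + 3 * (\<integral>x. d b x ^ 4 \<partial>P)"
    using int 0 by simp
  also have "\<dots> \<le> (2 * sqrt v) ^ 4 + 8 * (2 * sqrt v * \<delta> b)\<^sup>2 + 3 * \<delta> b ^ 4"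
    using M d MM by (intro add_mono mult_left_mono) (auto simp: Lp_le_def)
  also have "\<dots> = 16 * v\<^sup>2 + 32 * v * (\<delta> b)\<^sup>2 + 3 * ((\<delta> b)\<^sup>2)\<^sup>2"
  proof -
    have "(2 * sqrt v) ^ 4 = 16 * ((sqrt v)\<^sup>2)\<^sup>2" by (simp add: power_mult_distrib flip: power_mult)
    moreover have "(2 * sqrt v * \<delta> b)\<^sup>2 = 4 * (sqrt v)\<^sup>2 * (\<delta> b)\<^sup>2" by (simp add: power_mult_distrib)
    ultimately show ?thesis using v0 by (simp flip: power_mult)
  qed
  \<comment> \<open>The origin of the factor 2: with K in its place the induction closes if 8 K^2
    \<le> 2 K^4 and 3 \<le> K^4, so 2 is the least constant for this argument.\<close>
  also have "\<dots> \<le> 16 * ((\<delta> b)\<^sup>2 + v)\<^sup>2"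
  proof -
    have "16 * (d + v)\<^sup>2 - (16 * v\<^sup>2 + 32 * v * d + 3 * d\<^sup>2) = 13 * d\<^sup>2" for d
      by (simp add: power2_eq_square algebra_simps)
    from this[of "(\<delta> b)\<^sup>2"] show ?thesis by (metis diff_ge_0_iff_ge mult_nonneg_nonneg zero_le_numeral zero_le_power2)
  qed
  also have "\<dots> = (2 * sqrt ((\<delta> b)\<^sup>2 + v)) ^ 4"
  proof -
    have "(2 * sqrt ((\<delta> b)\<^sup>2 + v)) ^ 4 = 16 * ((sqrt ((\<delta> b)\<^sup>2 + v))\<^sup>2)\<^sup>2"
      by (simp add: power_mult_distrib flip: power_mult)
    then show ?thesis using v0 by (simp add: add.commute)
  qed
  finally have "Lp_le P 4 (\<lambda>x. M x + d b x) (2 * sqrt ((\<delta> b)\<^sup>2 + v))"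
    using int' v0 by (auto simp: Lp_le_def)
  moreover have "b \<notin> A" using insert by auto
  ultimately show ?case
    using insert(1) by (simp add: M_def v_def add.commute)
qed

lemma L2_sum_orth:
  fixes \<xi> :: "int \<Rightarrow> (int \<Rightarrow> 's) \<Rightarrow> real"
  assumes "finite I" "\<And>t. t \<in> I \<Longrightarrow> Lp_le P 2 (\<xi> t) (\<beta> t)"
    and "\<And>s t. s \<in> I \<Longrightarrow> t \<in> I \<Longrightarrow> s < t \<Longrightarrow> (\<integral>x. \<xi> s x * \<xi> t x \<partial>P) = 0"
  shows "(\<integral>x. (\<Sum>t\<in>I. \<xi> t x)\<^sup>2 \<partial>P) = (\<Sum>t\<in>I. \<integral>x. (\<xi> t x)\<^sup>2 \<partial>P)"
    and "Lp_le P 2 (\<lambda>x. \<Sum>t\<in>I. \<xi> t x) (sqrt (\<Sum>t\<in>I. (\<beta> t)\<^sup>2))"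
proof -
  have int: "integrable P (\<lambda>x. \<xi> s x * \<xi> t x)" if "s \<in> I" "t \<in> I" for s t
    by (rule L2_mult_integrable[OF assms(2)[OF that(1)] assms(2)[OF that(2)]])
  have meas[measurable]: "\<And>t. t \<in> I \<Longrightarrow> \<xi> t \<in> borel_measurable P"
    using assms(2) Lp_le_measurable by blast
  have orth: "(\<integral>x. \<xi> s x * \<xi> t x \<partial>P) = (if s = t then \<integral>x. (\<xi> s x)\<^sup>2 \<partial>P else 0)" if "s \<in> I" "t \<in> I" for s t
    using assms(3)[of s t] assms(3)[of t s] that
    by (cases "s < t") (auto simp: power2_eq_square mult.commute[of "\<xi> s _"])
  have "(\<integral>x. (\<Sum>t\<in>I. \<xi> t x)\<^sup>2 \<partial>P) = (\<integral>x. (\<Sum>s\<in>I. \<Sum>t\<in>I. \<xi> s x * \<xi> t x) \<partial>P)"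
    by (simp add: power2_eq_square sum_product)
  also have "\<dots> = (\<Sum>s\<in>I. \<Sum>t\<in>I. \<integral>x. \<xi> s x * \<xi> t x \<partial>P)"
    using int by (subst Bochner_Integration.integral_sum) (auto intro!: sum.cong Bochner_Integration.integral_sum)
  also have "\<dots> = (\<Sum>t\<in>I. \<integral>x. (\<xi> t x)\<^sup>2 \<partial>P)"
    using assms(1) by (intro sum.cong refl) (simp add: orth)
  finally show eq: "(\<integral>x. (\<Sum>t\<in>I. \<xi> t x)\<^sup>2 \<partial>P) = (\<Sum>t\<in>I. \<integral>x. (\<xi> t x)\<^sup>2 \<partial>P)" .
  show "Lp_le P 2 (\<lambda>x. \<Sum>t\<in>I. \<xi> t x) (sqrt (\<Sum>t\<in>I. (\<beta> t)\<^sup>2))"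
  proof (rule L2_leI)
    show "integrable P (\<lambda>x. (\<Sum>t\<in>I. \<xi> t x)\<^sup>2)"
      unfolding power2_eq_square sum_product by (intro Bochner_Integration.integrable_sum int)
    show "(\<integral>x. (\<Sum>t\<in>I. \<xi> t x)\<^sup>2 \<partial>P) \<le> (\<Sum>t\<in>I. (\<beta> t)\<^sup>2)"
      unfolding eq using assms(2) by (intro sum_mono) (auto simp: Lp_le_def)
  qed measurable
qed

text \<open>\<open>G v\<close> is a linear form in the past of \<open>v\<close>, bounded in L^4 by
  the moment inequality. Orthogonality for \<open>s < v\<close> tests \<open>Z v\<close> against the
  product of \<open>G s\<close>, \<open>Z s\<close> and \<open>G v\<close>, which are the three L^4
  factors allowed in \<open>mdiff\<close>.\<close>

lemma quad_step:
  fixes c :: "int \<Rightarrow> int \<Rightarrow> real"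
  assumes fin: "finite I" "finite J"
    and Y: "\<And>u. u \<in> I \<Longrightarrow> mdiff u (Y u)" "\<And>u. u \<in> I \<Longrightarrow> Lp_le P 4 (Y u) y"
    and Z: "\<And>v. v \<in> J \<Longrightarrow> mdiff v (Z v)" "\<And>v. v \<in> J \<Longrightarrow> Lp_le P 4 (Z v) z"
    and nn: "0 \<le> y" "0 \<le> z"
  defines "G \<equiv> \<lambda>v x. \<Sum>u | u \<in> I \<and> u < v. c u v * Y u x"
  shows "Lp_le P 4 (G v) (2 * y * sqrt (\<Sum>u | u \<in> I \<and> u < v. (c u v)\<^sup>2))" (is ?G)
    and "dep {..<v} (G v)" (is ?d)
    and "v \<in> J \<Longrightarrow> Lp_le P 2 (\<lambda>x. G v x * Z v x) (2 * y * z * sqrt (\<Sum>u | u \<in> I \<and> u < v. (c u v)\<^sup>2))" 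
    and "v \<in> J \<Longrightarrow> s \<in> J \<Longrightarrow> s < v \<Longrightarrow> (\<integral>x. (G s x * Z s x) * (G v x * Z v x) \<partial>P) = 0" 
proof -
  have G: "Lp_le P 4 (G v) (2 * y * sqrt (\<Sum>u | u \<in> I \<and> u < v. (c u v)\<^sup>2))" for v
  proof -
    have "Lp_le P 4 (G v) (2 * sqrt (\<Sum>u | u \<in> I \<and> u < v. (\<bar>c u v\<bar> * y)\<^sup>2))"
      unfolding G_def using fin Y by (intro burkholder4 mdiff_cmult Lp_le_cmult) auto
    also have "(\<Sum>u | u \<in> I \<and> u < v. (\<bar>c u v\<bar> * y)\<^sup>2) = y\<^sup>2 * (\<Sum>u | u \<in> I \<and> u < v. (c u v)\<^sup>2)"
      by (simp add: power_mult_distrib sum_distrib_left mult.commute)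
    also have "2 * sqrt \<dots> = 2 * y * sqrt (\<Sum>u | u \<in> I \<and> u < v. (c u v)\<^sup>2)"
      using nn by (simp add: real_sqrt_mult)
    finally show ?thesis .
  qed
  then show ?G .
  have dG: "dep {..<v} (G v)" for v
    unfolding G_def by (intro dep_sum dep_cmult mdiff_dep_less[OF Y(1)]) auto
  then show ?d .
  show "Lp_le P 2 (\<lambda>x. G v x * Z v x) (2 * y * z * sqrt (\<Sum>u | u \<in> I \<and> u < v. (c u v)\<^sup>2))" if "v \<in> J"
    using L4_mult[OF G[of v] Z(2)[OF that]] by (simp add: ac_simps)
  show "(\<integral>x. (G s x * Z s x) * (G v x * Z v x) \<partial>P) = 0" if "v \<in> J" "s \<in> J" "s < v"
    by (rule mdiff_orth3[OF Z(1)[OF that(1)]])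
       (use that dG in \<open>auto intro: L4I[OF G] mdiff_L4 Z mdiff_dep_less dep_mono[OF dG]\<close>)
qed

text \<open>Since the summands are orthogonal in \<open>v\<close>, only the Euclidean norm of the
  coefficients enters. For the weights \<open>wt\<close> that norm stays bounded in n, which makes
  the later estimates uniform.\<close>

lemma quad_bound:
  assumes fin: "finite I" "finite J"
    and Y: "\<And>u. u \<in> I \<Longrightarrow> mdiff u (Y u)" "\<And>u. u \<in> I \<Longrightarrow> Lp_le P 4 (Y u) y"
    and Z: "\<And>v. v \<in> J \<Longrightarrow> mdiff v (Z v)" "\<And>v. v \<in> J \<Longrightarrow> Lp_le P 4 (Z v) z"
    and nn: "0 \<le> y" "0 \<le> z"
  shows "Lp_le P 2 (quad I J c Y Z) (2 * y * z * sqrt (\<Sum>v\<in>J. \<Sum>u | u \<in> I \<and> u < v. (c u v)\<^sup>2))"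
proof -
  define G where "G = (\<lambda>v x. \<Sum>u | u \<in> I \<and> u < v. c u v * Y u x)"
  have *: "Lp_le P 2 (\<lambda>x. G v x * Z v x) (2 * y * z * sqrt (\<Sum>u | u \<in> I \<and> u < v. (c u v)\<^sup>2))" if "v \<in> J" for v
    unfolding G_def using quad_step(3)[where c = c, OF fin Y Z nn that] by blast
  have **: "(\<integral>x. (G s x * Z s x) * (G v x * Z v x) \<partial>P) = 0" if "v \<in> J" "s \<in> J" "s < v" for s v
    unfolding G_def using quad_step(4)[where c = c, OF fin Y Z nn that] by blast
  have "Lp_le P 2 (\<lambda>x. \<Sum>v\<in>J. G v x * Z v x)
    (sqrt (\<Sum>v\<in>J. (2 * y * z * sqrt (\<Sum>u | u \<in> I \<and> u < v. (c u v)\<^sup>2))\<^sup>2))"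
    by (rule L2_sum_orth(2)) (use * ** fin in auto)
  also have "(\<Sum>v\<in>J. (2 * y * z * sqrt (\<Sum>u | u \<in> I \<and> u < v. (c u v)\<^sup>2))\<^sup>2) =
     (2 * y * z)\<^sup>2 * (\<Sum>v\<in>J. \<Sum>u | u \<in> I \<and> u < v. (c u v)\<^sup>2)"
    by (simp add: power_mult_distrib sum_distrib_left sum_nonneg)
  also have "sqrt \<dots> = 2 * y * z * sqrt (\<Sum>v\<in>J. \<Sum>u | u \<in> I \<and> u < v. (c u v)\<^sup>2)"
    using nn by (simp add: real_sqrt_mult)
  also have "(\<lambda>x. \<Sum>v\<in>J. G v x * Z v x) = quad I J c Y Z"
    by (simp add: quad_def[abs_def] G_def sum_distrib_right mult.assoc)
  finally show ?thesis .
qed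

lemma offdiag_bound:
  assumes fin: "finite I" "finite J"
    and Y: "\<And>u. u \<in> I \<Longrightarrow> mdiff u (Y u)" "\<And>u. u \<in> I \<Longrightarrow> Lp_le P 4 (Y u) y"
    and Z: "\<And>v. v \<in> J \<Longrightarrow> mdiff v (Z v)" "\<And>v. v \<in> J \<Longrightarrow> Lp_le P 4 (Z v) z"
    and nn: "0 \<le> y" "0 \<le> z" and q: "(\<Sum>v\<in>J. \<Sum>u\<in>I. (c u v)\<^sup>2) \<le> q"
  shows "Lp_le P 2 (offdiag I J c Y Z) (4 * y * z * sqrt q)"
proof -
  have a: "(\<Sum>v\<in>J. \<Sum>u | u \<in> I \<and> u < v. (c u v)\<^sup>2) \<le> q"
    by (rule order_trans[OF _ q]) (intro sum_mono sum_mono2, use fin in auto)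
  have b: "(\<Sum>u\<in>I. \<Sum>v | v \<in> J \<and> v < u. (c u v)\<^sup>2) \<le> q"
    by (rule order_trans[OF _ q[unfolded sum.swap[of _ I J]]]) (intro sum_mono sum_mono2, use fin in auto)
  have "Lp_le P 2 (\<lambda>x. quad I J c Y Z x + quad J I (\<lambda>u v. c v u) Z Y x)
     (2 * y * z * sqrt (\<Sum>v\<in>J. \<Sum>u | u \<in> I \<and> u < v. (c u v)\<^sup>2) +
      2 * z * y * sqrt (\<Sum>u\<in>I. \<Sum>v | v \<in> J \<and> v < u. (c u v)\<^sup>2))"
    using assms by (intro Lp_le_add quad_bound) auto
  then have "Lp_le P 2 (\<lambda>x. quad I J c Y Z x + quad J I (\<lambda>u v. c v u) Z Y x) (2 * y * z * sqrt q + 2 * z * y * sqrt q)"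
    by (rule Lp_le_mono) (intro add_mono mult_left_mono, use a b nn in auto)
  moreover have "offdiag I J c Y Z = (\<lambda>x. quad I J c Y Z x + quad J I (\<lambda>u v. c v u) Z Y x)"
    by (rule ext) (rule offdiag_eq_quad[OF fin])
  moreover have "2 * y * z * sqrt q + 2 * z * y * sqrt q = 4 * y * z * sqrt q" by simp
  ultimately show ?thesis by (simp only:)
qed

lemma integral_offdiag:
  assumes fin: "finite I" "finite J"
    and Y: "\<And>u. u \<in> I \<Longrightarrow> mdiff u (Y u)" and Z: "\<And>v. v \<in> J \<Longrightarrow> mdiff v (Z v)"
  shows "(\<integral>x. offdiag I J c Y Z x \<partial>P) = 0"
proof -
  have "(\<integral>x. offdiag I J c Y Z x \<partial>P) = (\<Sum>v\<in>J. \<Sum>u\<in>I - {v}. c u v * (\<integral>x. Y u x * Z v x \<partial>P))"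
  proof -
    have i: "integrable P (\<lambda>x. Y u x * Z v x)" if "u \<in> I" "v \<in> J" for u v
      using that by (intro L4_integrable_mult mdiff_L4[OF Y] mdiff_L4[OF Z])
    then show ?thesis
      unfolding offdiag_def
      by (subst Bochner_Integration.integral_sum)
         (auto intro!: Bochner_Integration.integrable_sum integrable_mult_right sum.cong
           simp: Bochner_Integration.integral_sum integrable_mult_right)
  qed
  also have "\<dots> = 0"
    using mdiff_orth[OF Y Z] by (intro sum.neutral ballI) auto
  finally show ?thesis .
qed

end

section \<open>The kernel of the averaged periodogram\<close>

text \<open>Half of the Dirichlet kernel of order \<open>m\<close> at 2 pi u / n, without its
  constant term. Summing the periodogram over the first \<open>m\<close> Fourier frequencies puts it
  in front of X_s X_t with u = s - t.\<close>

definition kern :: "nat \<Rightarrow> nat \<Rightarrow> int \<Rightarrow> real" where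
  "kern m n u = (\<Sum>j=1..m. cos (2 * pi * real j * real_of_int u / real n))"

lemma kern_even: "kern m n (- u) = kern m n u"
  by (simp add: kern_def)

lemma kern_period:
  assumes "n > 0" shows "kern m n (u + int n * k) = kern m n u"
  unfolding kern_def
proof (intro sum.cong refl)
  fix j
  have "2 * pi * real j * real_of_int (u + int n * k) / real n =
      2 * pi * real j * real_of_int u / real n + 2 * pi * of_int (int j * k)"
    using assms by (simp add: field_simps)
  then show "cos (2 * pi * real j * real_of_int (u + int n * k) / real n) = cos (2 * pi * real j * real_of_int u / real n)"
    by (simp add: cos_add del: of_int_mult)
qed

lemma kern_abs_le: "\<bar>kern m n u\<bar> \<le> real m"
proof -
  have "\<bar>kern m n u\<bar> \<le> (\<Sum>j=1..m. 1)"
    unfolding kern_def by (rule order_trans[OF sum_abs]) (intro sum_mono, simp)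
  then show ?thesis by simp
qed

lemma kern_0 [simp]: "kern m n 0 = real m"
  by (simp add: kern_def)

lemma one_minus_cos_le: "1 - cos x \<le> x\<^sup>2 / 2" for x :: real
proof -
  have "1 - cos x = 2 * (sin (x / 2))\<^sup>2"
    using cos_double_sin[of "x / 2"] by simp
  also have "(sin (x / 2))\<^sup>2 \<le> (x / 2)\<^sup>2"
    using abs_sin_x_le_abs_x[of "x / 2"] by (subst abs_le_square_iff[symmetric])
  finally show ?thesis by (simp add: power2_eq_square)
qed

lemma sum_one_minus_cos:
  assumes "n > 0"
  shows "(\<Sum>j=1..m. 1 - cos (2 * pi * real j * real_of_int h / real n)) \<le> real m * (2 * pi * real m * real_of_int h / real n)\<^sup>2 / 2"
proof -
  have "(\<Sum>j=1..m. 1 - cos (2 * pi * real j * real_of_int h / real n)) \<le> (\<Sum>j=1..m. (2 * pi * real m * real_of_int h / real n)\<^sup>2 / 2)"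
  proof (rule sum_mono)
    fix j assume j: "j \<in> {1..m}"
    have "1 - cos (2 * pi * real j * real_of_int h / real n) \<le> (2 * pi * real j * real_of_int h / real n)\<^sup>2 / 2"
      by (rule one_minus_cos_le)
    also have "(2 * pi * real j * real_of_int h / real n)\<^sup>2 \<le> (2 * pi * real m * real_of_int h / real n)\<^sup>2"
      unfolding power_divide power_mult_distrib using j
      by (intro divide_right_mono mult_right_mono mult_left_mono power_mono) auto
    finally show "1 - cos (2 * pi * real j * real_of_int h / real n) \<le> (2 * pi * real m * real_of_int h / real n)\<^sup>2 / 2"
      by simp
  qed
  then show ?thesis by simp
qed

lemma kern_near_0:
  assumes "n > 0"
  shows "0 \<le> real m - kern m n h" "real m - kern m n h \<le> real m * (2 * pi * real m * real_of_int h / real n)\<^sup>2 / 2"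
proof -
  have eq: "real m - kern m n h = (\<Sum>j=1..m. 1 - cos (2 * pi * real j * real_of_int h / real n))"
    by (simp add: kern_def sum_subtractf)
  show "0 \<le> real m - kern m n h" unfolding eq by (intro sum_nonneg) simp
  show "real m - kern m n h \<le> real m * (2 * pi * real m * real_of_int h / real n)\<^sup>2 / 2"
    unfolding eq by (rule sum_one_minus_cos[OF assms])
qed

section \<open>Orthogonality of the harmonics and Parseval's identity\<close>

lemma sum_cis:
  assumes "n > 0" "\<not> int n dvd p"
  shows "(\<Sum>u<n. cis (2 * pi * real_of_int p * real u / real n)) = 0"
proof -
  define z where "z = cis (2 * pi * real_of_int p / real n)"
  have "z ^ n = cis (real n * (2 * pi * real_of_int p / real n))"
    unfolding z_def by (rule Complex.DeMoivre)
  also have "real n * (2 * pi * real_of_int p / real n) = 2 * pi * real_of_int p"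
    using assms(1) by simp
  finally have zn: "z ^ n = 1" by (simp add: cis_multiple_2pi)
  have z1: "z \<noteq> 1"
  proof
    assume "z = 1"
    then have "cos (2 * pi * real_of_int p / real n) = 1" by (simp add: z_def complex_eq_iff)
    then obtain k :: int where "2 * pi * real_of_int p / real n = of_int k * (2 * pi)"
      using cos_one_2pi_int by (metis mult.commute mult.assoc)
    then have "real_of_int p = real_of_int (k * int n)" using assms(1) by (simp add: field_simps)
    then have "p = k * int n" by (simp only: of_int_eq_iff)
    then show False using assms(2) by simp
  qed
  have "cis (2 * pi * real_of_int p * real u / real n) = z ^ u" for u
    by (simp add: z_def Complex.DeMoivre mult.commute)
  then show ?thesis using geometric_sum[OF z1, of n] zn by simp
qed

lemma sum_cos_sin:
  assumes "n > 0" "\<not> int n dvd p"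
  shows "(\<Sum>u<n. cos (2 * pi * real_of_int p * real u / real n)) = 0"
    and "(\<Sum>u<n. sin (2 * pi * real_of_int p * real u / real n)) = 0"
  using sum_cis[OF assms] by (auto simp: complex_eq_iff)

lemma trig_orth:
  fixes n m j k :: nat
  assumes n: "2 * m < n" and jk: "j \<in> {1..m}" "k \<in> {1..m}"
  defines "w \<equiv> \<lambda>j u. 2 * pi * real j * real u / real n"
  shows "(\<Sum>u<n. cos (w j u) * cos (w k u)) = (if j = k then real n / 2 else 0)"
    and "(\<Sum>u<n. sin (w j u) * sin (w k u)) = (if j = k then real n / 2 else 0)"
    and "(\<Sum>u<n. cos (w j u) * sin (w k u)) = 0"
proof -
  have n0: "n > 0" using n by simp
  have plus: "w j u + w k u = 2 * pi * real_of_int (int j + int k) * real u / real n" for u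
    by (simp add: w_def add_divide_distrib algebra_simps)
  have minus: "w j u - w k u = 2 * pi * real_of_int (int j - int k) * real u / real n" for u
    by (simp add: w_def diff_divide_distrib algebra_simps)
  \<comment> \<open>Here \<open>2 * m < n\<close> excludes aliasing: the sum of two frequencies
    stays strictly between 0 and n.\<close>
  have ndp: "\<not> int n dvd int j + int k" using jk n by (intro zdvd_not_zless) auto
  have ndm: "\<not> int n dvd int j - int k" if "j \<noteq> k"
  proof
    assume "int n dvd int j - int k"
    then have "int n \<le> \<bar>int j - int k\<bar>" using that by (intro zdvd_imp_le) auto
    then show False using jk n by auto
  qed
  have P: "(\<Sum>u<n. cos (w j u + w k u)) = 0" "(\<Sum>u<n. sin (w j u + w k u)) = 0"
    unfolding plus by (rule sum_cos_sin[OF n0 ndp])+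
  have M: "(\<Sum>u<n. cos (w j u - w k u)) = (if j = k then real n else 0)"
    "(\<Sum>u<n. sin (w j u - w k u)) = 0"
  proof -
    have a: "(\<Sum>u<n. cos (w j u - w k u)) = 0" "(\<Sum>u<n. sin (w j u - w k u)) = 0" if "j \<noteq> k"
      unfolding minus by (rule sum_cos_sin[OF n0 ndm[OF that]])+
    show "(\<Sum>u<n. cos (w j u - w k u)) = (if j = k then real n else 0)" using a by (cases "j = k") auto
    show "(\<Sum>u<n. sin (w j u - w k u)) = 0" using a by (cases "j = k") auto
  qed
  have "(\<Sum>u<n. cos (w j u) * cos (w k u)) = ((\<Sum>u<n. cos (w j u - w k u)) + (\<Sum>u<n. cos (w j u + w k u))) / 2"
    by (simp add: cos_times_cos sum_divide_distrib[symmetric] sum.distrib)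
  then show "(\<Sum>u<n. cos (w j u) * cos (w k u)) = (if j = k then real n / 2 else 0)"
    unfolding P M by (simp split: if_splits)
  have "(\<Sum>u<n. sin (w j u) * sin (w k u)) = ((\<Sum>u<n. cos (w j u - w k u)) - (\<Sum>u<n. cos (w j u + w k u))) / 2"
    by (simp add: sin_times_sin sum_divide_distrib[symmetric] sum_subtractf)
  then show "(\<Sum>u<n. sin (w j u) * sin (w k u)) = (if j = k then real n / 2 else 0)"
    unfolding P M by (simp split: if_splits)
  have "(\<Sum>u<n. cos (w j u) * sin (w k u)) = ((\<Sum>u<n. sin (w j u + w k u)) - (\<Sum>u<n. sin (w j u - w k u))) / 2"
    by (simp add: cos_times_sin sum_divide_distrib[symmetric] sum_subtractf)
  then show "(\<Sum>u<n. cos (w j u) * sin (w k u)) = 0" by (simp add: P M)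
qed

text \<open>The sine terms are included so that the identity covers not only the kernel itself but
  also its increments under a shift of the lag.\<close>

lemma trig_parseval:
  fixes n m :: nat
  assumes n: "2 * m < n"
  defines "w \<equiv> \<lambda>j u. 2 * pi * real j * real u / real n"
  shows "(\<Sum>u<n. (\<Sum>j=1..m. A j * cos (w j u) + B j * sin (w j u))\<^sup>2) = real n / 2 * (\<Sum>j=1..m. (A j)\<^sup>2 + (B j)\<^sup>2)"
proof -
  have "(\<Sum>u<n. (\<Sum>j=1..m. A j * cos (w j u) + B j * sin (w j u))\<^sup>2) =
    (\<Sum>u<n. \<Sum>j=1..m. \<Sum>k=1..m. A j * A k * (cos (w j u) * cos (w k u)) + B j * B k * (sin (w j u) * sin (w k u))
      + (A j * B k * (cos (w j u) * sin (w k u)) + B j * A k * (cos (w k u) * sin (w j u))))"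
    by (simp add: power2_eq_square sum_product algebra_simps)
  also have "\<dots> = (\<Sum>j=1..m. \<Sum>k=1..m. \<Sum>u<n. A j * A k * (cos (w j u) * cos (w k u)) + B j * B k * (sin (w j u) * sin (w k u))
      + (A j * B k * (cos (w j u) * sin (w k u)) + B j * A k * (cos (w k u) * sin (w j u))))"
    by (rule trans[OF sum.swap]) (rule sum.cong[OF refl], rule sum.swap)
  also have "\<dots> = (\<Sum>j=1..m. \<Sum>k=1..m. if j = k then real n / 2 * ((A j)\<^sup>2 + (B j)\<^sup>2) else 0)"
  proof (intro sum.cong refl)
    fix j k assume jk: "j \<in> {1..m}" "k \<in> {1..m}"
    show "(\<Sum>u<n. A j * A k * (cos (w j u) * cos (w k u)) + B j * B k * (sin (w j u) * sin (w k u))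
      + (A j * B k * (cos (w j u) * sin (w k u)) + B j * A k * (cos (w k u) * sin (w j u)))) =
      (if j = k then real n / 2 * ((A j)\<^sup>2 + (B j)\<^sup>2) else 0)"
      unfolding sum.distrib sum_distrib_left[symmetric] w_def trig_orth[OF n jk] trig_orth(3)[OF n jk(2,1)]
      by (simp add: power2_eq_square algebra_simps)
  qed
  also have "\<dots> = (\<Sum>j=1..m. real n / 2 * ((A j)\<^sup>2 + (B j)\<^sup>2))"
    by (intro sum.cong refl) simp
  finally show ?thesis by (simp only: sum_distrib_left)
qed

lemma sum_int_nat: "(\<Sum>u\<in>{0..<int n}. f u) = (\<Sum>u<n. f (int u))"
  by (rule sum.reindex_bij_witness[of _ int nat]) auto

lemma sum_kern_sq:
  assumes "2 * m < n"
  shows "(\<Sum>u\<in>{0..<int n}. (kern m n u)\<^sup>2) = real n * real m / 2"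
  using trig_parseval[OF assms, where A = "\<lambda>_. 1" and B = "\<lambda>_. 0"] by (simp add: sum_int_nat kern_def)

text \<open>A shift by \<open>h\<close> multiplies the j-th harmonic by a phase w, and |exp (i w) -
  1|^2 = 2 (1 - cos w), which is quadratic in w.\<close>

lemma sum_kern_diff_sq:
  assumes n: "2 * m < n"
  shows "(\<Sum>u\<in>{0..<int n}. (kern m n (u + h) - kern m n u)\<^sup>2) \<le> real n / 2 * (real m * (2 * pi * real m * real_of_int h / real n)\<^sup>2)"
proof -
  let ?w = "\<lambda>j h. 2 * pi * real j * real_of_int h / real n"
  have "kern m n (u + h) - kern m n u =
    (\<Sum>j=1..m. (cos (?w j h) - 1) * cos (?w j u) + (- sin (?w j h)) * sin (?w j u))" for u
  proof -
    have "cos (?w j (u + h)) = cos (?w j u) * cos (?w j h) - sin (?w j u) * sin (?w j h)" for j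
      by (simp add: distrib_left add_divide_distrib cos_add)
    then have "cos (?w j (u + h)) - cos (?w j u) = (cos (?w j h) - 1) * cos (?w j u) + (- sin (?w j h)) * sin (?w j u)" for j
      by (simp only:) (simp add: algebra_simps)
    then show ?thesis unfolding kern_def sum_subtractf[symmetric] by (intro sum.cong refl)
  qed
  then have "(\<Sum>u\<in>{0..<int n}. (kern m n (u + h) - kern m n u)\<^sup>2) = 
     real n / 2 * (\<Sum>j=1..m. (cos (?w j h) - 1)\<^sup>2 + (- sin (?w j h))\<^sup>2)"
    using trig_parseval[OF n, where A = "\<lambda>j. cos (?w j h) - 1" and B = "\<lambda>j. - sin (?w j h)"] by (simp add: sum_int_nat)
  also have "(\<Sum>j=1..m. (cos (?w j h) - 1)\<^sup>2 + (- sin (?w j h))\<^sup>2) = 2 * (\<Sum>j=1..m. 1 - cos (?w j h))"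
  proof -
    have "(cos x - 1)\<^sup>2 + (- sin x)\<^sup>2 = 2 * (1 - cos x)" for x :: real
      using sin_cos_squared_add[of x] by (simp add: power2_eq_square algebra_simps)
    then show ?thesis by (simp add: sum_distrib_left)
  qed
  also have "real n / 2 * (2 * (\<Sum>j=1..m. 1 - cos (?w j h))) \<le> real n / 2 * (2 * (real m * (?w m h)\<^sup>2 / 2))"
    using sum_one_minus_cos[where n = n and m = m and h = h] n by (intro mult_left_mono) auto
  finally show ?thesis by simp
qed

text \<open>Indices at distance less than n are pairwise incongruent modulo n, so their residues are
  distinct members of a single period.\<close>

lemma sum_periodic_le:
  fixes f :: "int \<Rightarrow> real"
  assumes n: "n > 0" and f: "\<And>u k. f (u + int n * k) = f u" "\<And>u. 0 \<le> f u"
    and S: "finite S" "\<And>u v. u \<in> S \<Longrightarrow> v \<in> S \<Longrightarrow> \<bar>u - v\<bar> < int n"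
  shows "(\<Sum>u\<in>S. f (b + u)) \<le> (\<Sum>u\<in>{0..<int n}. f u)"
proof -
  have fm: "f u = f (u mod int n)" for u
    using f(1)[of "u mod int n" "u div int n"] by (simp add: mod_mult_div_eq)
  have inj: "inj_on (\<lambda>u. (b + u) mod int n) S"
  proof (rule inj_onI)
    fix u v assume uv: "u \<in> S" "v \<in> S" "(b + u) mod int n = (b + v) mod int n"
    then have "int n dvd u - v" by (metis add_diff_cancel_left mod_eq_dvd_iff)
    then show "u = v" using S(2)[OF uv(1,2)] zdvd_imp_le[of "int n" "\<bar>u - v\<bar>"] by fastforce
  qed
  have "(\<Sum>u\<in>S. f (b + u)) = (\<Sum>u\<in>S. f ((b + u) mod int n))" by (intro sum.cong refl fm)
  also have "\<dots> = (\<Sum>v\<in>(\<lambda>u. (b + u) mod int n) ` S. f v)"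
    by (rule sum.reindex_cong[OF inj refl refl, symmetric])
  also have "\<dots> \<le> (\<Sum>u\<in>{0..<int n}. f u)"
    using n S(1) f(2) by (intro sum_mono2) auto
  finally show ?thesis .
qed

lemma sum_periodic_eq:
  fixes f :: "int \<Rightarrow> real"
  assumes n: "n > 0" and f: "\<And>u k. f (u + int n * k) = f u"
  shows "(\<Sum>u\<in>{1..int n}. f (b - u)) = (\<Sum>u\<in>{0..<int n}. f u)"
proof -
  have fm: "f u = f (u mod int n)" for u
    using f(1)[of "u mod int n" "u div int n"] by (simp add: mod_mult_div_eq)
  have inj: "inj_on (\<lambda>u. (b - u) mod int n) {1..int n}"
  proof (rule inj_onI)
    fix u v assume uv: "u \<in> {1..int n}" "v \<in> {1..int n}" "(b - u) mod int n = (b - v) mod int n"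
    then have "int n dvd u - v" by (metis diff_diff_eq2 diff_add_cancel minus_diff_eq dvd_minus_iff mod_eq_dvd_iff add_diff_cancel_left' diff_diff_add)
    then show "u = v" using uv zdvd_imp_le[of "int n" "\<bar>u - v\<bar>"] by fastforce
  qed
  have im: "(\<lambda>u. (b - u) mod int n) ` {1..int n} = {0..<int n}"
    by (rule card_subset_eq) (use n card_image[OF inj] in auto)
  have "(\<Sum>u\<in>{1..int n}. f (b - u)) = (\<Sum>u\<in>{1..int n}. f ((b - u) mod int n))" by (intro sum.cong refl fm)
  also have "\<dots> = (\<Sum>v\<in>{0..<int n}. f v)"
    by (rule sum.reindex_cong[OF inj im[symmetric] refl, symmetric])
  finally show ?thesis .
qed

section \<open>Decay of the Dirichlet kernel\<close>

lemma dirichlet_kernel: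
  "2 * sin (x / 2) * (\<Sum>j=1..m. cos (real j * x)) = sin ((real m + 1 / 2) * x) - sin (x / 2)"
proof (induction m)
  case (Suc m)
  have "2 * sin (x / 2) * cos (real (Suc m) * x) = sin ((real (Suc m) + 1 / 2) * x) - sin ((real m + 1 / 2) * x)"
  proof -
    have "x / 2 + real (Suc m) * x = (real (Suc m) + 1 / 2) * x" "x / 2 - real (Suc m) * x = - ((real m + 1 / 2) * x)"
      by (simp_all add: algebra_simps)
    note e = this
    have "2 * sin a * cos b = sin (a + b) + sin (a - b)" for a b :: real
      by (simp add: sin_add sin_diff)
    from this[of "x / 2" "real (Suc m) * x"] show ?thesis unfolding e sin_minus by simp
  qed
  then show ?case using Suc by (simp add: distrib_left)
qed simp

text \<open>A crude form of Jordan's inequality. The constant 1/3 is just good enough: in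
  \<open>kern_decay_half\<close> it leads to a factor 6, which 2 pi absorbs.\<close>

lemma sin_ge_third:
  fixes y :: real
  assumes "0 \<le> y" "y \<le> pi / 2" shows "y / 3 \<le> sin y"
proof -
  have "\<bar>sin y - y\<bar> \<le> \<bar>y\<bar> ^ 3 / 6"
    using Maclaurin_sin_bound[of y 3] by (simp add: sin_coeff_def eval_nat_numeral)
  then have "y - y ^ 3 / 6 \<le> sin y" using assms by linarith
  moreover have "y ^ 3 \<le> 4 * y"
  proof -
    have "y \<le> 2" using assms pi_half_less_two by linarith
    then have "y\<^sup>2 \<le> 2\<^sup>2" using assms by (intro power_mono) auto
    then show ?thesis using mult_right_mono[of "y\<^sup>2" 4 y] assms by (simp add: power2_eq_square power3_eq_cube)
  qed
  ultimately show ?thesis by linarith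
qed

lemma kern_decay_half:
  assumes n: "n > 0" and u: "1 \<le> u" "2 * u \<le> int n"
  shows "real_of_int u * \<bar>kern m n u\<bar> \<le> real n"
proof -
  define x where "x = 2 * pi * real_of_int u / real n"
  have x: "0 < x" "x / 2 \<le> pi / 2"
  proof -
    show "0 < x" using u n by (simp add: x_def)
    have "2 * real_of_int u \<le> real n" using u by linarith
    then have "pi * (2 * real_of_int u) \<le> pi * real n" by (intro mult_left_mono) auto
    then show "x / 2 \<le> pi / 2" using n by (simp add: x_def field_simps)
  qed
  have s: "x / 6 \<le> sin (x / 2)" using sin_ge_third[of "x / 2"] x by simp
  have k: "kern m n u = (\<Sum>j=1..m. cos (real j * x))"
    by (simp add: kern_def x_def field_simps)
  have "\<bar>2 * sin (x / 2) * kern m n u\<bar> \<le> 2"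
    unfolding k dirichlet_kernel using abs_sin_le_one[of "(real m + 1/2) * x"] abs_sin_le_one[of "x / 2"] by linarith
  then have "2 * sin (x / 2) * \<bar>kern m n u\<bar> \<le> 2"
    using s x by (simp add: abs_mult)
  moreover have "2 * (x / 6) * \<bar>kern m n u\<bar> \<le> 2 * sin (x / 2) * \<bar>kern m n u\<bar>"
    using s by (intro mult_right_mono mult_left_mono) auto
  ultimately have "x * \<bar>kern m n u\<bar> \<le> 6" by simp
  then have "2 * pi * (real_of_int u * \<bar>kern m n u\<bar>) \<le> 6 * real n"
    using n by (simp add: x_def field_simps)
  moreover have "6 * (real_of_int u * \<bar>kern m n u\<bar>) \<le> 2 * pi * (real_of_int u * \<bar>kern m n u\<bar>)"
    using pi_gt3 u by (intro mult_right_mono) auto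
  ultimately show ?thesis by simp
qed

lemma kern_reflect: "n > 0 \<Longrightarrow> kern m n (int n - u) = kern m n u"
  using kern_period[of n m "- u" 1] by (simp add: kern_even)

text \<open>The kernel has period n and is even, so what counts is the distance of \<open>u\<close>
  to the nearest multiple of n.\<close>

lemma kern_decay:
  assumes n: "n > 0" and u: "1 \<le> u" "u < int n"
  shows "real_of_int (min u (int n - u)) * \<bar>kern m n u\<bar> \<le> real n"
proof (cases "2 * u \<le> int n")
  case True
  then show ?thesis using kern_decay_half[OF n u(1)] by (simp add: min_def)
next
  case False
  then show ?thesis using kern_decay_half[OF n, where m = m and u = "int n - u"] u kern_reflect[OF n, of m u]
    by (simp add: min_def)
qed

text \<open>Cauchy-Schwarz and the known sum of squares. This is cruder than the logarithmic growth
  of Lebesgue constants, yet it still gains a factor sqrt m over the trivial bound n m.\<close>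

lemma sum_kern_abs:
  assumes "2 * m < n"
  shows "(\<Sum>u\<in>{0..<int n}. \<bar>kern m n u\<bar>) \<le> real n * sqrt (real m)"
proof -
  have "(\<Sum>u\<in>{0..<int n}. \<bar>kern m n u\<bar>)\<^sup>2 \<le> (\<Sum>u\<in>{0..<int n}. 1\<^sup>2) * (\<Sum>u\<in>{0..<int n}. (kern m n u)\<^sup>2)"
    using Cauchy_Schwarz_ineq_sum[of "\<lambda>_. 1" "\<lambda>u. \<bar>kern m n u\<bar>" "{0..<int n}"] by simp
  also have "\<dots> = real n * (real n * real m / 2)" using sum_kern_sq[OF assms] by simp
  also have "\<dots> \<le> (real n)\<^sup>2 * real m" by (simp add: power2_eq_square)
  also have "\<dots> = (real n * sqrt (real m))\<^sup>2" by (simp add: power_mult_distrib)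
  finally show ?thesis by (rule power2_le_imp_le) simp
qed

text \<open>A lag \<open>u\<close> occurs for at most min u (n - u) pairs on different sides of the
  cut \<open>b\<close>. One of the two factors |kern| pays for that number through its decay, the
  other is summed absolutely.\<close>

lemma sum_crossing_kern:
  assumes n: "2 * m < n" and b: "0 \<le> b" "b \<le> int n"
  shows "(\<Sum>s\<in>{1..b}. \<Sum>t\<in>{b+1..int n}. (kern m n (t - s))\<^sup>2) \<le> real n * (real n * sqrt (real m))"
proof -
  have n0: "n > 0" using n by simp
  let ?f = "\<lambda>u. (kern m n u)\<^sup>2"
  let ?C = "\<lambda>s u. b + 1 - s \<le> u \<and> u \<le> int n - s"
  have "(\<Sum>s\<in>{1..b}. \<Sum>t\<in>{b+1..int n}. ?f (t - s)) = (\<Sum>s\<in>{1..b}. \<Sum>u | u \<in> {1..<int n} \<and> ?C s u. ?f u)"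
  proof (rule sum.cong[OF refl])
    fix s assume s: "s \<in> {1..b}"
    show "(\<Sum>t\<in>{b+1..int n}. ?f (t - s)) = (\<Sum>u | u \<in> {1..<int n} \<and> ?C s u. ?f u)"
      by (rule sum.reindex_bij_witness[of _ "\<lambda>u. u + s" "\<lambda>t. t - s"]) (use s in auto)
  qed
  also have "\<dots> = (\<Sum>u\<in>{1..<int n}. \<Sum>s | s \<in> {1..b} \<and> ?C s u. ?f u)"
    by (rule sum.swap_restrict) auto
  also have "\<dots> \<le> (\<Sum>u\<in>{1..<int n}. real n * \<bar>kern m n u\<bar>)"
  proof (rule sum_mono)
    fix u assume u: "u \<in> {1..<int n}"
    have "card {s \<in> {1..b}. ?C s u} \<le> card {b+1-u..b}" "card {s \<in> {1..b}. ?C s u} \<le> card {1..int n-u}"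
      by (intro card_mono; auto)+
    then have "real (card {s \<in> {1..b}. ?C s u}) \<le> real_of_int (min u (int n - u))"
      using u by auto
    then have "(\<Sum>s | s \<in> {1..b} \<and> ?C s u. ?f u) \<le> real_of_int (min u (int n - u)) * (\<bar>kern m n u\<bar> * \<bar>kern m n u\<bar>)"
      by (simp add: power2_eq_square mult_right_mono flip: abs_mult)
    also have "\<dots> \<le> real n * \<bar>kern m n u\<bar>"
      unfolding mult.assoc[symmetric] using kern_decay[OF n0, of u m] u by (intro mult_right_mono) auto
    finally show "(\<Sum>s | s \<in> {1..b} \<and> ?C s u. ?f u) \<le> real n * \<bar>kern m n u\<bar>" .
  qed
  also have "\<dots> = real n * (\<Sum>u\<in>{1..<int n}. \<bar>kern m n u\<bar>)" by (simp add: sum_distrib_left)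
  also have "\<dots> \<le> real n * (\<Sum>u\<in>{0..<int n}. \<bar>kern m n u\<bar>)"
    by (intro mult_left_mono sum_mono2) auto
  also have "\<dots> \<le> real n * (real n * sqrt (real m))"
    by (intro mult_left_mono sum_kern_abs[OF n]) auto
  finally show ?thesis .
qed

text \<open>$\sqrt m\,Q_n = \sum_{s,t=1}^n w(s-t) X_s X_t$ for these weights.\<close>
definition wt :: "nat \<Rightarrow> nat \<Rightarrow> int \<Rightarrow> real" where
  "wt m n u = kern m n u / (2 * pi * real n * sqrt (real m))"

section \<open>Squared mass of the weights\<close>

lemma wt_sq: "(wt m n u)\<^sup>2 = (kern m n u)\<^sup>2 / (4 * pi\<^sup>2 * (real n)\<^sup>2 * real m)"
  by (simp add: wt_def power_divide power_mult_distrib)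

lemma wt_even: "wt m n (- u) = wt m n u"
  by (simp add: wt_def kern_even)

lemma wt_abs_le:
  assumes "m > 0" shows "\<bar>wt m n u\<bar> \<le> sqrt (real m) / real n"
proof -
  have "\<bar>wt m n u\<bar> = \<bar>kern m n u\<bar> / (2 * pi * real n * sqrt (real m))" by (simp add: wt_def abs_mult)
  also have "\<dots> \<le> real m / (2 * pi * real n * sqrt (real m))"
    by (intro divide_right_mono kern_abs_le) auto
  also have "\<dots> = (sqrt (real m) / real n) / (2 * pi)"
  proof -
    have "real m / (2 * pi * real n * sqrt (real m)) = real m / sqrt (real m) / real n / (2 * pi)" by simp
    then show ?thesis by (simp only: real_div_sqrt of_nat_0_le_iff)
  qed
  also have "\<dots> \<le> (sqrt (real m) / real n) / 1"
    using pi_gt3 by (intro divide_left_mono) auto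
  finally show ?thesis by simp
qed

text \<open>Over n rows the two bounds add up to 1 and (m h / n)^2. The second one vanishes for
  fixed \<open>h\<close> as m / n tends to 0, which is why time shifts of the differences may be
  ignored.\<close>

lemma wt_row_le:
  assumes n: "2 * m < n" and m: "m > 0" and S: "finite S" "\<And>u v. u \<in> S \<Longrightarrow> v \<in> S \<Longrightarrow> \<bar>u - v\<bar> < int n"
  shows "(\<Sum>u\<in>S. (wt m n (b + u))\<^sup>2) \<le> 1 / real n"
    and "(\<Sum>u\<in>S. (wt m n (b + u + h) - wt m n (b + u))\<^sup>2) \<le> (real m * real_of_int h)\<^sup>2 / real n ^ 3"
proof -
  have n0: "n > 0" using n by simp
  let ?c = "4 * pi\<^sup>2 * (real n)\<^sup>2 * real m"
  have c: "?c > 0" using n0 m by simp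
  have "(\<Sum>u\<in>S. (wt m n (b + u))\<^sup>2) = (\<Sum>u\<in>S. (kern m n (b + u))\<^sup>2) / ?c"
    by (simp add: wt_sq sum_divide_distrib)
  also have "\<dots> \<le> (\<Sum>u\<in>{0..<int n}. (kern m n u)\<^sup>2) / ?c"
    using c S by (intro divide_right_mono sum_periodic_le[OF n0]) (auto simp: kern_period[OF n0])
  also have "\<dots> = (1 / real n) / (8 * pi\<^sup>2)"
    unfolding sum_kern_sq[OF n] using n0 m by (simp add: power2_eq_square field_simps)
  also have "\<dots> \<le> (1 / real n) / 1"
  proof (intro divide_left_mono)
    have "1 \<le> pi\<^sup>2" using pi_gt3 by (intro one_le_power) auto
    then show "1 \<le> 8 * pi\<^sup>2" by simp
  qed auto
  finally show "(\<Sum>u\<in>S. (wt m n (b + u))\<^sup>2) \<le> 1 / real n" by simp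
  have "(wt m n (b + u + h) - wt m n (b + u))\<^sup>2 = (kern m n (b + u + h) - kern m n (b + u))\<^sup>2 / ?c" for u
    by (simp add: wt_def power_divide power_mult_distrib diff_divide_distrib[symmetric])
  then have "(\<Sum>u\<in>S. (wt m n (b + u + h) - wt m n (b + u))\<^sup>2) = (\<Sum>u\<in>S. (kern m n (b + u + h) - kern m n (b + u))\<^sup>2) / ?c"
    by (simp add: sum_divide_distrib)
  also have "\<dots> \<le> (\<Sum>u\<in>{0..<int n}. (kern m n (u + h) - kern m n u)\<^sup>2) / ?c"
  proof (intro divide_right_mono sum_periodic_le[OF n0, of "\<lambda>u. (kern m n (u + h) - kern m n u)\<^sup>2"])
    show "(kern m n (u + int n * k + h) - kern m n (u + int n * k))\<^sup>2 = (kern m n (u + h) - kern m n u)\<^sup>2" for u k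
      using kern_period[OF n0, of m u k] kern_period[OF n0, of m "u + h" k] by (simp add: algebra_simps)
  qed (use c S in auto)
  also have "\<dots> \<le> (real n / 2 * (real m * (2 * pi * real m * real_of_int h / real n)\<^sup>2)) / ?c"
    using c by (intro divide_right_mono sum_kern_diff_sq[OF n]) auto
  also have "\<dots> = ((real m * real_of_int h)\<^sup>2 / real n ^ 3) / 2"
    using n0 m by (simp add: power2_eq_square power3_eq_cube field_simps)
  also have "\<dots> \<le> (real m * real_of_int h)\<^sup>2 / real n ^ 3"
  proof -
    have "x / 2 \<le> x" if "0 \<le> x" for x :: real using that by simp
    then show ?thesis by this (intro divide_nonneg_nonneg; simp)
  qed
  finally show "(\<Sum>u\<in>S. (wt m n (b + u + h) - wt m n (b + u))\<^sup>2) \<le> (real m * real_of_int h)\<^sup>2 / real n ^ 3" .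
qed

text \<open>The whole square carries mass 1 / (8 pi^2) by Parseval. Removing the diagonal and
  halving by symmetry leaves the triangle. Its leading constant 1 / (16 pi^2) determines the
  limiting variance.\<close>

lemma wt_sum_less:
  assumes n: "2 * m < n" and m: "m > 0"
  shows "(\<Sum>t\<in>{1..int n}. \<Sum>s | s \<in> {1..int n} \<and> s < t. (wt m n (s - t))\<^sup>2) =
    1 / (16 * pi\<^sup>2) - real m / (8 * pi\<^sup>2 * real n)"
proof -
  have n0: "n > 0" using n by simp
  let ?I = "{1..int n}" and ?f = "\<lambda>u. (kern m n u)\<^sup>2"
  let ?L = "\<Sum>t\<in>?I. \<Sum>s | s \<in> ?I \<and> s < t. ?f (s - t)"
  have "(\<Sum>s\<in>?I. ?f (t - s)) = real n * real m / 2" for t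
    using sum_periodic_eq[OF n0, of ?f] kern_period[OF n0, of m] by (simp add: sum_kern_sq[OF n])
  then have "(\<Sum>t\<in>?I. \<Sum>s\<in>?I. ?f (t - s)) = (\<Sum>t\<in>?I. real n * real m / 2)"
    by (intro sum.cong refl)
  then have "(\<Sum>t\<in>?I. \<Sum>s\<in>?I. ?f (t - s)) = real n * (real n * real m / 2)" by simp
  moreover have "(\<Sum>t\<in>?I. \<Sum>s\<in>?I. ?f (t - s)) = ?L + ?L + real n * (real m)\<^sup>2"
  proof -
    have "(\<Sum>s\<in>?I. ?f (t - s)) = (\<Sum>s | s \<in> ?I \<and> s < t. ?f (s - t)) + ((\<Sum>s | s \<in> ?I \<and> t < s. ?f (s - t)) + ?f 0)" if "t \<in> ?I" for t
    proof -
      have 1: "?f (t - s) = ?f (s - t)" for s using kern_even[of m n "t - s"] by simp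
      have 2: "?I = {s. s \<in> ?I \<and> s < t} \<union> ({s. s \<in> ?I \<and> t < s} \<union> {t})" using that by auto
      have "(\<Sum>s\<in>?I. ?f (s - t)) = (\<Sum>s\<in>{s. s \<in> ?I \<and> s < t} \<union> ({s. s \<in> ?I \<and> t < s} \<union> {t}). ?f (s - t))"
        by (rule sum.cong[OF 2 refl])
      also have "\<dots> = (\<Sum>s | s \<in> ?I \<and> s < t. ?f (s - t)) + (\<Sum>s\<in>({s. s \<in> ?I \<and> t < s} \<union> {t}). ?f (s - t))"
        by (rule sum.union_disjoint) (auto intro: finite_subset[of _ ?I])
      also have "(\<Sum>s\<in>({s. s \<in> ?I \<and> t < s} \<union> {t}). ?f (s - t)) = (\<Sum>s | s \<in> ?I \<and> t < s. ?f (s - t)) + ?f 0"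
        by (subst sum.union_disjoint) (auto intro: finite_subset[of _ ?I])
      finally show ?thesis unfolding 1 .
    qed
    then have "(\<Sum>t\<in>?I. \<Sum>s\<in>?I. ?f (t - s)) = ?L + ((\<Sum>t\<in>?I. \<Sum>s | s \<in> ?I \<and> t < s. ?f (s - t)) + real n * (real m)\<^sup>2)"
      by (simp add: sum.distrib)
    also have "(\<Sum>t\<in>?I. \<Sum>s | s \<in> ?I \<and> t < s. ?f (s - t)) = (\<Sum>s\<in>?I. \<Sum>t | t \<in> ?I \<and> t < s. ?f (s - t))"
      by (rule sum.swap_restrict) auto
    also have "\<dots> = ?L"
      by (intro sum.cong refl) (metis kern_even minus_diff_eq)
    finally show ?thesis by simp
  qed
  ultimately have L: "?L = (real n * (real n * real m / 2) - real n * (real m)\<^sup>2) / 2" by simp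
  have "(\<Sum>t\<in>?I. \<Sum>s | s \<in> ?I \<and> s < t. (wt m n (s - t))\<^sup>2) = ?L / (4 * pi\<^sup>2 * (real n)\<^sup>2 * real m)"
    by (simp add: wt_sq sum_divide_distrib)
  also have "\<dots> = 1 / (16 * pi\<^sup>2) - real m / (8 * pi\<^sup>2 * real n)"
    unfolding L using n0 m by (simp add: field_simps power2_eq_square)
  finally show ?thesis .
qed

text \<open>One cut separates only a fraction of order 1 / sqrt m of the total mass, so o(sqrt m)
  cuts are harmless.\<close>

lemma wt_crossing:
  assumes n: "2 * m < n" and m: "m > 0" and b: "0 \<le> b" "b \<le> int n"
  shows "(\<Sum>s\<in>{1..b}. \<Sum>t\<in>{b+1..int n}. (wt m n (s - t))\<^sup>2) \<le> 1 / sqrt (real m)"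
proof -
  have n0: "n > 0" using n by simp
  let ?c = "4 * pi\<^sup>2 * (real n)\<^sup>2 * real m"
  have e: "kern m n (s - t) = kern m n (t - s)" for s t using kern_even[of m n "t - s"] by simp
  have "(\<Sum>s\<in>{1..b}. \<Sum>t\<in>{b+1..int n}. (wt m n (s - t))\<^sup>2) = (\<Sum>s\<in>{1..b}. \<Sum>t\<in>{b+1..int n}. (kern m n (t - s))\<^sup>2) / ?c"
    by (simp add: wt_sq sum_divide_distrib e)
  also have "\<dots> \<le> (real n * (real n * sqrt (real m))) / ?c"
    using n0 m by (intro divide_right_mono sum_crossing_kern[OF n b]) auto
  also have "\<dots> = (1 / sqrt (real m)) / (4 * pi\<^sup>2)"
    using n0 m by (simp add: power2_eq_square field_simps)
  also have "\<dots> \<le> (1 / sqrt (real m)) / 1"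
  proof (intro divide_left_mono)
    have "1 \<le> pi\<^sup>2" using pi_gt3 by (intro one_le_power) auto
    then show "1 \<le> 4 * pi\<^sup>2" by simp
  qed auto
  finally show ?thesis by simp
qed

section \<open>A central limit theorem for quadratic forms in bounded martingale differences\<close>

context iid_space
begin

lemma mdiff_shift:
  assumes d: "mdiff t d" shows "mdiff (t + s) (\<lambda>x. d (shift s x))"
  unfolding mdiff_def
proof (intro conjI allI impI)
  show "dep {..t + s} (\<lambda>x. d (shift s x))"
    by (rule dep_mono[OF dep_shift[OF mdiff_dep[OF d]]]) auto
  show "L4 (\<lambda>x. d (shift s x))" by (rule L4_shift[OF mdiff_L4[OF d]])
  fix h1 h2 h3 :: "(int \<Rightarrow> 's) \<Rightarrow> real"
  assume h: "L4 h1 \<and> L4 h2 \<and> L4 h3 \<and> dep {..<t + s} h1 \<and> dep {..<t + s} h2 \<and> dep {..<t + s} h3"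
  define k where "k h x = h (shift (- s) x)" for h :: "(int \<Rightarrow> 's) \<Rightarrow> real" and x
  have k: "L4 (k h)" "dep {..<t} (k h)" if "L4 h" "dep {..<t + s} h" for h
    unfolding k_def[abs_def] using that
    by (auto intro: L4_shift intro!: dep_mono[OF dep_shift[OF that(2)]])
  have kh: "k h (shift s x) = h x" for h x by (simp add: k_def shift_shift)
  have [measurable]: "d \<in> borel_measurable P" "k h1 \<in> borel_measurable P" "k h2 \<in> borel_measurable P" "k h3 \<in> borel_measurable P"
    using h by (auto intro: L4_measurable k mdiff_L4[OF d])
  have "(\<integral>x. h1 x * h2 x * (h3 x * d (shift s x)) \<partial>P) =
    (\<integral>x. k h1 (shift s x) * k h2 (shift s x) * (k h3 (shift s x) * d (shift s x)) \<partial>P)"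
    by (simp add: kh)
  also have "\<dots> = (\<integral>x. k h1 x * k h2 x * (k h3 x * d x) \<partial>P)"
    by (rule integral_shift[of "\<lambda>x. k h1 x * k h2 x * (k h3 x * d x)"]) measurable
  also have "\<dots> = 0" using h by (intro mdiff_orth3[OF d] k) auto
  finally show "(\<integral>x. h1 x * h2 x * (h3 x * d (shift s x)) \<partial>P) = 0" .
qed

text \<open>The characteristic function as an integral over the innovation space, so that
  independence and shift invariance apply to it directly.\<close>

definition phi :: "((int \<Rightarrow> 's) \<Rightarrow> real) \<Rightarrow> real \<Rightarrow> complex" where
  "phi f \<theta> = (\<integral>x. iexp (\<theta> * f x) \<partial>P)"

lemma phi_char: "f \<in> borel_measurable P \<Longrightarrow> phi f \<theta> = char (distr P borel f) \<theta>"
  by (simp add: phi_def char_def integral_distr)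

lemma norm_phi_le: 
  assumes "f \<in> borel_measurable P" shows "cmod (phi f \<theta>) \<le> 1"
  using real_distribution.cmod_char_le_1[OF real_distribution_distr[OF assms]] by (simp add: phi_char[OF assms])

lemma integrable_iexp: "f \<in> borel_measurable P \<Longrightarrow> integrable P (\<lambda>x. iexp (\<theta> * f x))"
  by (rule integrable_const_bound[of _ 1]) auto

lemma cmod_iexp_diff: "cmod (iexp a - iexp b) \<le> \<bar>a - b\<bar>"
proof -
  have "iexp a - iexp b = iexp b * (iexp (a - b) - 1)"
    by (simp add: algebra_simps flip: exp_add)
  then have "cmod (iexp a - iexp b) = cmod (iexp (a - b) - 1)"
    by (simp add: norm_mult)
  also have "\<dots> \<le> \<bar>a - b\<bar>" using iexp_approx1[of "a - b" 0] by simp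
  finally show ?thesis .
qed

text \<open>The map x to exp (i x) is Lipschitz with constant 1. All L^2 approximations of random
  variables below reach the limit law through this bound.\<close>

lemma phi_diff:
  assumes f: "f \<in> borel_measurable P" and g: "g \<in> borel_measurable P" and fg: "Lp_le P 2 (\<lambda>x. f x - g x) a"
  shows "cmod (phi f \<theta> - phi g \<theta>) \<le> \<bar>\<theta>\<bar> * a"
proof -
  note [measurable] = f g
  have i: "integrable P (\<lambda>x. \<bar>f x - g x\<bar>)" using L2_L1[OF fg] by (auto simp: Lp_le_def)
  have "cmod (phi f \<theta> - phi g \<theta>) = cmod (\<integral>x. iexp (\<theta> * f x) - iexp (\<theta> * g x) \<partial>P)"
    unfolding phi_def by (rule arg_cong[OF Bochner_Integration.integral_diff[OF integrable_iexp[OF f] integrable_iexp[OF g], symmetric]])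
  also have "\<dots> \<le> (\<integral>x. cmod (iexp (\<theta> * f x) - iexp (\<theta> * g x)) \<partial>P)"
    by (rule integral_norm_bound)
  also have "\<dots> \<le> (\<integral>x. \<bar>\<theta>\<bar> * \<bar>f x - g x\<bar> \<partial>P)"
  proof (rule integral_mono)
    show "integrable P (\<lambda>x. cmod (iexp (\<theta> * f x) - iexp (\<theta> * g x)))"
      by (intro integrable_norm Bochner_Integration.integrable_diff integrable_iexp) measurable
    show "cmod (iexp (\<theta> * f x) - iexp (\<theta> * g x)) \<le> \<bar>\<theta>\<bar> * \<bar>f x - g x\<bar>" for x
      using cmod_iexp_diff[of "\<theta> * f x" "\<theta> * g x"] by (simp add: abs_mult flip: right_diff_distrib)
  qed (use i in auto)
  also have "\<dots> = \<bar>\<theta>\<bar> * (\<integral>x. \<bar>f x - g x\<bar> \<partial>P)" by simp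
  also have "\<dots> \<le> \<bar>\<theta>\<bar> * a" using L2_L1[OF fg] by (intro mult_left_mono) (auto simp: Lp_le_def)
  finally show ?thesis .
qed

end

lemma wt_row_interval:
  assumes n: "2 * m < n" and m: "m > 0"
  shows "(\<Sum>u\<in>{1..int n}. (wt m n (u - v))\<^sup>2) \<le> 1 / real n"
    and "(\<Sum>u\<in>{1..int n}. (wt m n (v - u))\<^sup>2) \<le> 1 / real n"
proof -
  have "(\<Sum>u\<in>{1..int n}. (wt m n (- v + u))\<^sup>2) \<le> 1 / real n"
    by (rule wt_row_le(1)[OF n m]) auto
  then show *: "(\<Sum>u\<in>{1..int n}. (wt m n (u - v))\<^sup>2) \<le> 1 / real n" by simp
  have "wt m n (v - u) = wt m n (u - v)" for u using wt_even[of m n "u - v"] by simp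
  with * show "(\<Sum>u\<in>{1..int n}. (wt m n (v - u))\<^sup>2) \<le> 1 / real n" by simp
qed

lemma eventually_double_less:
  fixes m :: "nat \<Rightarrow> nat"
  assumes m: "filterlim m at_top at_top" and mn: "(\<lambda>n. real (m n) / real n) \<longlonglongrightarrow> 0"
  shows "eventually (\<lambda>n. 2 * m n < n \<and> m n > 0) sequentially"
proof -
  have "eventually (\<lambda>n. real (m n) / real n < 1 / 2) sequentially"
    by (rule order_tendstoD(2)[OF mn]) simp
  moreover have "eventually (\<lambda>n. m n > 0) sequentially"
    using m unfolding filterlim_at_top by (auto dest!: spec[of _ 1] elim: eventually_mono)
  moreover have "eventually (\<lambda>n::nat. n > 0) sequentially" by (rule eventually_gt_at_top)
  ultimately show ?thesis
  proof eventually_elim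
    case (elim n)
    then have "2 * real (m n) < real n" by (simp add: field_simps)
    then show ?case using elim by linarith
  qed
qed

lemma sqrt_le_self: "1 \<le> x \<Longrightarrow> sqrt x \<le> x"
  using mult_left_mono[of 1 x x] by (intro real_le_lsqrt) (auto simp: power2_eq_square)

lemma exp_minus_taylor:
  fixes y :: real assumes "0 \<le> y" shows "\<bar>1 - y - exp (- y)\<bar> \<le> y\<^sup>2"
proof -
  have "1 - y \<le> exp (- y)" using exp_ge_add_one_self[of "- y"] by simp
  moreover have "exp (- y) \<le> 1 - y + y\<^sup>2"
  proof -
    have p: "1 + y \<le> exp y" "0 < 1 + y" using assms exp_ge_add_one_self[of y] by auto
    \<comment> \<open>The product equals 1 + y^3.\<close>
    have "1 \<le> (1 + y) * (1 - y + y\<^sup>2)"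
      using assms by (simp add: power2_eq_square algebra_simps)
    also have "\<dots> \<le> exp y * (1 - y + y\<^sup>2)"
    proof (intro mult_right_mono p)
      have "0 \<le> (y - 1/2)\<^sup>2" by simp
      then show "0 \<le> 1 - y + y\<^sup>2" by (simp add: power2_eq_square algebra_simps)
    qed
    finally show ?thesis by (simp add: exp_minus field_simps)
  qed
  ultimately show ?thesis by simp
qed

text \<open>The final approximant in abstract form: as \<open>d\<close> reads only the last
  \<open>W\<close> innovations, its translates at times at least \<open>W\<close> apart are
  independent, and its bound \<open>B\<close> supplies the moments that the process lacks.\<close>

locale bounded_window = iid_space \<mu> for \<mu> :: "'s measure" +
  fixes d :: "(int \<Rightarrow> 's) \<Rightarrow> real" and W :: nat and B :: real
  assumes d_mdiff: "mdiff 0 d" and d_dep: "dep {- int W<..0} d"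
    and d_bound: "\<And>x. x \<in> space P \<Longrightarrow> \<bar>d x\<bar> \<le> B" and B_nonneg: "0 \<le> B" and W_pos: "0 < W"
begin

section \<open>Quadratic forms in the translates of a bounded difference\<close>

definition D :: "int \<Rightarrow> (int \<Rightarrow> 's) \<Rightarrow> real" where "D t x = d (shift t x)"

definition sg :: real where "sg = (\<integral>x. (d x)\<^sup>2 \<partial>P)"

lemma d_meas [measurable]: "d \<in> borel_measurable P"
  by (rule L4_measurable[OF mdiff_L4[OF d_mdiff]])

lemma D_meas [measurable]: "D t \<in> borel_measurable P"
  unfolding D_def[abs_def] by measurable

lemma D_mdiff: "mdiff t (D t)"
  using mdiff_shift[OF d_mdiff, of t] by (simp add: D_def[abs_def])

lemma D_dep: "dep {t - int W<..t} (D t)"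
proof -
  have "(\<lambda>i. i + t) ` {- int W<..0} \<subseteq> {t - int W<..t}" by auto
  then show ?thesis using dep_shift[OF d_dep, of t] unfolding D_def[abs_def] by (rule dep_mono[rotated])
qed

lemma shift_space: "x \<in> space P \<Longrightarrow> shift t x \<in> space P"
  by (auto simp: shift_def space_PiM PiE_iff)

lemma D_bound: "x \<in> space P \<Longrightarrow> \<bar>D t x\<bar> \<le> B"
  unfolding D_def by (intro d_bound shift_space)

lemma D_L4: "Lp_le P p (D t) B"
  by (rule Lp_le_bounded) (auto simp: D_bound B_nonneg)

lemma D_shift: "D t (shift s x) = D (t + s) x"
  by (simp add: D_def shift_shift)

lemma integral_D_sq: "(\<integral>x. (D t x)\<^sup>2 \<partial>P) = sg"
  unfolding D_def sg_def by (rule integral_shift[of "\<lambda>x. (d x)\<^sup>2"]) measurable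

definition step :: "(int \<Rightarrow> int \<Rightarrow> real) \<Rightarrow> int set \<Rightarrow> int \<Rightarrow> (int \<Rightarrow> 's) \<Rightarrow> real" where
  "step c J v x = (\<Sum>u | u \<in> J \<and> u < v. c u v * D u x)"

lemma quad_step_eq: "quad J J c D D x = (\<Sum>v\<in>J. step c J v x * D v x)"
  by (simp add: quad_def step_def sum_distrib_right mult.assoc)

lemma step_facts:
  assumes "finite J"
  shows "Lp_le P 4 (step c J v) (2 * B * sqrt (\<Sum>u | u \<in> J \<and> u < v. (c u v)\<^sup>2))"
    and "dep {..<v} (step c J v)"
    and "v \<in> J \<Longrightarrow> Lp_le P 2 (\<lambda>x. step c J v x * D v x) (2 * B * B * sqrt (\<Sum>u | u \<in> J \<and> u < v. (c u v)\<^sup>2))"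
    and "v \<in> J \<Longrightarrow> s \<in> J \<Longrightarrow> s < v \<Longrightarrow> (\<integral>x. (step c J s x * D s x) * (step c J v x * D v x) \<partial>P) = 0"
  using quad_step[OF assms assms D_mdiff D_L4 D_mdiff D_L4 B_nonneg B_nonneg, where c = c]
  unfolding step_def[abs_def] by blast+

lemma step_meas: "finite J \<Longrightarrow> step c J v \<in> borel_measurable P"
  using step_facts(1) Lp_le_measurable by blast

text \<open>The moment inequality is applied twice, to the inner linear form and to the outer sum.
  In L^4 the product of inner form and difference is affordable because the difference is replaced
  by its bound \<open>B\<close>.\<close>

lemma quad_DD_L4:
  assumes J: "finite J"
  shows "Lp_le P 4 (quad J J c D D) (4 * B\<^sup>2 * sqrt (\<Sum>v\<in>J. \<Sum>u | u \<in> J \<and> u < v. (c u v)\<^sup>2))"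
proof -
  let ?q = "\<lambda>v. \<Sum>u | u \<in> J \<and> u < v. (c u v)\<^sup>2"
  have "Lp_le P 4 (\<lambda>x. \<Sum>v\<in>J. step c J v x * D v x) (2 * sqrt (\<Sum>v\<in>J. (B * (2 * B * sqrt (?q v)))\<^sup>2))"
  proof (rule burkholder4[OF J])
    fix v assume "v \<in> J"
    note [measurable] = step_meas[OF J, of c v]
    \<comment> \<open>A purely qualitative bound: it makes the factor admissible in
      \<open>mdiff_mult_bounded\<close> and does not enter the constant.\<close>
    have bd: "\<bar>step c J v x\<bar> \<le> (\<Sum>u | u \<in> J \<and> u < v. \<bar>c u v\<bar> * B)" if "x \<in> space P" for x
      unfolding step_def by (rule order_trans[OF sum_abs]) (auto simp: abs_mult D_bound that intro!: sum_mono mult_left_mono)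
    show "mdiff v (\<lambda>x. step c J v x * D v x)"
      by (rule mdiff_mult_bounded[OF D_mdiff step_facts(2)[OF J] _ bd]) measurable
    have "Lp_le P 4 (\<lambda>x. B * step c J v x) (B * (2 * B * sqrt (?q v)))"
      using Lp_le_cmult[OF step_facts(1)[OF J], of B] B_nonneg by simp
    then show "Lp_le P 4 (\<lambda>x. step c J v x * D v x) (B * (2 * B * sqrt (?q v)))"
    proof (rule Lp_le_dominated)
      fix x assume "x \<in> space P"
      then show "\<bar>step c J v x * D v x\<bar> \<le> \<bar>B * step c J v x\<bar>"
        using D_bound[of x v] B_nonneg by (auto simp: abs_mult mult.commute[of B] intro!: mult_left_mono)
    qed measurable
  qed
  also have "(\<Sum>v\<in>J. (B * (2 * B * sqrt (?q v)))\<^sup>2) = (2 * B\<^sup>2)\<^sup>2 * (\<Sum>v\<in>J. ?q v)"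
  proof -
    have "(B * (2 * B * sqrt q))\<^sup>2 = (2 * B\<^sup>2)\<^sup>2 * q" if "0 \<le> q" for q
    proof -
      have "B * (2 * B * sqrt q) = (2 * B\<^sup>2) * sqrt q" by (simp add: power2_eq_square)
      then show ?thesis using that by (simp only: power_mult_distrib real_sqrt_pow2)
    qed
    then show ?thesis unfolding sum_distrib_left[of _ ?q] by (intro sum.cong refl) (simp add: sum_nonneg)
  qed
  also have "2 * sqrt \<dots> = 4 * B\<^sup>2 * sqrt (\<Sum>v\<in>J. ?q v)"
    using B_nonneg by (simp only: real_sqrt_mult real_sqrt_abs) simp
  finally show ?thesis by (simp add: quad_step_eq[abs_def])
qed

text \<open>With a gap of \<open>W\<close> the inner form at \<open>v\<close> reads innovations up
  to v - W and \<open>D v\<close> only later ones. The second moment of their product therefore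
  factorises, and every pair contributes its squared coefficient times \<open>sg\<close>
  squared.\<close>

lemma quad_DD_var:
  assumes J: "finite J" and c: "\<And>u v. v - int W < u \<Longrightarrow> c u v = 0"
  shows "(\<integral>x. (quad J J c D D x)\<^sup>2 \<partial>P) = sg\<^sup>2 * (\<Sum>v\<in>J. \<Sum>u | u \<in> J \<and> u < v. (c u v)\<^sup>2)"
proof -
  have "(\<integral>x. (quad J J c D D x)\<^sup>2 \<partial>P) = (\<Sum>v\<in>J. \<integral>x. (step c J v x * D v x)\<^sup>2 \<partial>P)"
    unfolding quad_step_eq by (rule L2_sum_orth(1)[OF J step_facts(3)[OF J]]) (use step_facts(4)[OF J] in auto)
  also have "\<dots> = (\<Sum>v\<in>J. sg\<^sup>2 * (\<Sum>u | u \<in> J \<and> u < v. (c u v)\<^sup>2))"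
  proof (intro sum.cong refl)
    fix v assume v: "v \<in> J"
    have d1: "dep {..v - int W} (step c J v)"
      unfolding step_def[abs_def]
    proof (rule dep_sum)
      fix u assume "u \<in> {u. u \<in> J \<and> u < v}"
      show "dep {..v - int W} (\<lambda>x. c u v * D u x)"
      proof (cases "v - int W < u")
        case True then show ?thesis by (simp add: c dep_const)
      next
        case False then show ?thesis
          by (intro dep_cmult dep_mono[OF D_dep]) auto
      qed
    qed
    have sq: "integrable P (\<lambda>x. (step c J v x)\<^sup>2)" "integrable P (\<lambda>x. (D v x)\<^sup>2)"
      using L4_L2[OF step_facts(1)[OF J, of c v]] D_L4[of 2 v] by (auto simp: Lp_le_def)
    have "(\<integral>x. (step c J v x * D v x)\<^sup>2 \<partial>P) = (\<integral>x. (step c J v x)\<^sup>2 * (D v x)\<^sup>2 \<partial>P)"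
      by (simp add: power_mult_distrib)
    also have "\<dots> = (\<integral>x. (step c J v x)\<^sup>2 \<partial>P) * (\<integral>x. (D v x)\<^sup>2 \<partial>P)"
      by (rule integral_mult_indep[OF dep_comp[OF d1] sq(1) dep_comp[OF D_dep] sq(2)]) auto
    also have "(\<integral>x. (step c J v x)\<^sup>2 \<partial>P) = (\<Sum>u | u \<in> J \<and> u < v. \<integral>x. (c u v * D u x)\<^sup>2 \<partial>P)"
      unfolding step_def
    proof (rule L2_sum_orth(1))
      show "Lp_le P 2 (\<lambda>x. c u v * D u x) (\<bar>c u v\<bar> * B)" for u by (intro Lp_le_cmult D_L4)
      show "(\<integral>x. (c s v * D s x) * (c t v * D t x) \<partial>P) = 0" if "s < t" for s t
        by (rule mdiff_orth[OF mdiff_cmult[OF D_mdiff] mdiff_cmult[OF D_mdiff]]) (use that in auto)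
    qed (use J in auto)
    finally show "(\<integral>x. (step c J v x * D v x)\<^sup>2 \<partial>P) = sg\<^sup>2 * (\<Sum>u | u \<in> J \<and> u < v. (c u v)\<^sup>2)"
      by (simp add: power_mult_distrib integral_D_sq sum_distrib_right[symmetric] power2_eq_square[of sg])
  qed
  finally show ?thesis by (simp add: sum_distrib_left)
qed

text \<open>Second-order Taylor expansion, with the third moment obtained from U and U^2 by
  Cauchy-Schwarz. Replacing 1 - y by exp (-y) makes the N-th power of the approximation Gaussian at
  once.\<close>

lemma phi_approx:
  assumes U: "Lp_le P 4 U k" and U0: "(\<integral>x. U x \<partial>P) = 0" and U2: "(\<integral>x. (U x)\<^sup>2 \<partial>P) = v"
  shows "cmod (phi U \<theta> - of_real (exp (- (\<theta>\<^sup>2 * v / 2)))) \<le> \<bar>\<theta>\<bar> ^ 3 * k ^ 3 + (\<theta>\<^sup>2 * v / 2)\<^sup>2"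
proof -
  note [measurable] = Lp_le_measurable[OF U]
  note U' = L4_L2[OF U]
  have UUU: "Lp_le P 1 (\<lambda>x. U x * (U x * U x)) (k * (k * k))"
    by (intro L2_mult L4_mult U L4_L2)
  have cube: "\<bar>a * (a * a)\<bar> ^ 1 = \<bar>a\<bar> ^ 3" for a :: real
    by (simp only: abs_mult power3_eq_cube mult.assoc power_one_right)
  have i3: "integrable P (\<lambda>x. \<bar>U x\<bar> ^ 3)"
    using Lp_le_integrable[OF UUU] by (simp only: cube)
  have b3: "(\<integral>x. \<bar>U x\<bar> ^ 3 \<partial>P) \<le> k ^ 3"
    using Lp_le_integral[OF UUU] unfolding cube by (simp add: power3_eq_cube mult.assoc)
  have i2: "integrable P (\<lambda>x. (U x)\<^sup>2)" using U' by (auto simp: Lp_le_def)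
  have "cmod (char (distr P borel U) \<theta> - (1 - \<theta>\<^sup>2 * v / 2)) \<le>
     (\<theta>\<^sup>2 / 6) * (\<integral>x. min (6 * (U x)\<^sup>2) (\<bar>\<theta>\<bar> * \<bar>U x\<bar> ^ 3) \<partial>P)"
    by (rule char_approx3'[OF _ L4_integrable[OF U] i2 U0 _ refl]) (auto simp: U0 U2)
  also have "\<dots> \<le> (\<theta>\<^sup>2 / 6) * (\<integral>x. \<bar>\<theta>\<bar> * \<bar>U x\<bar> ^ 3 \<partial>P)"
    by (intro mult_left_mono integral_mono) (use i3 i2 in auto)
  also have "\<dots> \<le> (\<theta>\<^sup>2 / 6) * (\<bar>\<theta>\<bar> * k ^ 3)"
    using b3 by (intro mult_left_mono) (auto intro: mult_left_mono)
  also have "\<dots> = (\<bar>\<theta>\<bar> ^ 3 * k ^ 3) / 6"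
    by (simp add: power3_eq_cube power2_eq_square)
  also have "\<dots> \<le> \<bar>\<theta>\<bar> ^ 3 * k ^ 3"
    using Lp_le_nonneg[OF U] mult_nonneg_nonneg[of "\<bar>\<theta>\<bar> ^ 3" "k ^ 3"] by simp
  finally have 1: "cmod (phi U \<theta> - of_real (1 - \<theta>\<^sup>2 * v / 2)) \<le> \<bar>\<theta>\<bar> ^ 3 * k ^ 3"
    by (simp add: phi_char)
  have v0: "0 \<le> \<theta>\<^sup>2 * v / 2" using U2 integral_nonneg_AE[of "\<lambda>x. (U x)\<^sup>2" P] by simp
  have 2: "cmod (of_real (1 - \<theta>\<^sup>2 * v / 2) - of_real (exp (- (\<theta>\<^sup>2 * v / 2)))) \<le> (\<theta>\<^sup>2 * v / 2)\<^sup>2"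
    unfolding of_real_diff[symmetric] norm_of_real by (rule exp_minus_taylor[OF v0])
  show ?thesis
    by (rule norm_diff_triangle_le[OF 1 2])
qed

text \<open>The factor 2 folds the symmetric double sum onto \<open>u < v\<close>. The cutoff
  creates the gap on which \<open>quad_DD_var\<close> relies.\<close>

definition coef :: "nat \<Rightarrow> nat \<Rightarrow> int \<Rightarrow> int \<Rightarrow> real" where
  "coef m n u v = (if u \<le> v - int W then 2 * wt m n (u - v) else 0)"

text \<open>The first \<open>W\<close> indices of each block are dropped, which makes the blocks independent.\<close>
definition blk :: "nat \<Rightarrow> nat \<Rightarrow> int set" where
  "blk q i = {int i * int q + int W + 1..int i * int q + int q}"

definition blk_quad :: "nat \<Rightarrow> nat \<Rightarrow> nat \<Rightarrow> nat \<Rightarrow> (int \<Rightarrow> 's) \<Rightarrow> real" where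
  "blk_quad m n q i = quad (blk q i) (blk q i) (coef m n) D D"

definition good :: "nat \<Rightarrow> nat \<Rightarrow> int \<Rightarrow> int \<Rightarrow> bool" where
  "good N q u v \<longleftrightarrow> (\<exists>i<N. u \<in> blk q i \<and> v \<in> blk q i)"

section \<open>Geometry of the blocks and the discarded pairs\<close>

lemma finite_blk [simp]: "finite (blk q i)"
  by (simp add: blk_def)

lemma blk_less: "u \<in> blk q i \<Longrightarrow> v \<in> blk q j \<Longrightarrow> i < j \<Longrightarrow> u \<le> int j * int q \<and> int j * int q < v"
proof -
  assume "u \<in> blk q i" "v \<in> blk q j" "i < j"
  moreover from \<open>i < j\<close> have "(int i + 1) * int q \<le> int j * int q" by (intro mult_right_mono) auto
  ultimately show ?thesis by (auto simp: blk_def algebra_simps)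
qed

lemma blk_unique: "u \<in> blk q i \<Longrightarrow> u \<in> blk q j \<Longrightarrow> i = j"
  using blk_less[of u q i u j] blk_less[of u q j u i] by (cases i j rule: linorder_cases) auto

lemma blk_subset:
  assumes "N * q \<le> n" "i < N" shows "blk q i \<subseteq> {1..int n}"
proof -
  have "(i + 1) * q \<le> N * q" using assms by (intro mult_right_mono) auto
  then have "(i + 1) * q \<le> n" using assms by simp
  then have "int ((i + 1) * q) \<le> int n" by (simp only: of_nat_le_iff)
  moreover have "0 \<le> int i * int q" by simp
  ultimately show ?thesis by (auto simp: blk_def algebra_simps)
qed

lemma sum_blk:
  fixes F :: "int \<Rightarrow> int \<Rightarrow> real"
  assumes "N * q \<le> n"
  shows "(\<Sum>i<N. \<Sum>v\<in>blk q i. \<Sum>u | u \<in> blk q i \<and> u < v. F u v) =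
    (\<Sum>v\<in>{1..int n}. \<Sum>u | u \<in> {1..int n} \<and> u < v. if good N q u v then F u v else 0)"
proof -
  let ?I = "{1..int n}" and ?P = "\<lambda>i u v. u \<in> blk q i \<and> v \<in> blk q i"
  have split: "(if good N q u v then F u v else 0) = (\<Sum>i<N. if ?P i u v then F u v else 0)" for u v
  proof (cases "good N q u v")
    case True
    then obtain j where j: "j < N" "?P j u v" by (auto simp: good_def)
    then have "(\<Sum>i<N. if ?P i u v then F u v else 0) = (\<Sum>i<N. if i = j then F u v else 0)"
      by (intro sum.cong refl) (auto dest: blk_unique)
    then show ?thesis using True j by simp
  next
    case False
    then have "(\<Sum>i<N. if ?P i u v then F u v else 0) = 0" by (intro sum.neutral) (auto simp: good_def)
    then show ?thesis using False by simp
  qed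
  have fin: "finite {u. u \<in> ?I \<and> u < v}" for v by (rule finite_subset[of _ ?I]) auto
  have "(\<Sum>v\<in>?I. \<Sum>u | u \<in> ?I \<and> u < v. if good N q u v then F u v else 0) =
    (\<Sum>v\<in>?I. \<Sum>i<N. \<Sum>u | u \<in> ?I \<and> u < v. if ?P i u v then F u v else 0)"
    unfolding split by (intro sum.cong refl sum.swap)
  also have "\<dots> = (\<Sum>i<N. \<Sum>v\<in>?I. \<Sum>u | u \<in> ?I \<and> u < v. if ?P i u v then F u v else 0)"
    by (rule sum.swap)
  also have "\<dots> = (\<Sum>i<N. \<Sum>v\<in>blk q i. \<Sum>u | u \<in> blk q i \<and> u < v. F u v)"
  proof (rule sum.cong[OF refl])
    fix i assume i: "i \<in> {..<N}"
    have sub: "blk q i \<subseteq> ?I" using blk_subset[OF assms, of i] i by simp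
    show "(\<Sum>v\<in>?I. \<Sum>u | u \<in> ?I \<and> u < v. if ?P i u v then F u v else 0) = (\<Sum>v\<in>blk q i. \<Sum>u | u \<in> blk q i \<and> u < v. F u v)"
    proof (rule sum.mono_neutral_cong_right)
      fix v assume v: "v \<in> blk q i"
      show "(\<Sum>u | u \<in> ?I \<and> u < v. if ?P i u v then F u v else 0) = (\<Sum>u | u \<in> blk q i \<and> u < v. F u v)"
        by (rule sum.mono_neutral_cong_right) (use v sub fin in auto)
    next
      show "\<forall>v\<in>?I - blk q i. (\<Sum>u | u \<in> ?I \<and> u < v. if ?P i u v then F u v else 0) = 0"
        by (auto intro!: sum.neutral)
    qed (use sub in auto)
  qed
  finally show ?thesis by simp
qed

text \<open>A discarded pair is closer than \<open>W\<close>, or has an index outside all blocks, or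
  is separated by the left end of a block. These cases are paid for by the maximum of the weights,
  by the mass of a row or column, and by the crossing estimate.\<close>

lemma sum_bad:
  assumes n: "2 * m < n" and m: "m > 0" and q: "q = n div N" and N: "N > 0"
  shows "(\<Sum>v\<in>{1..int n}. \<Sum>u | u \<in> {1..int n} \<and> u < v.
      if good N q u v \<and> u \<le> v - int W then 0 else (wt m n (u - v))\<^sup>2) \<le>
    real W * real m / real n + 2 * (real N + real N * real W) / real n + real N / sqrt (real m)"
proof -
  let ?I = "{1..int n}" and ?f = "\<lambda>u v. (wt m n (u - v))\<^sup>2"
  let ?b = "\<lambda>i. int i * int q"
  let ?cut = "\<lambda>i u v. if u \<le> ?b i \<and> ?b i < v then ?f u v else 0"
  have n0: "n > 0" using n by simp
  have Nq: "N * q \<le> n" unfolding q by simp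
  have n_less: "n < N * q + N"
    unfolding q using N mult_div_mod_eq[of N n] mod_less_divisor[OF N, of n] by linarith
  define Drop where "Drop = ?I - (\<Union>i<N. blk q i)"
  have finD: "finite Drop" "Drop \<subseteq> ?I" by (auto simp: Drop_def)
  \<comment> \<open>Outside the blocks lie at most \<open>W\<close> indices per block and the
    remainder of n modulo N, which is below N.\<close>
  have cardD: "real (card Drop) \<le> real N + real N * real W"
  proof -
    have "card (\<Union>i<N. blk q i) = (\<Sum>i<N. card (blk q i))"
      by (rule card_UN_disjoint) (auto dest: blk_unique)
    also have "\<dots> = (\<Sum>i<N. q - W)" by (intro sum.cong refl) (simp add: blk_def)
    also have "\<dots> = N * (q - W)" by simp
    finally have "card Drop = n - N * (q - W)"
      unfolding Drop_def using blk_subset[OF Nq] by (subst card_Diff_subset) auto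
    also have "\<dots> \<le> N + N * W"
    proof -
      have "N * q \<le> N * ((q - W) + W)" by (intro mult_le_mono2) simp
      then have "N * q \<le> N * (q - W) + N * W" by (simp add: distrib_left)
      then show ?thesis using n_less by linarith
    qed
    finally have "real (card Drop) \<le> real (N + N * W)" by (simp only: of_nat_le_iff)
    then show ?thesis by simp
  qed
  let ?near = "\<lambda>u v. if v - int W < u then ?f u v else 0"
  let ?du = "\<lambda>u v. if u \<in> Drop then ?f u v else 0" and ?dv = "\<lambda>u v. if v \<in> Drop then ?f u v else 0"
  have f0: "0 \<le> ?f u v" for u v by simp
  have row: "(\<Sum>u\<in>?I. ?f u v) \<le> 1 / real n" for v
    by (rule wt_row_interval(1)[OF n m])
  have col: "(\<Sum>v\<in>?I. ?f u v) \<le> 1 / real n" for u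
    by (rule wt_row_interval(2)[OF n m])
  have pw: "(if good N q u v \<and> u \<le> v - int W then 0 else ?f u v) \<le>
     ?near u v + ?du u v + ?dv u v
     + (\<Sum>i\<in>{..<N}. ?cut i u v)"
    if "u \<in> ?I" "v \<in> ?I" "u < v" for u v
  proof (cases "v - int W < u \<or> u \<in> Drop \<or> v \<in> Drop")
    case True
    then have "?f u v \<le> ?near u v + ?du u v + ?dv u v"
      using f0[of u v] by auto
    moreover have "0 \<le> (\<Sum>i\<in>{..<N}. ?cut i u v)"
      by (intro sum_nonneg) auto
    ultimately have "?f u v + 0 \<le> ?near u v + ?du u v + ?dv u v
     + (\<Sum>i\<in>{..<N}. ?cut i u v)" by (rule add_mono)
    then show ?thesis by (rule order_trans[rotated]) simp
  next
    case False
    then have "u \<in> (\<Union>i<N. blk q i)" "v \<in> (\<Union>i<N. blk q i)"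
      using that(1,2) unfolding Drop_def by blast+
    then obtain i j where ij: "i < N" "u \<in> blk q i" "j < N" "v \<in> blk q j" by blast
    show ?thesis
    proof (cases "i = j")
      case True
      then have "good N q u v" using ij by (auto simp: good_def)
      then show ?thesis using False f0[of u v] by (auto intro!: sum_nonneg)
    next
      case False
      have "\<not> j < i" using blk_less[OF ij(4,2)] that by auto
      with False have "i < j" by simp
      then have "u \<le> int j * int q \<and> int j * int q < v" using blk_less[OF ij(2,4)] by simp
      then have "?f u v \<le> (\<Sum>i\<in>{..<N}. ?cut i u v)"
        using ij(3) member_le_sum[of j "{..<N}" "\<lambda>i. ?cut i u v"]
        by auto
      moreover have "0 \<le> ?near u v + ?du u v + ?dv u v"
        by simp
      ultimately have "0 + ?f u v \<le> ?near u v + ?du u v + ?dv u v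
     + (\<Sum>i\<in>{..<N}. ?cut i u v)" by (intro add_mono)
      then show ?thesis by (rule order_trans[rotated]) simp
    qed
  qed
  let ?T = "\<lambda>Q. \<Sum>v\<in>?I. \<Sum>u | u \<in> ?I \<and> u < v. if Q u v then ?f u v else 0"
  have "(\<Sum>v\<in>?I. \<Sum>u | u \<in> ?I \<and> u < v. if good N q u v \<and> u \<le> v - int W then 0 else ?f u v) \<le>
    (\<Sum>v\<in>?I. \<Sum>u | u \<in> ?I \<and> u < v. ?near u v + ?du u v + ?dv u v
     + (\<Sum>i\<in>{..<N}. ?cut i u v))"
    by (intro sum_mono pw) auto
  also have "\<dots> = ?T (\<lambda>u v. v - int W < u) + ?T (\<lambda>u v. u \<in> Drop) + ?T (\<lambda>u v. v \<in> Drop) +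
     (\<Sum>v\<in>?I. \<Sum>u | u \<in> ?I \<and> u < v. \<Sum>i\<in>{..<N}. ?cut i u v)"
    by (simp add: sum.distrib)
  also have "(\<Sum>v\<in>?I. \<Sum>u | u \<in> ?I \<and> u < v. \<Sum>i\<in>{..<N}. ?cut i u v)
     = (\<Sum>i\<in>{..<N}. ?T (\<lambda>u v. u \<le> ?b i \<and> ?b i < v))"
    by (subst (2) sum.swap, subst sum.swap, rule refl)
  finally have main: "(\<Sum>v\<in>?I. \<Sum>u | u \<in> ?I \<and> u < v. if good N q u v \<and> u \<le> v - int W then 0 else ?f u v) \<le>
    ?T (\<lambda>u v. v - int W < u) + ?T (\<lambda>u v. u \<in> Drop) + ?T (\<lambda>u v. v \<in> Drop) + (\<Sum>i\<in>{..<N}. ?T (\<lambda>u v. u \<le> ?b i \<and> ?b i < v))" .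
  have 1: "?T (\<lambda>u v. v - int W < u) \<le> real W * real m / real n"
  proof -
    have "(\<Sum>u | u \<in> ?I \<and> u < v. if v - int W < u then ?f u v else 0) \<le> real W * (real m / (real n)\<^sup>2)" for v
    proof -
      have "(\<Sum>u | u \<in> ?I \<and> u < v. if v - int W < u then ?f u v else 0) = (\<Sum>u | u \<in> ?I \<and> u < v \<and> v - int W < u. ?f u v)"
        by (rule sum.mono_neutral_cong_right) (auto intro: finite_subset[of _ ?I])
      also have "\<dots> \<le> (\<Sum>u | u \<in> ?I \<and> u < v \<and> v - int W < u. real m / (real n)\<^sup>2)"
      proof (rule sum_mono)
        fix u
        have "(wt m n (u - v))\<^sup>2 \<le> (sqrt (real m) / real n)\<^sup>2"
          using wt_abs_le[OF m, of n "u - v"] by (metis abs_ge_zero power2_abs power_mono)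
        then show "?f u v \<le> real m / (real n)\<^sup>2" by (simp add: power_divide)
      qed
      also have "\<dots> = real (card {u. u \<in> ?I \<and> u < v \<and> v - int W < u}) * (real m / (real n)\<^sup>2)" by simp
      also have "\<dots> \<le> real W * (real m / (real n)\<^sup>2)"
      proof (intro mult_right_mono)
        have "card {u. u \<in> ?I \<and> u < v \<and> v - int W < u} \<le> card {v - int W..<v}"
          by (intro card_mono) auto
        then show "real (card {u. u \<in> ?I \<and> u < v \<and> v - int W < u}) \<le> real W" by simp
      qed simp
      finally show ?thesis .
    qed
    then have "?T (\<lambda>u v. v - int W < u) \<le> (\<Sum>v\<in>?I. real W * (real m / (real n)\<^sup>2))" by (intro sum_mono)
    also have "\<dots> = real W * real m / real n" using n0 by (simp add: power2_eq_square)
    finally show ?thesis .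
  qed
  have 2: "?T (\<lambda>u v. u \<in> Drop) \<le> (real N + real N * real W) / real n"
  proof -
    have "?T (\<lambda>u v. u \<in> Drop) \<le> (\<Sum>v\<in>?I. \<Sum>u\<in>Drop. ?f u v)"
    proof (rule sum_mono)
      fix v
      have "(\<Sum>u | u \<in> ?I \<and> u < v. if u \<in> Drop then ?f u v else 0) = (\<Sum>u | u \<in> ?I \<and> u < v \<and> u \<in> Drop. ?f u v)"
        by (rule sum.mono_neutral_cong_right) (auto intro: finite_subset[of _ ?I])
      also have "\<dots> \<le> (\<Sum>u\<in>Drop. ?f u v)" using finD by (intro sum_mono2) auto
      finally show "(\<Sum>u | u \<in> ?I \<and> u < v. if u \<in> Drop then ?f u v else 0) \<le> (\<Sum>u\<in>Drop. ?f u v)" .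
    qed
    also have "\<dots> = (\<Sum>u\<in>Drop. \<Sum>v\<in>?I. ?f u v)" by (rule sum.swap)
    also have "\<dots> \<le> (\<Sum>u\<in>Drop. 1 / real n)" by (intro sum_mono col)
    also have "\<dots> \<le> (real N + real N * real W) / real n" using cardD by (simp add: divide_right_mono)
    finally show ?thesis .
  qed
  have 3: "?T (\<lambda>u v. v \<in> Drop) \<le> (real N + real N * real W) / real n"
  proof -
    have "?T (\<lambda>u v. v \<in> Drop) = (\<Sum>v\<in>Drop. \<Sum>u | u \<in> ?I \<and> u < v. ?f u v)"
      by (rule sum.mono_neutral_cong_right) (use finD in auto)
    also have "\<dots> \<le> (\<Sum>v\<in>Drop. \<Sum>u\<in>?I. ?f u v)" by (intro sum_mono sum_mono2) auto
    also have "\<dots> \<le> (\<Sum>v\<in>Drop. 1 / real n)" by (intro sum_mono row)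
    also have "\<dots> \<le> (real N + real N * real W) / real n" using cardD by (simp add: divide_right_mono)
    finally show ?thesis .
  qed
  have 4: "?T (\<lambda>u v. u \<le> ?b i \<and> ?b i < v) \<le> 1 / sqrt (real m)" if "i < N" for i
  proof -
    have "i * q \<le> N * q" using that by (intro mult_right_mono) auto
    then have "i * q \<le> n" using Nq by (rule le_trans)
    then have b: "0 \<le> ?b i" "?b i \<le> int n" by (auto simp flip: of_nat_mult)
    have "?T (\<lambda>u v. u \<le> ?b i \<and> ?b i < v) = (\<Sum>v\<in>{?b i+1..int n}. \<Sum>u\<in>{1..?b i}. ?f u v)"
    proof (rule sum.mono_neutral_cong_right)
      show "{?b i+1..int n} \<subseteq> ?I" using b by auto
      fix v assume "v \<in> {?b i+1..int n}"
      then show "(\<Sum>u | u \<in> ?I \<and> u < v. if u \<le> ?b i \<and> ?b i < v then ?f u v else 0) = (\<Sum>u\<in>{1..?b i}. ?f u v)"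
        using b by (intro sum.mono_neutral_cong_right) (auto intro: finite_subset[of _ ?I])
    qed (auto intro!: sum.neutral)
    also have "\<dots> = (\<Sum>u\<in>{1..?b i}. \<Sum>v\<in>{?b i+1..int n}. ?f u v)" by (rule sum.swap)
    also have "\<dots> \<le> 1 / sqrt (real m)" by (rule wt_crossing[OF n m b])
    finally show ?thesis .
  qed
  have "(\<Sum>i\<in>{..<N}. ?T (\<lambda>u v. u \<le> ?b i \<and> ?b i < v)) \<le> (\<Sum>i\<in>{..<N}. 1 / sqrt (real m))"
    by (intro sum_mono 4) auto
  then have 5: "(\<Sum>i\<in>{..<N}. ?T (\<lambda>u v. u \<le> ?b i \<and> ?b i < v)) \<le> real N / sqrt (real m)" by simp
  have eq: "2 * (real N + real N * real W) / real n = (real N + real N * real W) / real n + (real N + real N * real W) / real n"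
    by simp
  show ?thesis unfolding eq using main 1 2 3 5 by linarith
qed

text \<open>A block has at most n / N columns, each with squared coefficients of total at most 4 /
  n. So a block has size N^(-1/2), and the cubic errors of N blocks add up to order
  N^(-1/2).\<close>

lemma blk_quad_L4:
  assumes n: "2 * m < n" and m: "m > 0" and q: "q = n div N" and N: "N > 0" and i: "i < N"
  shows "Lp_le P 4 (blk_quad m n q i) (8 * B\<^sup>2 / sqrt (real N))"
proof -
  have n0: "n > 0" using n by simp
  have Nq: "N * q \<le> n" unfolding q by simp
  have "(\<Sum>v\<in>blk q i. \<Sum>u | u \<in> blk q i \<and> u < v. (coef m n u v)\<^sup>2) \<le> (\<Sum>v\<in>blk q i. 4 * (1 / real n))"
  proof (rule sum_mono)
    fix v
    have "(\<Sum>u | u \<in> blk q i \<and> u < v. (coef m n u v)\<^sup>2) \<le> (\<Sum>u\<in>{1..int n}. 4 * (wt m n (u - v))\<^sup>2)"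
    proof (rule order_trans[OF sum_mono sum_mono2])
      show "(coef m n u v)\<^sup>2 \<le> 4 * (wt m n (u - v))\<^sup>2" for u
        by (simp add: coef_def power_mult_distrib)
    qed (use blk_subset[OF Nq i] in auto)
    also have "\<dots> \<le> 4 * (1 / real n)"
      unfolding sum_distrib_left[symmetric]
      by (intro mult_left_mono wt_row_interval(1)[OF n m]) auto
    finally show "(\<Sum>u | u \<in> blk q i \<and> u < v. (coef m n u v)\<^sup>2) \<le> 4 * (1 / real n)" .
  qed
  also have "\<dots> = 4 * (real (card (blk q i)) / real n)" by simp
  also have "\<dots> \<le> 4 * (1 / real N)"
  proof -
    have "card (blk q i) \<le> q" by (simp add: blk_def)
    then have "N * card (blk q i) \<le> n" using Nq by (meson le_trans mult_le_mono2)
    then have "real N * real (card (blk q i)) \<le> real n" by (simp flip: of_nat_mult)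
    then show ?thesis using n0 N by (simp add: field_simps)
  qed
  finally have "sqrt (\<Sum>v\<in>blk q i. \<Sum>u | u \<in> blk q i \<and> u < v. (coef m n u v)\<^sup>2) \<le> sqrt (4 * (1 / real N))"
    by (rule real_sqrt_le_mono)
  also have "\<dots> = 2 / sqrt (real N)" by (simp add: real_sqrt_mult real_sqrt_divide)
  finally have "4 * B\<^sup>2 * sqrt (\<Sum>v\<in>blk q i. \<Sum>u | u \<in> blk q i \<and> u < v. (coef m n u v)\<^sup>2) \<le> 4 * B\<^sup>2 * (2 / sqrt (real N))"
    by (intro mult_left_mono) auto
  then show ?thesis
    unfolding blk_quad_def by (intro Lp_le_mono[OF quad_DD_L4]) auto
qed

lemma blk_quad_meas: "blk_quad m n q i \<in> borel_measurable P"
  unfolding blk_quad_def by (rule Lp_le_measurable[OF quad_DD_L4]) simp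

text \<open>The coefficients depend on \<open>u - v\<close> only, so the blocks are translates of
  one another and identically distributed.\<close>

lemma blk_quad_shift: "blk_quad m n q 0 (shift (int i * int q) x) = blk_quad m n q i x"
proof -
  let ?s = "int i * int q"
  have c: "coef m n (u - ?s) (v - ?s) = coef m n u v" for u v by (simp add: coef_def)
  have "blk_quad m n q i x = (\<Sum>v\<in>blk q i. \<Sum>u | u \<in> blk q i \<and> u < v. coef m n u v * (D u x * D v x))"
    by (simp add: blk_quad_def quad_def)
  also have "\<dots> = (\<Sum>v\<in>blk q 0. \<Sum>u | u \<in> blk q 0 \<and> u < v. coef m n u v * (D (u + ?s) x * D (v + ?s) x))"
  proof (rule sum.reindex_bij_witness[of _ "\<lambda>v. v + ?s" "\<lambda>v. v - ?s"])
    fix v assume "v \<in> blk q i"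
    show "(\<Sum>u | u \<in> blk q 0 \<and> u < v - ?s. coef m n u (v - ?s) * (D (u + ?s) x * D (v - ?s + ?s) x)) =
      (\<Sum>u | u \<in> blk q i \<and> u < v. coef m n u v * (D u x * D v x))"
      by (rule sum.reindex_bij_witness[of _ "\<lambda>v. v - ?s" "\<lambda>v. v + ?s"])
         (auto simp: blk_def coef_def algebra_simps)
  qed (auto simp: blk_def)
  also have "\<dots> = blk_quad m n q 0 (shift ?s x)"
    by (simp add: blk_quad_def quad_def D_shift)
  finally show ?thesis by simp
qed

lemma blk_quad_dep: "dep {int i * int q<..int (Suc i) * int q} (blk_quad m n q i)"
proof -
  have "dep {int i * int q<..int (Suc i) * int q} (D u)" if "u \<in> blk q i" for u
    by (rule dep_mono[OF D_dep]) (use that in \<open>auto simp: blk_def algebra_simps\<close>)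
  then show ?thesis
    unfolding blk_quad_def[abs_def] quad_def[abs_def]
    by (intro dep_sum dep_cmult dep_mult) auto
qed

text \<open>Each block reads the innovations of its own interval, hence the factorisation; shift
  invariance identifies all factors with the first.\<close>

lemma phi_blocks: "phi (\<lambda>x. \<Sum>i<N. blk_quad m n q i x) \<theta> = (phi (blk_quad m n q 0) \<theta>) ^ N"
proof (induction N)
  case 0
  then show ?case by (simp add: phi_def prob_space)
next
  case (Suc N)
  note [measurable] = blk_quad_meas
  let ?A = "{..int N * int q}" and ?B = "{int N * int q<..}"
  have dA: "dep ?A (\<lambda>x. \<Sum>i<N. blk_quad m n q i x)"
  proof (intro dep_sum)
    fix i assume "i \<in> {..<N}"
    then have "int (Suc i) * int q \<le> int N * int q" by (intro mult_right_mono) auto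
    then show "dep ?A (blk_quad m n q i)" by (intro dep_mono[OF blk_quad_dep]) auto
  qed
  have dB: "dep ?B (blk_quad m n q N)" by (rule dep_mono[OF blk_quad_dep]) auto
  have "phi (\<lambda>x. \<Sum>i<Suc N. blk_quad m n q i x) \<theta> =
    (\<integral>x. iexp (\<theta> * (\<Sum>i<N. blk_quad m n q i x)) * iexp (\<theta> * blk_quad m n q N x) \<partial>P)"
    by (simp add: phi_def distrib_left exp_add)
  also have "\<dots> = phi (\<lambda>x. \<Sum>i<N. blk_quad m n q i x) \<theta> * phi (blk_quad m n q N) \<theta>"
    unfolding phi_def
    by (rule integral_mult_indep[OF dep_comp[OF dA] integrable_iexp dep_comp[OF dB] integrable_iexp]) auto
  also have "phi (blk_quad m n q N) \<theta> = phi (blk_quad m n q 0) \<theta>"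
    unfolding phi_def
    using integral_shift[of "\<lambda>x. iexp (\<theta> * blk_quad m n q 0 x)" "int N * int q"] by (simp add: blk_quad_shift)
  finally show ?case using Suc by (simp add: mult.commute)
qed

lemma integral_quad_0: "finite J \<Longrightarrow> (\<integral>x. quad J J c D D x \<partial>P) = 0"
proof -
  assume J: "finite J"
  have i: "integrable P (\<lambda>x. D u x * D v x)" for u v
    by (rule L4_mult_integrable[OF D_L4 D_L4])
  have "(\<integral>x. quad J J c D D x \<partial>P) = (\<Sum>v\<in>J. \<Sum>u | u \<in> J \<and> u < v. c u v * (\<integral>x. D u x * D v x \<partial>P))"
    unfolding quad_def by (subst Bochner_Integration.integral_sum)
      (auto intro!: Bochner_Integration.integrable_sum integrable_mult_right i simp: Bochner_Integration.integral_sum i)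
  also have "\<dots> = 0" by (intro sum.neutral ballI) (auto simp: mdiff_orth[OF D_mdiff D_mdiff])
  finally show ?thesis .
qed

text \<open>As the weights are even, twice the triangle is the form over all off-diagonal
  pairs.\<close>

definition TD :: "nat \<Rightarrow> nat \<Rightarrow> (int \<Rightarrow> 's) \<Rightarrow> real" where
  "TD m n = quad {1..int n} {1..int n} (\<lambda>u v. 2 * wt m n (u - v)) D D"

definition bad :: "nat \<Rightarrow> nat \<Rightarrow> nat \<Rightarrow> real" where
  "bad m n N = real W * real m / real n + 2 * (real N + real N * real W) / real n + real N / sqrt (real m)"

lemma TD_meas: "TD m n \<in> borel_measurable P"
  unfolding TD_def by (rule Lp_le_measurable[OF quad_DD_L4]) simp

text \<open>The three errors come from the pairs that no block contains, from the cubic remainder of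
  the blocks, and from replacing 1 - y by its exponential. The first is a square root because
  \<open>bad\<close> bounds squared weights.\<close>

lemma clt_step:
  assumes n: "2 * m < n" and m: "m > 0" and N: "N > 0"
  defines "v \<equiv> (\<integral>x. (blk_quad m n (n div N) 0 x)\<^sup>2 \<partial>P)"
  shows "\<bar>real N * v - 4 * sg\<^sup>2 * (1 / (16 * pi\<^sup>2) - real m / (8 * pi\<^sup>2 * real n))\<bar> \<le> 4 * sg\<^sup>2 * bad m n N"
    and "cmod (phi (TD m n) \<theta> - of_real (exp (- (\<theta>\<^sup>2 * (real N * v) / 2)))) \<le>
      \<bar>\<theta>\<bar> * (4 * B\<^sup>2 * sqrt (bad m n N)) + \<bar>\<theta>\<bar> ^ 3 * (8 * B\<^sup>2) ^ 3 / sqrt (real N) + (\<theta>\<^sup>2 * (real N * v) / 2)\<^sup>2 / real N"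
proof -
  define q where "q = n div N"
  let ?I = "{1..int n}"
  let ?g = "\<lambda>u v. good N q u v \<and> u \<le> v - int W"
  have n0: "n > 0" using n by simp
  have Nq: "N * q \<le> n" unfolding q_def by simp
  note sb = sum_bad[OF n m q_def N, folded bad_def]
  define L where "L = 1 / (16 * pi\<^sup>2) - real m / (8 * pi\<^sup>2 * real n)"
  note wl = wt_sum_less[OF n m, folded L_def]
  define b where "b = (\<Sum>v\<in>?I. \<Sum>u | u \<in> ?I \<and> u < v. if ?g u v then 0 else (wt m n (u - v))\<^sup>2)"
  have b: "0 \<le> b" "b \<le> bad m n N" using sb unfolding b_def by (auto intro!: sum_nonneg)
  have Uvar: "(\<integral>x. (blk_quad m n q i x)\<^sup>2 \<partial>P) = v" for i
    unfolding v_def q_def[symmetric]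
    using integral_shift[of "\<lambda>x. (blk_quad m n q 0 x)\<^sup>2" "int i * int q"] blk_quad_meas
    by (simp add: blk_quad_shift)
  have "real N * v = (\<Sum>i<N. \<integral>x. (blk_quad m n q i x)\<^sup>2 \<partial>P)" by (simp add: Uvar)
  also have "\<dots> = (\<Sum>i<N. sg\<^sup>2 * (\<Sum>v\<in>blk q i. \<Sum>u | u \<in> blk q i \<and> u < v. (coef m n u v)\<^sup>2))"
    unfolding blk_quad_def by (intro sum.cong refl quad_DD_var) (auto simp: coef_def)
  also have "\<dots> = sg\<^sup>2 * (\<Sum>v\<in>?I. \<Sum>u | u \<in> ?I \<and> u < v. if good N q u v then (coef m n u v)\<^sup>2 else 0)"
    by (simp add: sum_blk[OF Nq] flip: sum_distrib_left)
  also have "(\<Sum>v\<in>?I. \<Sum>u | u \<in> ?I \<and> u < v. if good N q u v then (coef m n u v)\<^sup>2 else 0) =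
     (\<Sum>v\<in>?I. \<Sum>u | u \<in> ?I \<and> u < v. 4 * ((wt m n (u - v))\<^sup>2 - (if ?g u v then 0 else (wt m n (u - v))\<^sup>2)))"
    by (intro sum.cong refl) (auto simp: coef_def power_mult_distrib)
  also have "\<dots> = 4 * (L - b)"
    unfolding sum_distrib_left[symmetric] sum_subtractf wl b_def[symmetric] ..
  finally have Nv: "real N * v = 4 * sg\<^sup>2 * (L - b)" by simp
  have "\<bar>real N * v - 4 * sg\<^sup>2 * L\<bar> = 4 * sg\<^sup>2 * b"
    unfolding Nv using b by (simp add: algebra_simps abs_mult)
  then show "\<bar>real N * v - 4 * sg\<^sup>2 * L\<bar> \<le> 4 * sg\<^sup>2 * bad m n N"
    using b by (simp add: mult_left_mono)
  define V where "V x = (\<Sum>i<N. blk_quad m n q i x)" for x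
  note [measurable] = blk_quad_meas TD_meas
  have V_meas [measurable]: "V \<in> borel_measurable P" unfolding V_def[abs_def] by measurable
  have V_eq: "V x = quad ?I ?I (\<lambda>u v. if good N q u v then coef m n u v else 0) D D x" for x
  proof -
    have "V x = (\<Sum>v\<in>?I. \<Sum>u | u \<in> ?I \<and> u < v. if good N q u v then coef m n u v * (D u x * D v x) else 0)"
      unfolding V_def blk_quad_def quad_def by (rule sum_blk[OF Nq])
    then show ?thesis by (simp add: quad_def if_distrib[of "\<lambda>c. c * _"] cong: if_cong)
  qed
  define c where "c u v = 2 * wt m n (u - v) - (if good N q u v then coef m n u v else 0)" for u v
  have TV: "TD m n x - V x = quad ?I ?I c D D x" for x
    by (simp add: V_eq TD_def quad_def c_def sum_subtractf left_diff_distrib)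
  have "Lp_le P 2 (quad ?I ?I c D D) (2 * B * B * sqrt (\<Sum>v\<in>?I. \<Sum>u | u \<in> ?I \<and> u < v. (c u v)\<^sup>2))"
    by (rule quad_bound) (auto simp: D_mdiff D_L4 B_nonneg)
  also have "(\<Sum>v\<in>?I. \<Sum>u | u \<in> ?I \<and> u < v. (c u v)\<^sup>2) = 4 * b"
    unfolding b_def sum_distrib_left by (intro sum.cong refl) (auto simp: c_def coef_def power_mult_distrib)
  finally have "Lp_le P 2 (\<lambda>x. TD m n x - V x) (2 * B * B * sqrt (4 * b))" unfolding TV .
  then have "Lp_le P 2 (\<lambda>x. TD m n x - V x) (4 * B\<^sup>2 * sqrt (bad m n N))"
    by (rule Lp_le_mono) (use b B_nonneg in \<open>auto simp: real_sqrt_mult power2_eq_square intro!: mult_left_mono\<close>)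
  then have 1: "cmod (phi (TD m n) \<theta> - phi V \<theta>) \<le> \<bar>\<theta>\<bar> * (4 * B\<^sup>2 * sqrt (bad m n N))"
    by (intro phi_diff) auto
  have v0: "0 \<le> v" unfolding v_def by simp
  have phiV: "phi V \<theta> = (phi (blk_quad m n q 0) \<theta>) ^ N"
    unfolding V_def[abs_def] by (rule phi_blocks)
  let ?y = "\<theta>\<^sup>2 * v / 2"
  have e: "exp (- (\<theta>\<^sup>2 * (real N * v) / 2)) = exp (- ?y) ^ N"
    by (simp add: exp_of_nat_mult[symmetric] field_simps)
  have "cmod (phi V \<theta> - of_real (exp (- (\<theta>\<^sup>2 * (real N * v) / 2)))) = cmod (phi (blk_quad m n q 0) \<theta> ^ N - of_real (exp (- ?y)) ^ N)"
    unfolding phiV e by simp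
  \<comment> \<open>Both bases have modulus at most 1, so passing to N-th powers costs only a factor
    N.\<close>
  also have "\<dots> \<le> real N * cmod (phi (blk_quad m n q 0) \<theta> - of_real (exp (- ?y)))"
    by (rule norm_power_diff) (use v0 in \<open>auto intro!: norm_phi_le\<close>)
  also have "\<dots> \<le> real N * (\<bar>\<theta>\<bar> ^ 3 * (8 * B\<^sup>2 / sqrt (real N)) ^ 3 + ?y\<^sup>2)"
  proof (intro mult_left_mono phi_approx)
    show "Lp_le P 4 (blk_quad m n q 0) (8 * B\<^sup>2 / sqrt (real N))"
      by (rule blk_quad_L4[OF n m q_def N]) (use N in auto)
    show "(\<integral>x. blk_quad m n q 0 x \<partial>P) = 0" unfolding blk_quad_def by (rule integral_quad_0) simp
  qed (use Uvar[of 0] in auto)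
  also have "\<dots> = \<bar>\<theta>\<bar> ^ 3 * (8 * B\<^sup>2) ^ 3 / sqrt (real N) + (\<theta>\<^sup>2 * (real N * v) / 2)\<^sup>2 / real N"
  proof -
    have s: "sqrt (real N) ^ 3 = real N * sqrt (real N)" by (simp add: power3_eq_cube)
    have "real N * (\<bar>\<theta>\<bar> ^ 3 * (8 * B\<^sup>2 / sqrt (real N)) ^ 3) = \<bar>\<theta>\<bar> ^ 3 * (8 * B\<^sup>2) ^ 3 / sqrt (real N)"
      unfolding power_divide s using N by (simp add: field_simps)
    moreover have "real N * ?y\<^sup>2 = (\<theta>\<^sup>2 * (real N * v) / 2)\<^sup>2 / real N"
      using N by (simp add: power2_eq_square field_simps)
    ultimately show ?thesis by (simp only: distrib_left)
  qed
  finally have 2: "cmod (phi V \<theta> - of_real (exp (- (\<theta>\<^sup>2 * (real N * v) / 2)))) \<le>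
     \<bar>\<theta>\<bar> ^ 3 * (8 * B\<^sup>2) ^ 3 / sqrt (real N) + (\<theta>\<^sup>2 * (real N * v) / 2)\<^sup>2 / real N" .
  show "cmod (phi (TD m n) \<theta> - of_real (exp (- (\<theta>\<^sup>2 * (real N * v) / 2)))) \<le>
      \<bar>\<theta>\<bar> * (4 * B\<^sup>2 * sqrt (bad m n N)) + \<bar>\<theta>\<bar> ^ 3 * (8 * B\<^sup>2) ^ 3 / sqrt (real N) + (\<theta>\<^sup>2 * (real N * v) / 2)\<^sup>2 / real N"
    using norm_diff_triangle_le[OF 1 2] by (simp add: add.assoc)
qed

theorem clt_quad:
  fixes m :: "nat \<Rightarrow> nat"
  assumes m: "filterlim m at_top at_top" and mn: "(\<lambda>n. real (m n) / real n) \<longlonglongrightarrow> 0"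
  shows "(\<lambda>n. phi (TD (m n) n) \<theta>) \<longlonglongrightarrow> of_real (exp (- (\<theta>\<^sup>2 * (sg\<^sup>2 / (4 * pi\<^sup>2)) / 2)))"
proof -
  \<comment> \<open>The Lyapunov error needs N to tend to infinity, the cuts need N = o(sqrt m). The
    fourth root of m is a convenient choice between the two.\<close>
  define N where "N n = nat \<lfloor>sqrt (sqrt (real (m n)))\<rfloor>" for n
  define v where "v n = (\<integral>x. (blk_quad (m n) n (n div N n) 0 x)\<^sup>2 \<partial>P)" for n
  have mr: "filterlim (\<lambda>n. real (m n)) at_top at_top"
    by (rule filterlim_compose[OF filterlim_real_sequentially m])
  have ssm: "filterlim (\<lambda>n. sqrt (sqrt (real (m n)))) at_top at_top"
    by (intro filterlim_compose[OF sqrt_at_top] mr)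
  have Nlim: "filterlim N at_top at_top"
    unfolding N_def by (intro filterlim_compose[OF filterlim_nat_sequentially] filterlim_compose[OF filterlim_floor_sequentially] ssm)
  have Nr: "filterlim (\<lambda>n. real (N n)) at_top at_top"
    by (rule filterlim_compose[OF filterlim_real_sequentially Nlim])
  have N_le: "real (N n) \<le> sqrt (sqrt (real (m n)))" for n
    unfolding N_def by (simp add: of_nat_nat)
  have "eventually (\<lambda>n. N n > 0) sequentially"
    using Nlim unfolding filterlim_at_top by (auto dest!: spec[of _ 1] elim: eventually_mono)
  with eventually_double_less[OF m mn]
  have ev: "eventually (\<lambda>n. 2 * m n < n \<and> m n > 0 \<and> N n > 0) sequentially"
    by eventually_elim auto
  have b1: "(\<lambda>n. real (N n) / sqrt (real (m n))) \<longlonglongrightarrow> 0"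
  proof (rule tendsto_sandwich[where f = "\<lambda>_. 0" and h = "\<lambda>n. 1 / sqrt (sqrt (real (m n)))"])
    show "(\<lambda>n. 1 / sqrt (sqrt (real (m n)))) \<longlonglongrightarrow> 0"
      by (intro tendsto_divide_0[OF tendsto_const] filterlim_at_top_imp_at_infinity ssm)
    show "eventually (\<lambda>n. real (N n) / sqrt (real (m n)) \<le> 1 / sqrt (sqrt (real (m n)))) sequentially"
      using ev
    proof eventually_elim
      case (elim n)
      have "real (N n) / sqrt (real (m n)) \<le> sqrt (sqrt (real (m n))) / sqrt (real (m n))"
        by (intro divide_right_mono N_le) simp
      also have "\<dots> = 1 / sqrt (sqrt (real (m n)))"
        using elim by (simp add: real_div_sqrt field_simps)
      finally show ?case .
    qed
  qed (auto intro!: always_eventually)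
  have b2: "(\<lambda>n. real (N n) / real n) \<longlonglongrightarrow> 0"
  proof (rule tendsto_sandwich[where f = "\<lambda>_. 0", OF _ _ tendsto_const mn])
    show "eventually (\<lambda>n. real (N n) / real n \<le> real (m n) / real n) sequentially"
      using ev
    proof eventually_elim
      case (elim n)
      have "sqrt (sqrt (real (m n))) \<le> real (m n)"
      proof -
        have 1: "1 \<le> real (m n)" using elim by simp
        have "1 \<le> sqrt (real (m n))" using 1 by simp
        then show ?thesis using order_trans[OF sqrt_le_self[of "sqrt (real (m n))"] sqrt_le_self[OF 1]] by blast
      qed
      then show ?case using N_le[of n] by (intro divide_right_mono) auto
    qed
  qed (auto intro!: always_eventually)
  have bad0: "(\<lambda>n. bad (m n) n (N n)) \<longlonglongrightarrow> 0"
  proof -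
    have "(\<lambda>n. real W * (real (m n) / real n) + (2 + 2 * real W) * (real (N n) / real n) + real (N n) / sqrt (real (m n))) \<longlonglongrightarrow> 
       real W * 0 + (2 + 2 * real W) * 0 + 0"
      by (intro tendsto_intros mn b1 b2)
    moreover have "bad (m n) n (N n) = real W * (real (m n) / real n) + (2 + 2 * real W) * (real (N n) / real n) + real (N n) / sqrt (real (m n))" for n
      unfolding bad_def by (simp add: algebra_simps add_divide_distrib)
    ultimately show ?thesis by simp
  qed
  have Nv: "(\<lambda>n. real (N n) * v n) \<longlonglongrightarrow> sg\<^sup>2 / (4 * pi\<^sup>2)"
  proof -
    define L where "L n = 4 * sg\<^sup>2 * (1 / (16 * pi\<^sup>2) - real (m n) / (8 * pi\<^sup>2 * real n))" for n
    have "(\<lambda>n. 4 * sg\<^sup>2 * (1 / (16 * pi\<^sup>2) - (real (m n) / real n) / (8 * pi\<^sup>2))) \<longlonglongrightarrow> 4 * sg\<^sup>2 * (1 / (16 * pi\<^sup>2) - 0 / (8 * pi\<^sup>2))"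
      by (intro tendsto_intros mn) auto
    then have L: "L \<longlonglongrightarrow> sg\<^sup>2 / (4 * pi\<^sup>2)" by (simp add: L_def[abs_def] mult.commute)
    have "(\<lambda>n. real (N n) * v n - L n) \<longlonglongrightarrow> 0"
    proof (rule Lim_null_comparison)
      show "eventually (\<lambda>n. norm (real (N n) * v n - L n) \<le> 4 * sg\<^sup>2 * bad (m n) n (N n)) sequentially"
        using ev
      proof eventually_elim
        case (elim n)
        then show ?case using clt_step(1)[of "m n" n "N n"] by (simp add: v_def L_def)
      qed
      show "(\<lambda>n. 4 * sg\<^sup>2 * bad (m n) n (N n)) \<longlonglongrightarrow> 0" using tendsto_mult_left[OF bad0] by simp
    qed
    from tendsto_add[OF this L] show ?thesis by simp
  qed
  have inv: "(\<lambda>n. 1 / sqrt (real (N n))) \<longlonglongrightarrow> 0" "(\<lambda>n. 1 / real (N n)) \<longlonglongrightarrow> 0"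
    by (intro tendsto_divide_0[OF tendsto_const] filterlim_at_top_imp_at_infinity filterlim_compose[OF sqrt_at_top] Nr)+
  \<comment> \<open>The error bound as a continuous function of its vanishing or convergent
    ingredients, whose limit follows by substitution.\<close>
  define r where "r b s y i = \<bar>\<theta>\<bar> * (4 * B\<^sup>2 * sqrt b) + \<bar>\<theta>\<bar> ^ 3 * (8 * B\<^sup>2) ^ 3 * s + (\<theta>\<^sup>2 * y / 2)\<^sup>2 * i"
    for b s y i :: real
  have "(\<lambda>n. phi (TD (m n) n) \<theta> - of_real (exp (- (\<theta>\<^sup>2 * (real (N n) * v n) / 2)))) \<longlonglongrightarrow> 0"
  proof (rule Lim_null_comparison)
    show "eventually (\<lambda>n. cmod (phi (TD (m n) n) \<theta> - of_real (exp (- (\<theta>\<^sup>2 * (real (N n) * v n) / 2)))) \<le>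
       r (bad (m n) n (N n)) (1 / sqrt (real (N n))) (real (N n) * v n) (1 / real (N n))) sequentially"
      using ev
    proof eventually_elim
      case (elim n)
      then show ?case using clt_step(2)[of "m n" n "N n" \<theta>] by (simp add: v_def r_def)
    qed
    have "(\<lambda>n. r (bad (m n) n (N n)) (1 / sqrt (real (N n))) (real (N n) * v n) (1 / real (N n)))
      \<longlonglongrightarrow> r 0 0 (sg\<^sup>2 / (4 * pi\<^sup>2)) 0"
      unfolding r_def by (intro tendsto_intros bad0 inv Nv) auto
    then show "(\<lambda>n. r (bad (m n) n (N n)) (1 / sqrt (real (N n))) (real (N n) * v n) (1 / real (N n))) \<longlonglongrightarrow> 0"
      by (simp add: r_def)
  qed
  moreover have "(\<lambda>n. complex_of_real (exp (- (\<theta>\<^sup>2 * (real (N n) * v n) / 2)))) \<longlonglongrightarrow> of_real (exp (- (\<theta>\<^sup>2 * (sg\<^sup>2 / (4 * pi\<^sup>2)) / 2)))"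
    by (intro tendsto_intros Nv) auto
  ultimately show ?thesis using tendsto_add by fastforce
qed

end

section \<open>Martingale decomposition of the Bernoulli shift\<close>

text \<open>On either side of \<open>u\<close> the distance is injective in \<open>v\<close>, whence
  the factor 2.\<close>

lemma sum_abs_diff_le_suminf:
  fixes c :: "nat \<Rightarrow> real"
  assumes c: "summable c" "\<And>k. 0 \<le> c k" and J: "finite J"
  shows "(\<Sum>v\<in>J. c (nat \<bar>u - v\<bar>)) \<le> 2 * suminf c"
proof -
  have *: "(\<Sum>v\<in>K. c (nat \<bar>u - v\<bar>)) \<le> suminf c" if "finite K" "inj_on (\<lambda>v. nat \<bar>u - v\<bar>) K" for K
  proof -
    have "(\<Sum>v\<in>K. c (nat \<bar>u - v\<bar>)) = (\<Sum>k\<in>(\<lambda>v. nat \<bar>u - v\<bar>) ` K. c k)"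
      by (rule sum.reindex_cong[OF that(2) refl refl, symmetric])
    also have "\<dots> \<le> suminf c" using that c by (intro sum_le_suminf) auto
    finally show ?thesis .
  qed
  have "(\<Sum>v\<in>J. c (nat \<bar>u - v\<bar>)) = (\<Sum>v\<in>J \<inter> {..u}. c (nat \<bar>u - v\<bar>)) + (\<Sum>v\<in>J - {..u}. c (nat \<bar>u - v\<bar>))"
    by (rule sum.Int_Diff[OF J])
  also have "\<dots> \<le> suminf c + suminf c"
    using J by (intro add_mono *) (auto simp: inj_on_def)
  finally show ?thesis by simp
qed

lemma sum_swap4:
  "(\<Sum>t\<in>A. \<Sum>s\<in>B. \<Sum>k\<in>C. \<Sum>l\<in>D. F t s k l) = (\<Sum>k\<in>C. \<Sum>l\<in>D. \<Sum>t\<in>A. \<Sum>s\<in>B. F t s k l)"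
proof -
  have "(\<Sum>t\<in>A. \<Sum>s\<in>B. \<Sum>k\<in>C. \<Sum>l\<in>D. F t s k l) = (\<Sum>t\<in>A. \<Sum>k\<in>C. \<Sum>s\<in>B. \<Sum>l\<in>D. F t s k l)"
    by (rule sum.cong[OF refl], rule sum.swap)
  also have "\<dots> = (\<Sum>k\<in>C. \<Sum>t\<in>A. \<Sum>s\<in>B. \<Sum>l\<in>D. F t s k l)"
    by (rule sum.swap)
  also have "\<dots> = (\<Sum>k\<in>C. \<Sum>t\<in>A. \<Sum>l\<in>D. \<Sum>s\<in>B. F t s k l)"
    by (rule sum.cong[OF refl], rule sum.cong[OF refl], rule sum.swap)
  also have "\<dots> = (\<Sum>k\<in>C. \<Sum>l\<in>D. \<Sum>t\<in>A. \<Sum>s\<in>B. F t s k l)"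
    by (rule sum.cong[OF refl], rule sum.swap)
  finally show ?thesis .
qed

text \<open>\<open>f\<close> is X_0 as a function of the innovations, and \<open>c\<close> a
  decreasing majorant of the coupling distances. Summability of sqrt c serves the diagonal sums,
  that of (k + 1)^2 c k the bias and the remainder of the decomposition. For c k of order
  k^(-\<eta>) these mean \<eta> > 2 and \<eta> > 3.\<close>

locale shift_process = iid_space \<mu> for \<mu> :: "'s measure" +
  fixes f :: "(int \<Rightarrow> 's) \<Rightarrow> real" and c :: "nat \<Rightarrow> real"
  assumes f_dep: "dep {..0} f" and f_L4: "L4 f" and f_mean: "(\<integral>x. f x \<partial>P) = 0"
    and f_coup: "\<And>l. Lp_le (P \<Otimes>\<^sub>M P) 4 (\<lambda>z. f (fst z) - f (mix {- int l<..} (fst z) (snd z))) (c l)"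
    and c_dec: "decseq c" and c_sqrt: "summable (\<lambda>k. sqrt (c k))"
    and c_sq: "summable (\<lambda>k. (real k + 1)\<^sup>2 * c k)"
begin

lemma c_nonneg: "0 \<le> c k"
  by (rule Lp_le_nonneg[OF f_coup])

lemma c_mono: "i \<le> j \<Longrightarrow> c j \<le> c i"
  using c_dec by (rule decseqD)

lemma c_summable: "summable c"
proof (rule summable_comparison_test'[OF c_sq])
  fix k show "norm (c k) \<le> (real k + 1)\<^sup>2 * c k"
    using c_nonneg[of k] mult_right_mono[of 1 "(real k + 1)\<^sup>2" "c k"] by (simp add: one_le_power)
qed

definition S :: real where "S = suminf c"

lemma S_nonneg: "0 \<le> S"
  unfolding S_def by (intro suminf_nonneg c_summable c_nonneg)

lemma sum_c_le: "finite I \<Longrightarrow> (\<Sum>k\<in>I. c k) \<le> S"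
  unfolding S_def by (intro sum_le_suminf c_summable) (auto simp: c_nonneg)

text \<open>Any L^4 bound of \<open>f\<close> will do, as it enters only through constants.\<close>

definition nrm :: real where "nrm = (SOME K. Lp_le P 4 f K)"

lemma f_a: "Lp_le P 4 f nrm"
  using f_L4 unfolding L4_def nrm_def by (rule someI_ex)

lemma nrm_nonneg: "0 \<le> nrm" by (rule Lp_le_nonneg[OF f_a])

lemma f_meas [measurable]: "f \<in> borel_measurable P"
  by (rule Lp_le_measurable[OF f_a])

lemma f_int: "integrable P f"
  by (rule L4_integrable[OF f_a])

section \<open>Forecasts and their successive differences\<close>

definition X :: "int \<Rightarrow> (int \<Rightarrow> 's) \<Rightarrow> real" where "X t x = f (shift t x)"

lemma X_meas [measurable]: "X t \<in> borel_measurable P"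
  unfolding X_def[abs_def] by measurable

lemma X_a: "Lp_le P 4 (X t) nrm"
  unfolding X_def[abs_def] by (rule Lp_le_shift[OF f_a])

lemma X_L4: "L4 (X t)" by (rule L4I[OF X_a])

lemma X_int: "integrable P (X t)"
  by (rule L4_integrable[OF X_a])

lemma X_mean: "(\<integral>x. X t x \<partial>P) = 0"
  unfolding X_def using integral_shift[OF f_meas, of t] f_mean by simp

lemma X_dep: "dep {..t} (X t)"
  unfolding X_def[abs_def] by (rule dep_mono[OF dep_shift[OF f_dep]]) auto

lemma X_shift: "X t (shift s x) = X (t + s) x"
  by (simp add: X_def shift_shift)

lemma cexp_X:
  assumes "x \<in> space P"
  shows "cexp A (X t) x = cexp ((\<lambda>i. i - t) ` A) f (shift t x)"
proof -
  have "(\<lambda>i. i + t) ` (\<lambda>i. i - t) ` A = A" by (auto simp: image_image)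
  then show ?thesis using cexp_shift[OF f_meas assms, of "(\<lambda>i. i - t) ` A" t] by (simp add: X_def[abs_def])
qed

lemma X_coup: "Lp_le P 4 (\<lambda>x. cexp A (X t) x - cexp (A \<inter> {t - int l<..}) (X t) x) (c l)"
proof -
  let ?A = "(\<lambda>i. i - t) ` A"
  have eq: "(\<lambda>i. i - t) ` (A \<inter> {t - int l<..}) = ?A \<inter> {- int l<..}" by auto
  have "Lp_le P 4 (\<lambda>x. cexp ?A f x - cexp (?A \<inter> {- int l<..}) f x) (c l)"
    by (rule Lp_le_cexp_diff[OF f_int f_coup]) simp
  then have "Lp_le P 4 (\<lambda>x. cexp ?A f (shift t x) - cexp (?A \<inter> {- int l<..}) f (shift t x)) (c l)"
    by (rule Lp_le_shift)
  then show ?thesis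
    by (rule Lp_le_cong) (simp add: cexp_X eq)
qed

lemma X_coup_subset:
  assumes "A' = A \<inter> {t - int l<..}"
  shows "Lp_le P 4 (\<lambda>x. cexp A (X t) x - cexp A' (X t) x) (c l)"
  unfolding assms by (rule X_coup)

text \<open>Intersecting \<open>A\<close> with the recent window leaves the empty set, whose
  conditional expectation is the mean 0. Thus the forecast from the distant past is itself
  small.\<close>

lemma X_coup_disjoint:
  assumes "A \<subseteq> {..t - int l}"
  shows "Lp_le P 4 (cexp A (X t)) (c l)"
proof -
  have "A \<inter> {t - int l<..} = {}" using assms by auto
  then show ?thesis using X_coup[of A t l] by (simp add: cexp_empty X_mean)
qed

definition Y :: "nat \<Rightarrow> int \<Rightarrow> (int \<Rightarrow> 's) \<Rightarrow> real" where
  "Y k t x = cexp {..t} (X (t + int k)) x - cexp {..<t} (X (t + int k)) x"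

lemma Y_mdiff: "mdiff t (Y k t)"
proof -
  have "{..t} \<inter> {..<t} = {..<t}" by auto
  then show ?thesis using mdiff_cexp[OF X_L4[of "t + int k"], of "{..t}" t] by (simp add: Y_def[abs_def])
qed

lemma Y_bound: "Lp_le P 4 (Y k t) (2 * c k)"
proof -
  have "Lp_le P 4 (Y k t) (c k + c k)"
    unfolding Y_def[abs_def] by (intro Lp_le_diff X_coup_disjoint) auto
  then show ?thesis by simp
qed

lemma Y_meas [measurable]: "Y k t \<in> borel_measurable P"
  by (rule Lp_le_measurable[OF Y_bound])

lemma Y_shift: "x \<in> space P \<Longrightarrow> Y k t x = Y k 0 (shift t x)"
proof -
  assume x: "x \<in> space P"
  have x': "shift t x \<in> space P" using x by (auto simp: shift_def space_PiM PiE_iff)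
  have "(\<lambda>i. i - int k) ` {..0} = (\<lambda>i. i - (t + int k)) ` {..t}" "(\<lambda>i. i - int k) ` {..<0} = (\<lambda>i. i - (t + int k)) ` {..<t}"
  proof -
    have "(\<lambda>i. i - s) ` {..b} = {..b - s}" "(\<lambda>i. i - s) ` {..<b} = {..<b - s}" for s b :: int
      by (auto intro: image_eqI[of _ _ "_ + s"])
    then show "(\<lambda>i. i - int k) ` {..0} = (\<lambda>i. i - (t + int k)) ` {..t}" "(\<lambda>i. i - int k) ` {..<0} = (\<lambda>i. i - (t + int k)) ` {..<t}"
      by simp_all
  qed
  then show ?thesis
    by (simp add: Y_def cexp_X[OF x] cexp_X[OF x'] shift_shift add.commute)
qed

text \<open>The forecast of X_t from time t - n: the remainder after n projections.\<close>

definition R :: "nat \<Rightarrow> int \<Rightarrow> (int \<Rightarrow> 's) \<Rightarrow> real" where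
  "R n t = cexp {..t - int n} (X t)"

definition XL :: "nat \<Rightarrow> int \<Rightarrow> (int \<Rightarrow> 's) \<Rightarrow> real" where
  "XL n t x = (\<Sum>k<n. Y k (t - int k) x)"

text \<open>Successive forecasts telescope. The identity is pointwise because the conditional
  expectations are concrete functions.\<close>

lemma X_decomp: "X t x = XL n t x + R n t x"
proof (induction n)
  case 0
  then show ?case by (simp add: XL_def R_def cexp_dep[OF X_dep])
next
  case (Suc n)
  have "{..<t - int n} = {..t - int (Suc n)}" by auto
  then have "R n t x = Y n (t - int n) x + R (Suc n) t x"
    by (simp add: Y_def R_def)
  then show ?case using Suc by (simp add: XL_def)
qed

lemma R_bound: "Lp_le P 4 (R n t) (c n)"
  unfolding R_def by (rule X_coup_disjoint) auto

lemma XL_bound: "Lp_le P 4 (XL n t) (nrm + c n)"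
proof -
  have "Lp_le P 4 (\<lambda>x. X t x - R n t x) (nrm + c n)"
    by (intro Lp_le_diff X_a R_bound) simp
  then show ?thesis using X_decomp[of t _ n] by simp
qed

lemma XL_meas [measurable]: "XL n t \<in> borel_measurable P"
  and R_meas [measurable]: "R n t \<in> borel_measurable P"
  using XL_bound R_bound Lp_le_measurable by blast+

text \<open>A copy of \<open>Y k t\<close> that depends only on the last \<open>i\<close> innovations.\<close>
definition Yw :: "nat \<Rightarrow> nat \<Rightarrow> int \<Rightarrow> (int \<Rightarrow> 's) \<Rightarrow> real" where
  "Yw i k t x = cexp {t - int i<..t} (X (t + int k)) x - cexp {t - int i<..<t} (X (t + int k)) x"

lemma Yw_dep: "dep {t - int i<..t} (Yw i k t)"
  unfolding Yw_def[abs_def] by (intro dep_diff dep_mono[OF dep_cexp]) auto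

lemma Yw_bound: "Lp_le P 4 (Yw i k t) (2 * c k)"
proof -
  have "Lp_le P 4 (Yw i k t) (c k + c k)"
    unfolding Yw_def[abs_def] by (intro Lp_le_diff X_coup_disjoint) auto
  then show ?thesis by simp
qed

text \<open>The window reaches k + i steps behind time t + k, so the coupling gives
  \<open>c (k + i)\<close>. Only the decay in \<open>i\<close> is kept.\<close>

lemma Y_minus_Yw: "Lp_le P 4 (\<lambda>x. Y k t x - Yw i k t x) (2 * c i)"
proof -
  have "Lp_le P 4 (\<lambda>x. (cexp {..t} (X (t + int k)) x - cexp {t - int i<..t} (X (t + int k)) x)
      - (cexp {..<t} (X (t + int k)) x - cexp {t - int i<..<t} (X (t + int k)) x)) (c (k + i) + c (k + i))"
    by (intro Lp_le_diff X_coup_subset) auto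
  then have "Lp_le P 4 (\<lambda>x. Y k t x - Yw i k t x) (c (k + i) + c (k + i))"
    by (rule Lp_le_cong) (simp add: Y_def Yw_def)
  then show ?thesis by (rule Lp_le_mono) (use c_mono[of i "k + i"] in simp)
qed

section \<open>Diagonal products\<close>

lemma YY_bound: "Lp_le P 2 (\<lambda>x. Y k u x * Y l u x) (4 * c k * c l)"
  using L4_mult[OF Y_bound[of k u] Y_bound[of l u]] by (simp add: ac_simps)

text \<open>For u < v both factors at time \<open>v\<close> are replaced by their copies on the
  window between \<open>u\<close> and \<open>v\<close>. These are independent of everything up to
  \<open>u\<close>, so the centred product at \<open>u\<close> annihilates them, and the replacement
  costs a multiple of \<open>c\<close> at distance v - u.\<close>

lemma YY_cov:
  fixes k l :: nat
  defines "w \<equiv> \<lambda>u x. Y k u x * Y l u x - (\<integral>x. Y k u x * Y l u x \<partial>P)"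
  shows "\<bar>\<integral>x. w u x * w v x \<partial>P\<bar> \<le> 64 * c 0 * c k * c l * c (nat \<bar>u - v\<bar>)"
proof -
  note nn = c_nonneg[of 0] c_nonneg[of k] c_nonneg[of l]
  have w2: "Lp_le P 2 (w u) (8 * c k * c l)" for u
    unfolding w_def using Lp_le_center[OF YY_bound[of k u l]] by (simp add: ac_simps)
  have w0: "(\<integral>x. w u x \<partial>P) = 0" for u
    unfolding w_def using L2_integrable[OF YY_bound[of k u l]] by (simp add: prob_space)
  have main: "\<bar>\<integral>x. w u x * w v x \<partial>P\<bar> \<le> 64 * c 0 * c k * c l * c (nat (v - u))" if "u < v" for u v
  proof -
    define i where "i = nat (v - u)"
    have vi: "v - int i = u" using that by (simp add: i_def)
    let ?W = "\<lambda>x. Yw i k v x * Yw i l v x"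
    have W2: "Lp_le P 2 ?W (2 * c k * (2 * c l))" by (intro L4_mult Yw_bound)
    have dW: "dep {u<..} ?W"
      using Yw_dep[of v i k] Yw_dep[of v i l] unfolding vi by (intro dep_mult; elim dep_mono) auto
    have dw: "dep {..u} (w u)"
      unfolding w_def by (intro dep_diff dep_mult dep_const mdiff_dep[OF Y_mdiff])
    have 0: "(\<integral>x. w u x * ?W x \<partial>P) = 0"
    proof -
      have "{..u} \<inter> {u<..} = {}" by auto
      from integral_mult_indep[OF dw L2_integrable[OF w2] dW L2_integrable[OF W2] this] show ?thesis
        by (simp add: w0)
    qed
    have "Lp_le P 2 (\<lambda>x. (Y k v x - Yw i k v x) * Y l v x + Yw i k v x * (Y l v x - Yw i l v x))
       (2 * c i * (2 * c l) + 2 * c k * (2 * c i))"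
      by (intro Lp_le_add L4_mult Y_minus_Yw Y_bound Yw_bound) simp
    moreover have "2 * c i * (2 * c l) + 2 * c k * (2 * c i) \<le> 8 * c 0 * c i"
    proof -
      have "c i * c l \<le> c i * c 0" "c i * c k \<le> c i * c 0"
        by (intro mult_left_mono c_mono c_nonneg; simp)+
      moreover have "2 * c i * (2 * c l) + 2 * c k * (2 * c i) = 4 * (c i * c l) + 4 * (c i * c k)" by simp
      moreover have "8 * c 0 * c i = 4 * (c i * c 0) + 4 * (c i * c 0)" by simp
      ultimately show ?thesis by linarith
    qed
    ultimately have "Lp_le P 2 (\<lambda>x. (Y k v x - Yw i k v x) * Y l v x + Yw i k v x * (Y l v x - Yw i l v x)) (8 * c 0 * c i)"
      by (rule Lp_le_mono)
    then have d: "Lp_le P 2 (\<lambda>x. Y k v x * Y l v x - ?W x) (8 * c 0 * c i)"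
      by (rule Lp_le_cong) (simp add: algebra_simps)
    let ?e = "\<integral>x. Y k v x * Y l v x \<partial>P"
    have i1: "integrable P (\<lambda>x. w u x * (Y k v x * Y l v x - ?W x))" by (rule L2_mult_integrable[OF w2 d])
    have i2: "integrable P (\<lambda>x. w u x * ?W x)" by (rule L2_mult_integrable[OF w2 W2])
    have "w u x * w v x = w u x * (Y k v x * Y l v x - ?W x) + (w u x * ?W x - ?e * w u x)" for x
    proof -
      have "w v x = Y k v x * Y l v x - ?e" by (simp add: w_def)
      then show ?thesis by (simp only:) (simp add: algebra_simps)
    qed
    then have "(\<integral>x. w u x * w v x \<partial>P) = (\<integral>x. w u x * (Y k v x * Y l v x - ?W x) + (w u x * ?W x - ?e * w u x) \<partial>P)"
      by simp
    also have "\<dots> = (\<integral>x. w u x * (Y k v x * Y l v x - ?W x) \<partial>P) + ((\<integral>x. w u x * ?W x \<partial>P) - ?e * (\<integral>x. w u x \<partial>P))"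
      using i1 i2 L2_integrable[OF w2, of u] by simp
    finally have "(\<integral>x. w u x * w v x \<partial>P) = (\<integral>x. w u x * (Y k v x * Y l v x - ?W x) \<partial>P)"
      using 0 w0 by simp
    then show ?thesis using L2_prod_bound[OF w2[of u] d] by (simp add: i_def ac_simps)
  qed
  show ?thesis
  proof (cases u v rule: linorder_cases)
    case less
    then show ?thesis using main[of u v] by simp
  next
    case greater
    then show ?thesis using main[of v u] by (simp add: mult.commute[of "w u _"])
  next
    case equal
    have "\<bar>\<integral>x. w u x * w u x \<partial>P\<bar> \<le> 8 * c k * c l * (8 * c k * c l)" by (rule L2_prod_bound[OF w2 w2])
    also have "\<dots> \<le> 8 * c k * c l * (8 * c 0 * c 0)"
      using nn by (intro mult_left_mono mult_mono c_mono) auto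
    finally show ?thesis using equal by (simp add: ac_simps)
  qed
qed

text \<open>Covariances summable in the distance make the variance linear in the number of terms.
  The norm retains only the square root of c k * c l, hence the assumption on sqrt c.\<close>

lemma diag_bound:
  assumes J: "finite J"
  shows "Lp_le P 2 (\<lambda>x. \<Sum>u\<in>J. Y k u x * Y l u x - (\<integral>x. Y k u x * Y l u x \<partial>P))
     (sqrt (real (card J) * (128 * c 0 * S * c k * c l)))"
proof (rule L2_leI)
  let ?w = "\<lambda>u x. Y k u x * Y l u x - (\<integral>x. Y k u x * Y l u x \<partial>P)"
  have w2: "Lp_le P 2 (?w u) (8 * c k * c l)" for u
    using Lp_le_center[OF YY_bound[of k u l]] by (simp add: ac_simps)
  have i: "integrable P (\<lambda>x. ?w u x * ?w v x)" for u v by (rule L2_mult_integrable[OF w2 w2])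
  show "integrable P (\<lambda>x. (\<Sum>u\<in>J. ?w u x)\<^sup>2)"
    unfolding power2_eq_square sum_product by (intro Bochner_Integration.integrable_sum i)
  have "(\<integral>x. (\<Sum>u\<in>J. ?w u x)\<^sup>2 \<partial>P) = (\<Sum>u\<in>J. \<Sum>v\<in>J. \<integral>x. ?w u x * ?w v x \<partial>P)"
    unfolding power2_eq_square sum_product
    by (subst Bochner_Integration.integral_sum) (auto intro!: Bochner_Integration.integrable_sum i sum.cong Bochner_Integration.integral_sum)
  also have "\<dots> \<le> (\<Sum>u\<in>J. \<Sum>v\<in>J. 64 * c 0 * c k * c l * c (nat \<bar>u - v\<bar>))"
    using YY_cov[where k = k and l = l] by (intro sum_mono) (auto simp: abs_le_iff)
  also have "\<dots> = (\<Sum>u\<in>J. 64 * c 0 * c k * c l * (\<Sum>v\<in>J. c (nat \<bar>u - v\<bar>)))"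
    by (simp add: sum_distrib_left)
  also have "\<dots> \<le> (\<Sum>u\<in>J. 64 * c 0 * c k * c l * (2 * S))"
    unfolding S_def using c_nonneg by (intro sum_mono mult_left_mono sum_abs_diff_le_suminf c_summable J) auto
  finally show "(\<integral>x. (\<Sum>u\<in>J. ?w u x)\<^sup>2 \<partial>P) \<le> real (card J) * (128 * c 0 * S * c k * c l)"
    by (simp add: ac_simps)
qed measurable

definition QF :: "nat \<Rightarrow> nat \<Rightarrow> (int \<Rightarrow> 'c \<Rightarrow> real) \<Rightarrow> 'c \<Rightarrow> real" where
  "QF m n Z x = (\<Sum>t\<in>{1..int n}. \<Sum>s\<in>{1..int n}. wt m n (s - t) * (Z s x * Z t x))"

text \<open>The times s - k for s = 1, ..., n, at which \<open>Y k\<close> enters X_s.\<close>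

definition Ik :: "nat \<Rightarrow> nat \<Rightarrow> int set" where "Ik n k = {1 - int k..int n - int k}"

definition offkl :: "nat \<Rightarrow> nat \<Rightarrow> nat \<Rightarrow> nat \<Rightarrow> (int \<Rightarrow> 's) \<Rightarrow> real" where
  "offkl m n k l = offdiag (Ik n k) (Ik n l) (\<lambda>u v. wt m n (u - v + (int k - int l))) (Y k) (Y l)"

definition diagkl :: "nat \<Rightarrow> nat \<Rightarrow> nat \<Rightarrow> nat \<Rightarrow> (int \<Rightarrow> 's) \<Rightarrow> real" where
  "diagkl m n k l x = wt m n (int k - int l) * (\<Sum>u\<in>Ik n k \<inter> Ik n l. Y k u x * Y l u x)"

lemma finite_Ik [simp]: "finite (Ik n k)" by (simp add: Ik_def)

text \<open>The substitution u = s - k, v = t - l turns the lag s - t into u - v + (k - l). The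
  terms with u = v all carry the same weight and form \<open>diagkl\<close>.\<close>

lemma QF_XL: "QF m n (XL n) x = (\<Sum>k<n. \<Sum>l<n. diagkl m n k l x + offkl m n k l x)"
proof -
  have "QF m n (XL n) x = (\<Sum>t\<in>{1..int n}. \<Sum>s\<in>{1..int n}. \<Sum>k<n. \<Sum>l<n. wt m n (s - t) * (Y k (s - int k) x * Y l (t - int l) x))"
    unfolding QF_def XL_def sum_product unfolding sum_distrib_left ..
  also have "\<dots> = (\<Sum>k<n. \<Sum>l<n. \<Sum>t\<in>{1..int n}. \<Sum>s\<in>{1..int n}. wt m n (s - t) * (Y k (s - int k) x * Y l (t - int l) x))"
    by (rule sum_swap4)
  also have "\<dots> = (\<Sum>k<n. \<Sum>l<n. diagkl m n k l x + offkl m n k l x)"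
  proof (intro sum.cong refl)
    fix k l
    let ?F = "\<lambda>u v. wt m n (u - v + (int k - int l)) * (Y k u x * Y l v x)"
    have "(\<Sum>t\<in>{1..int n}. \<Sum>s\<in>{1..int n}. wt m n (s - t) * (Y k (s - int k) x * Y l (t - int l) x)) =
       (\<Sum>v\<in>Ik n l. \<Sum>u\<in>Ik n k. ?F u v)"
    proof (rule sum.reindex_bij_witness[of _ "\<lambda>v. v + int l" "\<lambda>t. t - int l"])
      fix t assume "t \<in> {1..int n}"
      show "(\<Sum>u\<in>Ik n k. ?F u (t - int l)) = (\<Sum>s\<in>{1..int n}. wt m n (s - t) * (Y k (s - int k) x * Y l (t - int l) x))"
        by (rule sum.reindex_bij_witness[of _ "\<lambda>t. t - int k" "\<lambda>v. v + int k"]) (auto simp: Ik_def algebra_simps)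
    qed (auto simp: Ik_def)
    also have "\<dots> = (\<Sum>v\<in>Ik n l. (if v \<in> Ik n k then ?F v v else 0) + (\<Sum>u\<in>Ik n k - {v}. ?F u v))"
      by (intro sum.cong refl) (auto simp: sum.remove)
    also have "\<dots> = (\<Sum>v\<in>Ik n l. if v \<in> Ik n k then ?F v v else 0) + offkl m n k l x"
      by (simp add: sum.distrib offkl_def offdiag_def)
    also have "(\<Sum>v\<in>Ik n l. if v \<in> Ik n k then ?F v v else 0) = diagkl m n k l x"
      by (simp add: diagkl_def sum_distrib_left sum.inter_restrict[symmetric] Int_commute)
    finally show "(\<Sum>t\<in>{1..int n}. \<Sum>s\<in>{1..int n}. wt m n (s - t) * (Y k (s - int k) x * Y l (t - int l) x)) = diagkl m n k l x + offkl m n k l x" .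
  qed
  finally show ?thesis .
qed

end

lemma sum_if_rect:
  fixes F :: "'i \<Rightarrow> 'j \<Rightarrow> real"
  assumes "finite H" "finite K" "A \<subseteq> H" "B \<subseteq> K"
  shows "(\<Sum>v\<in>K. \<Sum>u\<in>H. if u \<in> A \<and> v \<in> B then F u v else 0) = (\<Sum>v\<in>B. \<Sum>u\<in>A. F u v)"
proof (rule sum.mono_neutral_cong_right)
  fix v assume "v \<in> B"
  then show "(\<Sum>u\<in>H. if u \<in> A \<and> v \<in> B then F u v else 0) = (\<Sum>u\<in>A. F u v)"
    by (intro sum.mono_neutral_cong_right) (use assms in auto)
qed (use assms in auto)

text \<open>Places forms over different index ranges on one square, where they can be subtracted
  coefficientwise.\<close>

lemma offdiag_extend:
  assumes "finite H" "I \<subseteq> H" "J \<subseteq> H"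
  shows "offdiag I J c Y Z x = offdiag H H (\<lambda>u v. if u \<in> I \<and> v \<in> J then c u v else 0) Y Z x"
  unfolding offdiag_def
proof (rule sum.mono_neutral_cong_left)
  fix v assume v: "v \<in> J"
  show "(\<Sum>u\<in>I - {v}. c u v * (Y u x * Z v x)) = (\<Sum>u\<in>H - {v}. (if u \<in> I \<and> v \<in> J then c u v else 0) * (Y u x * Z v x))"
    by (rule sum.mono_neutral_cong_left) (use assms v in auto)
qed (use assms in auto)

lemma offdiag_diff:
  "offdiag I J c Y Z x - offdiag I J c' Y Z x = offdiag I J (\<lambda>u v. c u v - c' u v) Y Z x"
  by (simp add: offdiag_def sum_subtractf left_diff_distrib)

lemma wt_rows:
  assumes n: "2 * m < n" and m: "m > 0" and S: "finite S" "\<And>u v. u \<in> S \<Longrightarrow> v \<in> S \<Longrightarrow> \<bar>u - v\<bar> < int n"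
  shows "(\<Sum>u\<in>S. (wt m n (u - v + h))\<^sup>2) \<le> 1 / real n"
    and "(\<Sum>u\<in>S. (wt m n (v - u))\<^sup>2) \<le> 1 / real n"
    and "(\<Sum>u\<in>S. (wt m n (u - v + h) - wt m n (u - v))\<^sup>2) \<le> (real m * real_of_int h)\<^sup>2 / real n ^ 3"
proof -
  have "(\<Sum>u\<in>S. (wt m n (h - v + u))\<^sup>2) \<le> 1 / real n" by (rule wt_row_le(1)[OF n m S])
  then show "(\<Sum>u\<in>S. (wt m n (u - v + h))\<^sup>2) \<le> 1 / real n" by (simp add: algebra_simps)
  have "(\<Sum>u\<in>S. (wt m n (- v + u))\<^sup>2) \<le> 1 / real n" by (rule wt_row_le(1)[OF n m S])
  moreover have "wt m n (v - u) = wt m n (- v + u)" for u using wt_even[of m n "u - v"] by simp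
  ultimately show "(\<Sum>u\<in>S. (wt m n (v - u))\<^sup>2) \<le> 1 / real n" by simp
  have "(\<Sum>u\<in>S. (wt m n (- v + u + h) - wt m n (- v + u))\<^sup>2) \<le> (real m * real_of_int h)\<^sup>2 / real n ^ 3"
    by (rule wt_row_le(2)[OF n m S])
  then show "(\<Sum>u\<in>S. (wt m n (u - v + h) - wt m n (u - v))\<^sup>2) \<le> (real m * real_of_int h)\<^sup>2 / real n ^ 3"
    by simp
qed

context shift_process
begin

section \<open>Off-diagonal forms and the removal of the time shifts\<close>

lemma Ik_diam: "u \<in> Ik n k \<Longrightarrow> v \<in> Ik n k \<Longrightarrow> \<bar>u - v\<bar> < int n"
  by (auto simp: Ik_def)

lemma card_Ik [simp]: "card (Ik n k) = n"
  by (simp add: Ik_def)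

text \<open>The bound is uniform in n and summable over \<open>k\<close> and \<open>l\<close>: it is
  the majorant for the dominated convergence argument.\<close>

lemma offkl_bound:
  assumes n: "2 * m < n" and m: "m > 0"
  shows "Lp_le P 2 (offkl m n k l) (16 * c k * c l)"
proof -
  have q: "(\<Sum>v\<in>Ik n l. \<Sum>u\<in>Ik n k. (wt m n (u - v + (int k - int l)))\<^sup>2) \<le> 1"
  proof -
    have "(\<Sum>v\<in>Ik n l. \<Sum>u\<in>Ik n k. (wt m n (u - v + (int k - int l)))\<^sup>2) \<le> (\<Sum>v\<in>Ik n l. 1 / real n)"
      by (intro sum_mono wt_rows(1)[OF n m]) (auto intro: Ik_diam)
    also have "\<dots> = 1" using n by simp
    finally show ?thesis .
  qed
  have "Lp_le P 2 (offkl m n k l) (4 * (2 * c k) * (2 * c l) * sqrt 1)"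
    unfolding offkl_def by (rule offdiag_bound) (auto simp: q Y_mdiff Y_bound c_nonneg)
  moreover have "4 * (2 * c k) * (2 * c l) * sqrt 1 = 16 * c k * c l" by simp
  ultimately show ?thesis by (simp only:)
qed

definition off0 :: "nat \<Rightarrow> nat \<Rightarrow> nat \<Rightarrow> nat \<Rightarrow> (int \<Rightarrow> 's) \<Rightarrow> real" where
  "off0 m n k l = offdiag {1..int n} {1..int n} (\<lambda>u v. wt m n (u - v)) (Y k) (Y l)"

text \<open>The first term comes from the changed lag in the weights, the second from the boundary
  indices in which the ranges differ. For fixed \<open>L\<close> both vanish as m / n tends to
  0.\<close>

definition err :: "nat \<Rightarrow> nat \<Rightarrow> nat \<Rightarrow> real" where
  "err L m n = 2 * (real m * real L)\<^sup>2 / (real n)\<^sup>2 + 8 * real L / real n"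

lemma offkl_diff:
  assumes n: "2 * m < n" and m: "m > 0" and kl: "k < L" "l < L"
  shows "Lp_le P 2 (\<lambda>x. offkl m n k l x - off0 m n k l x) (16 * c k * c l * sqrt (err L m n))"
proof -
  have n0: "n > 0" using n by simp
  define h where "h = int k - int l"
  define H where "H = {1 - int (k + l)..int n}"
  let ?I = "{1..int n}" and ?w = "wt m n"
  let ?A = "\<lambda>u v. u \<in> Ik n k \<and> v \<in> Ik n l" and ?B = "\<lambda>u v. u \<in> ?I \<and> v \<in> ?I"
  define d where "d u v = (if ?A u v then ?w (u - v + h) else 0) - (if ?B u v then ?w (u - v) else 0)" for u v
  have sub: "Ik n k \<subseteq> H" "Ik n l \<subseteq> H" "?I \<subseteq> H" and finH: "finite H" by (auto simp: H_def Ik_def)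
  have "offkl m n k l x - off0 m n k l x = offdiag H H d (Y k) (Y l) x" for x
    unfolding offkl_def off0_def offdiag_extend[OF finH sub(1,2)] offdiag_extend[OF finH sub(3,3)] offdiag_diff
    unfolding d_def[abs_def] h_def ..
  moreover have "(\<Sum>v\<in>H. \<Sum>u\<in>H. (d u v)\<^sup>2) \<le> err L m n"
  proof -
    \<comment> \<open>The passage from the shifted rectangle to the square: \<open>E1\<close> pays
      for the change of weight on the rectangle, \<open>E2\<close> for exchanging the range of
      \<open>u\<close>, then \<open>E3\<close> for that of \<open>v\<close>.\<close>
    define E1 where "E1 u v = (if u \<in> Ik n k \<and> v \<in> Ik n l then (?w (u - v + h) - ?w (u - v))\<^sup>2 else 0)" for u v
    define SD where "SD k = (Ik n k - ?I) \<union> (?I - Ik n k)" for k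
    define E2 where "E2 u v = (if u \<in> SD k \<and> v \<in> Ik n l then (?w (u - v))\<^sup>2 else 0)" for u v
    define E3 where "E3 u v = (if u \<in> ?I \<and> v \<in> SD l then (?w (u - v))\<^sup>2 else 0)" for u v
    have sS: "SD k \<subseteq> H" "SD l \<subseteq> H" using sub by (auto simp: SD_def)
    have cardS: "real (card (SD k)) \<le> 2 * real k" for k
    proof -
      have "SD k \<subseteq> {1 - int k..0} \<union> {int n - int k + 1..int n}" by (auto simp: SD_def Ik_def)
      then have "card (SD k) \<le> card ({1 - int k..0} \<union> {int n - int k + 1..int n})" by (intro card_mono) auto
      also have "\<dots> \<le> card {1 - int k..0} + card {int n - int k + 1..int n}" by (rule card_Un_le)
      finally show ?thesis by simp
    qed
    have pw: "(d u v)\<^sup>2 \<le> 2 * E1 u v + 2 * (E2 u v + E3 u v)" for u v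
    proof -
      have sq: "(x - y)\<^sup>2 \<le> 2 * (x - y)\<^sup>2" "x\<^sup>2 \<le> 2 * (x - y)\<^sup>2 + 2 * y\<^sup>2" for x y :: real
      proof -
        have "0 \<le> (x - 2 * y)\<^sup>2" by simp
        then show "x\<^sup>2 \<le> 2 * (x - y)\<^sup>2 + 2 * y\<^sup>2" by (simp add: power2_eq_square algebra_simps)
      qed simp
      show ?thesis
        using sq[of "?w (u - v + h)" "?w (u - v)"]
        by (cases "u \<in> Ik n k"; cases "v \<in> Ik n l"; cases "u \<in> ?I"; cases "v \<in> ?I")
          (simp_all add: d_def E1_def E2_def E3_def SD_def del: atLeastAtMost_iff)
    qed
    have s1: "(\<Sum>v\<in>H. \<Sum>u\<in>H. E1 u v) \<le> (real m * real L)\<^sup>2 / (real n)\<^sup>2"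
    proof -
      have "(\<Sum>v\<in>H. \<Sum>u\<in>H. E1 u v) = (\<Sum>v\<in>Ik n l. \<Sum>u\<in>Ik n k. (?w (u - v + h) - ?w (u - v))\<^sup>2)"
        unfolding E1_def by (rule sum_if_rect[OF finH finH sub(1,2)])
      also have "\<dots> \<le> (\<Sum>v\<in>Ik n l. (real m * real_of_int h)\<^sup>2 / real n ^ 3)"
        by (intro sum_mono wt_rows(3)[OF n m]) (auto intro: Ik_diam)
      also have "\<dots> = (real m * real_of_int h)\<^sup>2 / (real n)\<^sup>2"
        using n0 by (simp add: power2_eq_square power3_eq_cube)
      also have "\<dots> \<le> (real m * real L)\<^sup>2 / (real n)\<^sup>2"
      proof (intro divide_right_mono)
        have "\<bar>real_of_int h\<bar> \<le> \<bar>real L\<bar>" using kl by (auto simp: h_def)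
        then have "(real_of_int h)\<^sup>2 \<le> (real L)\<^sup>2" by (subst abs_le_square_iff[symmetric])
        then show "(real m * real_of_int h)\<^sup>2 \<le> (real m * real L)\<^sup>2"
          unfolding power_mult_distrib by (intro mult_left_mono) auto
      qed simp
      finally show ?thesis .
    qed
    have s2: "(\<Sum>v\<in>H. \<Sum>u\<in>H. E2 u v) \<le> 2 * real L / real n"
    proof -
      have "(\<Sum>v\<in>H. \<Sum>u\<in>H. E2 u v) = (\<Sum>v\<in>Ik n l. \<Sum>u\<in>SD k. (?w (u - v))\<^sup>2)"
        unfolding E2_def by (rule sum_if_rect[OF finH finH sS(1) sub(2)])
      also have "\<dots> = (\<Sum>u\<in>SD k. \<Sum>v\<in>Ik n l. (?w (u - v))\<^sup>2)" by (rule sum.swap)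
      also have "\<dots> \<le> (\<Sum>u\<in>SD k. 1 / real n)"
        by (intro sum_mono wt_rows(2)[OF n m]) (auto intro: Ik_diam)
      also have "\<dots> \<le> 2 * real L / real n" using cardS[of k] kl by (auto simp: intro!: divide_right_mono)
      finally show ?thesis .
    qed
    have s3: "(\<Sum>v\<in>H. \<Sum>u\<in>H. E3 u v) \<le> 2 * real L / real n"
    proof -
      have "(\<Sum>v\<in>H. \<Sum>u\<in>H. E3 u v) = (\<Sum>v\<in>SD l. \<Sum>u\<in>?I. (?w (u - v))\<^sup>2)"
        unfolding E3_def by (rule sum_if_rect[OF finH finH sub(3) sS(2)])
      also have "\<dots> \<le> (\<Sum>v\<in>SD l. 1 / real n)"
        by (intro sum_mono) (rule wt_rows(1)[OF n m, of ?I _ 0, simplified], auto)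
      also have "\<dots> \<le> 2 * real L / real n" using cardS[of l] kl by (auto simp: intro!: divide_right_mono)
      finally show ?thesis .
    qed
    have "(\<Sum>v\<in>H. \<Sum>u\<in>H. (d u v)\<^sup>2) \<le> (\<Sum>v\<in>H. \<Sum>u\<in>H. 2 * E1 u v + 2 * (E2 u v + E3 u v))"
      by (intro sum_mono pw)
    also have "\<dots> = 2 * (\<Sum>v\<in>H. \<Sum>u\<in>H. E1 u v) + 2 * ((\<Sum>v\<in>H. \<Sum>u\<in>H. E2 u v) + (\<Sum>v\<in>H. \<Sum>u\<in>H. E3 u v))"
      by (simp only: sum.distrib sum_distrib_left[symmetric])
    also have "\<dots> \<le> 2 * ((real m * real L)\<^sup>2 / (real n)\<^sup>2) + 2 * (2 * real L / real n + 2 * real L / real n)"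
      by (intro add_mono mult_left_mono s1 s2 s3) auto
    also have "\<dots> = err L m n" by (simp add: err_def)
    finally show ?thesis .
  qed
  moreover have "Lp_le P 2 (offdiag H H d (Y k) (Y l)) (4 * (2 * c k) * (2 * c l) * sqrt (err L m n))"
    if "(\<Sum>v\<in>H. \<Sum>u\<in>H. (d u v)\<^sup>2) \<le> err L m n"
    by (rule offdiag_bound) (use finH that in \<open>auto simp: Y_mdiff Y_bound c_nonneg\<close>)
  moreover have "4 * (2 * c k) * (2 * c l) * sqrt (err L m n) = 16 * c k * c l * sqrt (err L m n)" by simp
  ultimately show ?thesis by (simp only:)
qed

text \<open>Partial sums of the series in Gordin's martingale approximation of the process.\<close>

definition DL :: "nat \<Rightarrow> int \<Rightarrow> (int \<Rightarrow> 's) \<Rightarrow> real" where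
  "DL L t x = (\<Sum>k<L. Y k t x)"

definition Off :: "nat \<Rightarrow> nat \<Rightarrow> nat \<Rightarrow> (int \<Rightarrow> 's) \<Rightarrow> real" where
  "Off L m n = offdiag {1..int n} {1..int n} (\<lambda>u v. wt m n (u - v)) (DL L) (DL L)"

lemma Off_eq: "Off L m n x = (\<Sum>k<L. \<Sum>l<L. off0 m n k l x)"
proof -
  have "Off L m n x = (\<Sum>v\<in>{1..int n}. \<Sum>u\<in>{1..int n} - {v}. \<Sum>k<L. \<Sum>l<L. wt m n (u - v) * (Y k u x * Y l v x))"
    unfolding Off_def offdiag_def DL_def sum_product unfolding sum_distrib_left ..
  also have "\<dots> = (\<Sum>v\<in>{1..int n}. \<Sum>k<L. \<Sum>l<L. \<Sum>u\<in>{1..int n} - {v}. wt m n (u - v) * (Y k u x * Y l v x))"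
    by (rule sum.cong[OF refl], rule trans[OF sum.swap], rule sum.cong[OF refl], rule sum.swap)
  also have "\<dots> = (\<Sum>k<L. \<Sum>l<L. \<Sum>v\<in>{1..int n}. \<Sum>u\<in>{1..int n} - {v}. wt m n (u - v) * (Y k u x * Y l v x))"
    by (rule trans[OF sum.swap], rule sum.cong[OF refl], rule sum.swap)
  finally show ?thesis by (simp add: off0_def offdiag_def)
qed

text \<open>The mass that the products c k * c l have outside the square k, l < L.\<close>

definition tail :: "nat \<Rightarrow> real" where
  "tail L = S\<^sup>2 - (\<Sum>k<L. c k)\<^sup>2"

text \<open>Dominated convergence in quantitative form: pairs with k, l < L are compared with their
  unshifted versions at cost \<open>err\<close>, the remaining ones are estimated by the uniform
  majorant.\<close>

lemma sum_off_bound: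
  assumes n: "2 * m < n" and m: "m > 0" and L: "L \<le> n"
  shows "Lp_le P 2 (\<lambda>x. (\<Sum>k<n. \<Sum>l<n. offkl m n k l x) - Off L m n x) (16 * S\<^sup>2 * sqrt (err L m n) + 16 * tail L)"
proof -
  define b where "b k l = (if k < L \<and> l < L then 16 * c k * c l * sqrt (err L m n) else 16 * c k * c l)" for k l
  have b: "Lp_le P 2 (\<lambda>x. offkl m n k l x - (if k < L \<and> l < L then off0 m n k l x else 0)) (b k l)" for k l
    using offkl_diff[OF n m, of k L l] offkl_bound[OF n m, of k l] by (auto simp: b_def)
  have rect: "(\<Sum>k<n. \<Sum>l<n. if k < L \<and> l < L then F k l else 0) = (\<Sum>k<L. \<Sum>l<L. F k l)" for F :: "nat \<Rightarrow> nat \<Rightarrow> real"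
    using sum_if_rect[of "{..<n}" "{..<n}" "{..<L}" "{..<L}" "\<lambda>l k. F k l"] L by (simp add: conj_commute)
  have eq: "(\<Sum>k<n. \<Sum>l<n. offkl m n k l x) - Off L m n x =
     (\<Sum>k<n. \<Sum>l<n. offkl m n k l x - (if k < L \<and> l < L then off0 m n k l x else 0))" for x
    by (simp add: Off_eq sum_subtractf rect)
  have "Lp_le P 2 (\<lambda>x. (\<Sum>k<n. \<Sum>l<n. offkl m n k l x) - Off L m n x) (\<Sum>k<n. \<Sum>l<n. b k l)"
    unfolding eq by (intro Lp_le_sum b) auto
  moreover have "(\<Sum>k<n. \<Sum>l<n. b k l) \<le> 16 * S\<^sup>2 * sqrt (err L m n) + 16 * tail L"
  proof -
    let ?e = "sqrt (err L m n)"
    have e0: "0 \<le> ?e" by (simp add: err_def)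
    have "(\<Sum>k<n. \<Sum>l<n. b k l) \<le> (\<Sum>k<n. \<Sum>l<n. 16 * ?e * (c k * c l) + 16 * (c k * c l - (if k < L \<and> l < L then c k * c l else 0)))"
      using e0 c_nonneg by (intro sum_mono) (auto simp: b_def)
    also have "\<dots> = 16 * ?e * (\<Sum>k<n. \<Sum>l<n. c k * c l) + 16 * ((\<Sum>k<n. \<Sum>l<n. c k * c l) - (\<Sum>k<n. \<Sum>l<n. if k < L \<and> l < L then c k * c l else 0))"
      by (simp only: sum.distrib sum_distrib_left[symmetric] sum_subtractf)
    also have "(\<Sum>k<n. \<Sum>l<n. if k < L \<and> l < L then c k * c l else 0) = (\<Sum>k<L. \<Sum>l<L. c k * c l)"
      by (rule rect)
    also have "(\<Sum>k<L. \<Sum>l<L. c k * c l) = (\<Sum>k<L. c k)\<^sup>2"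
      by (simp add: sum_product power2_eq_square)
    also have "(\<Sum>k<n. \<Sum>l<n. c k * c l) = (\<Sum>k<n. c k)\<^sup>2"
      by (simp add: sum_product power2_eq_square)
    also have "16 * ?e * (\<Sum>k<n. c k)\<^sup>2 + 16 * ((\<Sum>k<n. c k)\<^sup>2 - (\<Sum>k<L. c k)\<^sup>2) \<le> 16 * ?e * S\<^sup>2 + 16 * (S\<^sup>2 - (\<Sum>k<L. c k)\<^sup>2)"
      using e0 by (intro add_mono mult_left_mono diff_right_mono power_mono sum_c_le sum_nonneg c_nonneg) auto
    finally show ?thesis by (simp add: tail_def ac_simps)
  qed
  ultimately show ?thesis by (rule Lp_le_mono)
qed

definition Sq :: real where "Sq = (\<Sum>k. sqrt (c k))"

text \<open>A diagonal sum has a weight of at most sqrt m / n and fluctuations of order sqrt n,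
  which together give sqrt (m / n).\<close>

lemma sum_diag_bound:
  assumes n: "2 * m < n" and m: "m > 0"
  shows "Lp_le P 2 (\<lambda>x. \<Sum>k<n. \<Sum>l<n. diagkl m n k l x - (\<integral>x. diagkl m n k l x \<partial>P))
    (sqrt (real m / real n) * sqrt (128 * c 0 * S) * Sq\<^sup>2)"
proof -
  have n0: "n > 0" using n by simp
  let ?K = "sqrt (real m / real n) * sqrt (128 * c 0 * S)"
  have kl: "Lp_le P 2 (\<lambda>x. diagkl m n k l x - (\<integral>x. diagkl m n k l x \<partial>P)) (?K * (sqrt (c k) * sqrt (c l)))" for k l
  proof -
    let ?J = "Ik n k \<inter> Ik n l"
    have int: "integrable P (\<lambda>x. Y k u x * Y l u x)" for u by (rule L2_integrable[OF YY_bound])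
    have e: "diagkl m n k l x - (\<integral>x. diagkl m n k l x \<partial>P) =
      wt m n (int k - int l) * (\<Sum>u\<in>?J. Y k u x * Y l u x - (\<integral>x. Y k u x * Y l u x \<partial>P))" for x
      unfolding diagkl_def using int by (simp add: sum_subtractf right_diff_distrib)
    have "Lp_le P 2 (\<lambda>x. diagkl m n k l x - (\<integral>x. diagkl m n k l x \<partial>P)) (\<bar>wt m n (int k - int l)\<bar> * sqrt (real (card ?J) * (128 * c 0 * S * c k * c l)))"
      unfolding e by (intro Lp_le_cmult diag_bound) simp
    note 1 = this
    have 2: "\<bar>wt m n (int k - int l)\<bar> * sqrt (real (card ?J) * (128 * c 0 * S * c k * c l)) \<le>
        (sqrt (real m) / real n) * sqrt (real n * (128 * c 0 * S * c k * c l))"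
    proof (intro mult_mono wt_abs_le m real_sqrt_le_mono mult_right_mono)
      have "card ?J \<le> card (Ik n k)" by (intro card_mono) auto
      then show "real (card ?J) \<le> real n" by simp
    qed (use c_nonneg S_nonneg in auto)
    have 3: "(sqrt (real m) / real n) * sqrt (real n * (128 * c 0 * S * c k * c l)) = ?K * (sqrt (c k) * sqrt (c l))"
    proof -
      have "sqrt (real n) / real n = 1 / sqrt (real n)" using n0 by (simp add: real_div_sqrt field_simps)
      then have "sqrt (real m) * (sqrt (real n) / real n) = sqrt (real m / real n)" by (simp only: real_sqrt_divide) simp
      then have "sqrt (real m) / real n * sqrt (real n) = sqrt (real m / real n)" by simp
      moreover have "(sqrt (real m) / real n) * sqrt (real n * (128 * c 0 * S * c k * c l)) =
         (sqrt (real m) / real n * sqrt (real n)) * sqrt (128 * c 0 * S) * (sqrt (c k) * sqrt (c l))"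
        by (simp add: real_sqrt_mult)
      ultimately show ?thesis by simp
    qed
    show ?thesis by (rule Lp_le_mono[OF 1 2[unfolded 3]])
  qed
  have "Lp_le P 2 (\<lambda>x. \<Sum>k<n. \<Sum>l<n. diagkl m n k l x - (\<integral>x. diagkl m n k l x \<partial>P)) (\<Sum>k<n. \<Sum>l<n. ?K * (sqrt (c k) * sqrt (c l)))"
    by (intro Lp_le_sum kl) auto
  also have "(\<Sum>k<n. \<Sum>l<n. ?K * (sqrt (c k) * sqrt (c l))) = ?K * (\<Sum>k<n. sqrt (c k))\<^sup>2"
    unfolding power2_eq_square sum_product sum_distrib_left[symmetric] ..
  finally have 1: "Lp_le P 2 (\<lambda>x. \<Sum>k<n. \<Sum>l<n. diagkl m n k l x - (\<integral>x. diagkl m n k l x \<partial>P)) (?K * (\<Sum>k<n. sqrt (c k))\<^sup>2)" .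
  have 2: "?K * (\<Sum>k<n. sqrt (c k))\<^sup>2 \<le> ?K * Sq\<^sup>2"
    unfolding Sq_def using c_nonneg S_nonneg c_sqrt by (intro mult_left_mono power_mono sum_le_suminf sum_nonneg) auto
  show ?thesis by (rule Lp_le_mono[OF 1 2])
qed

text \<open>No cancellation is used: each of the n^2 terms is estimated by the maximal weight. The
  decay of \<open>c n\<close> pays for this, as n sqrt m * c n vanishes.\<close>

lemma QF_diff_bound:
  assumes m: "m > 0" and n: "n > 0"
  shows "Lp_le P 2 (\<lambda>x. QF m n X x - QF m n (XL n) x) (real n * sqrt (real m) * c n * (2 * nrm + c n))"
proof -
  have st: "Lp_le P 2 (\<lambda>x. X s x * X t x - XL n s x * XL n t x) (c n * nrm + (nrm + c n) * c n)" for s t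
  proof -
    have "Lp_le P 2 (\<lambda>x. R n s x * X t x + XL n s x * R n t x) (c n * nrm + (nrm + c n) * c n)"
      by (intro Lp_le_add L4_mult R_bound X_a XL_bound) simp
    then show ?thesis
    proof (rule Lp_le_cong)
      fix x
      have "R n s x = X s x - XL n s x" "R n t x = X t x - XL n t x" using X_decomp[of _ x n] by simp_all
      then show "R n s x * X t x + XL n s x * R n t x = X s x * X t x - XL n s x * XL n t x"
        by (simp only:) (simp add: algebra_simps)
    qed
  qed
  have e: "QF m n X x - QF m n (XL n) x = (\<Sum>t\<in>{1..int n}. \<Sum>s\<in>{1..int n}. wt m n (s - t) * (X s x * X t x - XL n s x * XL n t x))" for x
    by (simp add: QF_def sum_subtractf right_diff_distrib)
  have "Lp_le P 2 (\<lambda>x. QF m n X x - QF m n (XL n) x) (\<Sum>t\<in>{1..int n}. \<Sum>s\<in>{1..int n}. \<bar>wt m n (s - t)\<bar> * (c n * nrm + (nrm + c n) * c n))"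
    unfolding e by (intro Lp_le_sum Lp_le_cmult st) auto
  then show ?thesis
  proof (rule Lp_le_mono)
    have "(\<Sum>t\<in>{1..int n}. \<Sum>s\<in>{1..int n}. \<bar>wt m n (s - t)\<bar> * (c n * nrm + (nrm + c n) * c n)) \<le>
     (\<Sum>t\<in>{1..int n}. \<Sum>s\<in>{1..int n}. (sqrt (real m) / real n) * (c n * nrm + (nrm + c n) * c n))"
    using c_nonneg nrm_nonneg by (intro sum_mono mult_right_mono wt_abs_le m) auto
  also have "\<dots> = real n * sqrt (real m) * c n * (2 * nrm + c n)"
    using n by (simp add: algebra_simps)
  finally show "(\<Sum>t\<in>{1..int n}. \<Sum>s\<in>{1..int n}. \<bar>wt m n (s - t)\<bar> * (c n * nrm + (nrm + c n) * c n)) \<le> real n * sqrt (real m) * c n * (2 * nrm + c n)" .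
  qed
qed

text \<open>The total L^2 error. The leading 2 is the price of centring the difference between the
  forms for \<open>X\<close> and \<open>XL n\<close>.\<close>

definition beta :: "nat \<Rightarrow> nat \<Rightarrow> nat \<Rightarrow> real" where
  "beta L m n = 2 * (real n * sqrt (real m) * c n * (2 * nrm + c n)) + sqrt (real m / real n) * sqrt (128 * c 0 * S) * Sq\<^sup>2
     + (16 * S\<^sup>2 * sqrt (err L m n) + 16 * tail L)"

lemma QF_X_L2: "\<exists>b. Lp_le P 2 (QF m n X) b"
proof -
  have "Lp_le P 2 (QF m n X) (\<Sum>t\<in>{1..int n}. \<Sum>s\<in>{1..int n}. \<bar>wt m n (s - t)\<bar> * (nrm * nrm))"
    unfolding QF_def[abs_def] by (intro Lp_le_sum Lp_le_cmult L4_mult X_a) auto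
  then show ?thesis by blast
qed

text \<open>The off-diagonal forms have mean 0, so centring affects only the diagonal sums and the
  remainder of the decomposition. The means of the diagonal sums need not be known.\<close>

lemma main_approx:
  assumes n: "2 * m < n" and m: "m > 0" and L: "L \<le> n"
  shows "Lp_le P 2 (\<lambda>x. (QF m n X x - (\<integral>x. QF m n X x \<partial>P)) - Off L m n x) (beta L m n)"
proof -
  have n0: "n > 0" using n by simp
  let ?D = "\<lambda>x. QF m n X x - QF m n (XL n) x"
  have D: "Lp_le P 2 ?D (real n * sqrt (real m) * c n * (2 * nrm + c n))"
    by (rule QF_diff_bound[OF m n0])
  obtain b where b: "Lp_le P 2 (QF m n X) b" using QF_X_L2 by blast
  have i1: "integrable P (QF m n X)" "integrable P ?D" using L2_integrable b D by blast+
  have di: "integrable P (diagkl m n k l)" for k l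
    unfolding diagkl_def[abs_def] using L2_integrable[OF YY_bound] by (intro integrable_mult_right Bochner_Integration.integrable_sum) auto
  have oi: "integrable P (offkl m n k l)" for k l
    using L2_integrable[OF offkl_bound[OF n m]] .
  have o0: "(\<integral>x. offkl m n k l x \<partial>P) = 0" for k l
    unfolding offkl_def by (rule integral_offdiag) (auto simp: Y_mdiff)
  have "(\<integral>x. QF m n (XL n) x \<partial>P) = (\<Sum>k<n. \<Sum>l<n. \<integral>x. diagkl m n k l x \<partial>P)"
    unfolding QF_XL using di oi by (simp add: Bochner_Integration.integral_sum o0)
  moreover have "(\<integral>x. QF m n (XL n) x \<partial>P) = (\<integral>x. QF m n X x \<partial>P) - (\<integral>x. ?D x \<partial>P)"
    using Bochner_Integration.integral_diff[OF i1] by simp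
  ultimately have mean: "(\<integral>x. QF m n X x \<partial>P) = (\<integral>x. ?D x \<partial>P) + (\<Sum>k<n. \<Sum>l<n. \<integral>x. diagkl m n k l x \<partial>P)"
    by simp
  have "Lp_le P 2 (\<lambda>x. (?D x - (\<integral>x. ?D x \<partial>P)) + (\<Sum>k<n. \<Sum>l<n. diagkl m n k l x - (\<integral>x. diagkl m n k l x \<partial>P))
      + ((\<Sum>k<n. \<Sum>l<n. offkl m n k l x) - Off L m n x)) (beta L m n)"
    unfolding beta_def by (intro Lp_le_add Lp_le_center D sum_diag_bound[OF n m] sum_off_bound[OF n m L]) auto
  then show ?thesis
    by (rule Lp_le_cong) (simp add: mean QF_XL sum.distrib sum_subtractf)
qed

end

section \<open>Truncation, autocovariances and the variance\<close>

definition trunc :: "real \<Rightarrow> real \<Rightarrow> real" where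
  "trunc B z = max (- B) (min z B)"

lemma trunc_abs_le: "0 \<le> B \<Longrightarrow> \<bar>trunc B z\<bar> \<le> B"
  by (auto simp: trunc_def)

lemma trunc_diff_le: "0 \<le> B \<Longrightarrow> \<bar>z - trunc B z\<bar> \<le> \<bar>z\<bar>"
  by (auto simp: trunc_def)

lemma trunc_eq: "\<bar>z\<bar> \<le> B \<Longrightarrow> trunc B z = z"
  by (auto simp: trunc_def)

lemma measurable_trunc [measurable]: "trunc B \<in> borel_measurable borel"
  unfolding trunc_def by measurable

lemma sum_diff_window:
  fixes F :: "int \<Rightarrow> real"
  shows "(\<Sum>t\<in>{1..int n}. \<Sum>s\<in>{1..int n}. F (s - t)) = (\<Sum>h\<in>{- int n<..<int n}. (real n - \<bar>real_of_int h\<bar>) * F h)"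
proof -
  let ?I = "{1..int n}" and ?H = "{- int n<..<int n}"
  have "(\<Sum>t\<in>?I. \<Sum>s\<in>?I. F (s - t)) = (\<Sum>t\<in>?I. \<Sum>h | h \<in> ?H \<and> t + h \<in> ?I. F h)"
  proof (rule sum.cong[OF refl])
    fix t assume t: "t \<in> ?I"
    show "(\<Sum>s\<in>?I. F (s - t)) = (\<Sum>h | h \<in> ?H \<and> t + h \<in> ?I. F h)"
      by (rule sum.reindex_bij_witness[of _ "\<lambda>h. t + h" "\<lambda>s. s - t"]) (use t in auto)
  qed
  also have "\<dots> = (\<Sum>h\<in>?H. \<Sum>t | t \<in> ?I \<and> t + h \<in> ?I. F h)"
    by (rule sum.swap_restrict) auto
  also have "\<dots> = (\<Sum>h\<in>?H. (real n - \<bar>real_of_int h\<bar>) * F h)"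
  proof (rule sum.cong[OF refl])
    fix h assume h: "h \<in> ?H"
    have "{t. t \<in> ?I \<and> t + h \<in> ?I} = {max 1 (1 - h)..min (int n) (int n - h)}" by auto
    moreover have "int (card {max 1 (1 - h)..min (int n) (int n - h)}) = int n - \<bar>h\<bar>"
      using h by (auto simp: max_def min_def)
    ultimately have "real_of_int (int (card {t. t \<in> ?I \<and> t + h \<in> ?I})) = real_of_int (int n - \<bar>h\<bar>)" by simp
    then show "(\<Sum>t | t \<in> ?I \<and> t + h \<in> ?I. F h) = (real n - \<bar>real_of_int h\<bar>) * F h" by simp
  qed
  finally show ?thesis .
qed

text \<open>Connects the unordered sum in the spectral density with symmetric partial sums.\<close>

lemma filterlim_int_window: "filterlim (\<lambda>L. {- int L<..<int L}) (finite_subsets_at_top UNIV) sequentially"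
  unfolding filterlim_iff
proof (intro allI impI)
  fix Q :: "int set \<Rightarrow> bool" assume "eventually Q (finite_subsets_at_top UNIV)"
  then obtain A where A: "finite A" "\<And>B. finite B \<Longrightarrow> A \<subseteq> B \<Longrightarrow> Q B"
    by (auto simp: eventually_finite_subsets_at_top)
  obtain K :: int where K: "\<And>x. x \<in> A \<Longrightarrow> \<bar>x\<bar> \<le> K"
    using finite_imageI[OF A(1), of abs] by (meson Max_ge image_eqI)
  show "eventually (\<lambda>L. Q {- int L<..<int L}) sequentially"
  proof (rule eventually_sequentiallyI)
    fix L assume L: "nat \<bar>K\<bar> + 1 \<le> L"
    show "Q {- int L<..<int L}"
      by (rule A(2)) (use K L in \<open>fastforce simp: abs_le_iff\<close>)+
  qed
qed

context iid_space
begin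

lemma cexp_abs_le:
  assumes [measurable]: "g \<in> borel_measurable P" and g: "\<And>x. \<bar>g x\<bar> \<le> B" and x[measurable]: "x \<in> space P"
  shows "\<bar>cexp A g x\<bar> \<le> B"
proof -
  have "Lp_le P 1 (\<lambda>y. g (mix A x y)) B"
    using order_trans[OF abs_ge_zero g] by (intro Lp_le_bounded) (auto simp: g)
  then show ?thesis unfolding cexp_def by (rule L1_abs_integral)
qed

end

context shift_process
begin

lemma trunc_L4:
  assumes "e > 0" shows "\<exists>B>0. Lp_le P 4 (\<lambda>x. f x - trunc B (f x)) e"
proof -
  have i: "integrable P (\<lambda>x. \<bar>f x\<bar> ^ 4)" by (rule Lp_le_integrable[OF f_a])
  have "(\<lambda>N::nat. \<integral>x. \<bar>f x - trunc (real N) (f x)\<bar> ^ 4 \<partial>P) \<longlonglongrightarrow> (\<integral>x. 0 \<partial>P)"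
  proof (rule integral_dominated_convergence[OF _ _ i])
    show "AE x in P. (\<lambda>N::nat. \<bar>f x - trunc (real N) (f x)\<bar> ^ 4) \<longlonglongrightarrow> 0"
    proof (intro AE_I2)
      fix x
      have "eventually (\<lambda>N::nat. \<bar>f x\<bar> \<le> real N) sequentially"
        using filterlim_real_sequentially by (simp add: filterlim_at_top)
      then have "eventually (\<lambda>N::nat. \<bar>f x - trunc (real N) (f x)\<bar> ^ 4 = 0) sequentially"
        by eventually_elim (simp add: trunc_eq)
      then show "(\<lambda>N::nat. \<bar>f x - trunc (real N) (f x)\<bar> ^ 4) \<longlonglongrightarrow> 0"
        by (rule tendsto_eventually)
    qed
    show "AE x in P. norm (\<bar>f x - trunc (real N) (f x)\<bar> ^ 4) \<le> \<bar>f x\<bar> ^ 4" for N :: nat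
    proof (intro AE_I2)
      fix x
      have "\<bar>f x - trunc (real N) (f x)\<bar> ^ 4 \<le> \<bar>f x\<bar> ^ 4"
        by (intro power_mono trunc_diff_le) auto
      then show "norm (\<bar>f x - trunc (real N) (f x)\<bar> ^ 4) \<le> \<bar>f x\<bar> ^ 4" by simp
    qed
  qed measurable
  then have "eventually (\<lambda>N::nat. (\<integral>x. \<bar>f x - trunc (real N) (f x)\<bar> ^ 4 \<partial>P) < e ^ 4) sequentially"
    using assms by (intro order_tendstoD(2)) auto
  moreover have "eventually (\<lambda>N::nat. N > 0) sequentially" by (rule eventually_gt_at_top)
  ultimately have "eventually (\<lambda>N::nat. N > 0 \<and> (\<integral>x. \<bar>f x - trunc (real N) (f x)\<bar> ^ 4 \<partial>P) < e ^ 4) sequentially"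
    by eventually_elim auto
  then obtain N :: nat where N: "N > 0" "(\<integral>x. \<bar>f x - trunc (real N) (f x)\<bar> ^ 4 \<partial>P) < e ^ 4"
    using eventually_happens'[OF sequentially_bot] by blast
  have "Lp_le P 4 (\<lambda>x. f x - trunc (real N) (f x)) nrm"
    by (rule Lp_le_dominated[OF f_a]) (auto intro: trunc_diff_le)
  then have "Lp_le P 4 (\<lambda>x. f x - trunc (real N) (f x)) e"
    using N assms by (auto simp: Lp_le_def)
  then show ?thesis using N(1) by (intro exI[of _ "real N"]) auto
qed

text \<open>The process is truncated before it is projected; truncating the difference itself would
  destroy the martingale property. The mean created by the truncation cancels between the two
  conditional expectations.\<close>

definition dd :: "nat \<Rightarrow> nat \<Rightarrow> real \<Rightarrow> (int \<Rightarrow> 's) \<Rightarrow> real" where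
  "dd L W B x = (\<Sum>k<L. cexp {- int W<..0} (\<lambda>x. trunc B (X (int k) x)) x - cexp {- int W<..<0} (\<lambda>x. trunc B (X (int k) x)) x)"

lemma bounded_window_dd:
  assumes "0 < W" "0 \<le> B"
  shows "bounded_window \<mu> (dd L W B) W (real L * (2 * B))"
proof (unfold_locales)
  have L4t: "L4 (\<lambda>x. trunc B (X t x))" for t
    by (rule L4I, rule Lp_le_bounded[where B = B]) (auto simp: assms trunc_abs_le)
  have eq: "{- int W<..0} \<inter> {..<0} = {- int W<..<0}" and sub: "{- int W<..0} \<subseteq> {..0}" by auto
  show "mdiff 0 (dd L W B)"
    unfolding dd_def[abs_def]
  proof (rule mdiff_sum)
    fix k
    show "mdiff 0 (\<lambda>x. cexp {- int W<..0} (\<lambda>x. trunc B (X (int k) x)) x - cexp {- int W<..<0} (\<lambda>x. trunc B (X (int k) x)) x)"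
      by (rule mdiff_cexp[OF L4t[of "int k"] sub, unfolded eq])
  qed
  show "dep {- int W<..0} (dd L W B)"
    unfolding dd_def[abs_def] by (intro dep_sum dep_diff dep_cexp dep_mono[OF dep_cexp]) auto
  show "\<bar>dd L W B x\<bar> \<le> real L * (2 * B)" if x: "x \<in> space P" for x
  proof -
    have "\<bar>cexp A (\<lambda>x. trunc B (X (int k) x)) x\<bar> \<le> B" for A k
      by (rule cexp_abs_le[OF _ _ x]) (auto simp: assms trunc_abs_le)
    then have "\<bar>cexp {- int W<..0} (\<lambda>x. trunc B (X (int k) x)) x - cexp {- int W<..<0} (\<lambda>x. trunc B (X (int k) x)) x\<bar> \<le> B + B" for k
      by (intro order_trans[OF abs_triangle_ineq4] add_mono)
    then have "\<bar>dd L W B x\<bar> \<le> (\<Sum>k<L. 2 * B)"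
      unfolding dd_def by (intro order_trans[OF sum_abs] sum_mono) simp
    then show ?thesis by simp
  qed
qed (use assms in auto)

text \<open>Each of the two projections contributes \<open>c W\<close> for restricting the window
  and \<tau> for the truncation, as conditional expectations are contractions.\<close>

lemma dd_close:
  assumes B: "0 \<le> B" and t: "Lp_le P 4 (\<lambda>x. f x - trunc B (f x)) \<tau>"
  shows "Lp_le P 4 (\<lambda>x. DL L 0 x - dd L W B x) (real L * (2 * (c W + \<tau>)))"
proof -
  have 2: "Lp_le P 4 (\<lambda>x. cexp A (X k) x - cexp A (\<lambda>x. trunc B (X k x)) x) \<tau>" for A k
  proof -
    have "Lp_le P 4 (\<lambda>x. X k x - trunc B (X k x)) \<tau>"
      using Lp_le_shift[OF t, of k] by (simp add: X_def)
    then have "Lp_le P 4 (cexp A (\<lambda>x. X k x - trunc B (X k x))) \<tau>" by (rule Lp_le_cexp) simp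
    then show ?thesis
    proof (rule Lp_le_cong_AE)
      have "integrable P (\<lambda>x. trunc B (X k x))"
        by (rule L4_integrable[OF Lp_le_bounded[where B = B]]) (auto simp: B trunc_abs_le)
      then show "AE x in P. cexp A (\<lambda>x. X k x - trunc B (X k x)) x = cexp A (X k) x - cexp A (\<lambda>x. trunc B (X k x)) x"
        by (rule cexp_diff[OF X_int])
    qed measurable
  qed
  have 1: "Lp_le P 4 (\<lambda>x. cexp A (X (int k)) x - cexp A' (X (int k)) x) (c W)" if "A' = A \<inter> {- int W<..}" for A A' k
    using X_coup_subset[of A' A "int k" "k + W"] that by (intro Lp_le_mono[OF _ c_mono[of W "k + W"]]) auto
  have "Lp_le P 4 (\<lambda>x. \<Sum>k<L.
      ((cexp {..0} (X (int k)) x - cexp {- int W<..0} (X (int k)) x) + (cexp {- int W<..0} (X (int k)) x - cexp {- int W<..0} (\<lambda>x. trunc B (X (int k) x)) x)) -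
      ((cexp {..<0} (X (int k)) x - cexp {- int W<..<0} (X (int k)) x) + (cexp {- int W<..<0} (X (int k)) x - cexp {- int W<..<0} (\<lambda>x. trunc B (X (int k) x)) x)))
     (\<Sum>k<L. (c W + \<tau>) + (c W + \<tau>))"
    by (intro Lp_le_sum Lp_le_diff Lp_le_add 1 2) auto
  then have "Lp_le P 4 (\<lambda>x. DL L 0 x - dd L W B x) (\<Sum>k<L. (c W + \<tau>) + (c W + \<tau>))"
    by (rule Lp_le_cong) (simp add: DL_def dd_def Y_def sum_subtractf sum.distrib)
  then show ?thesis by simp
qed

section \<open>Passage from partial sums to a bounded difference\<close>

lemma DL_mdiff: "mdiff t (DL L t)"
  unfolding DL_def[abs_def] by (intro mdiff_sum Y_mdiff)

lemma DL_bound: "Lp_le P 4 (DL L t) (2 * S)"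
proof -
  have "Lp_le P 4 (DL L t) (\<Sum>k<L. 2 * c k)"
    unfolding DL_def[abs_def] by (intro Lp_le_sum Y_bound) simp
  then show ?thesis
    by (rule Lp_le_mono) (use sum_c_le[of "{..<L}"] in \<open>simp add: sum_distrib_left[symmetric]\<close>)
qed

lemma DL_shift: "x \<in> space P \<Longrightarrow> DL L t x = DL L 0 (shift t x)"
  unfolding DL_def using Y_shift by (intro sum.cong refl) blast

lemma wt_total:
  assumes n: "2 * m < n" and m: "m > 0"
  shows "(\<Sum>v\<in>{1..int n}. \<Sum>u\<in>{1..int n}. (wt m n (u - v))\<^sup>2) \<le> 1"
proof -
  have "(\<Sum>v\<in>{1..int n}. \<Sum>u\<in>{1..int n}. (wt m n (u - v))\<^sup>2) \<le> (\<Sum>v\<in>{1..int n}. 1 / real n)"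
    by (intro sum_mono wt_row_interval(1)[OF n m])
  then show ?thesis using n by simp
qed

text \<open>A bilinear form is changed in one argument at a time. Both changes are again
  off-diagonal forms in martingale differences.\<close>

lemma Off_close:
  assumes n: "2 * m < n" and m: "m > 0" and bw: "bounded_window \<mu> d W B"
    and e: "Lp_le P 4 (\<lambda>x. DL L 0 x - d x) e"
  shows "Lp_le P 2 (\<lambda>x. Off L m n x - bounded_window.TD d m n x) (4 * e * (2 * S) + 4 * (2 * S + e) * e)"
proof -
  interpret bw: bounded_window \<mu> d W B by (rule bw)
  let ?I = "{1..int n}" and ?w = "\<lambda>u v. wt m n (u - v)"
  have e0: "0 \<le> e" by (rule Lp_le_nonneg[OF e])
  have et: "Lp_le P 4 (\<lambda>x. DL L t x - bw.D t x) e" for t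
    by (rule Lp_le_cong[OF Lp_le_shift[OF e, of t]]) (simp add: DL_shift[of _ L t] bw.D_def)
  have Db: "Lp_le P 4 (bw.D t) (2 * S + e)" for t
    by (rule Lp_le_cong[OF Lp_le_diff[OF DL_bound[of L t] et[of t]]]) auto
  \<comment> \<open>Evenness of the weights unfolds twice the triangle into all off-diagonal
    pairs.\<close>
  have TD: "bw.TD m n x = offdiag ?I ?I ?w bw.D bw.D x" for x
  proof -
    have "wt m n (v - u) = wt m n (u - v)" for u v using wt_even[of m n "u - v"] by simp
    then show ?thesis
      by (simp add: offdiag_eq_quad bw.TD_def quad_def sum_distrib_left mult_ac flip: sum.distrib)
  qed
  have "Off L m n x - bw.TD m n x =
    offdiag ?I ?I ?w (\<lambda>t x. DL L t x - bw.D t x) (DL L) x + offdiag ?I ?I ?w bw.D (\<lambda>t x. DL L t x - bw.D t x) x" for x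
    unfolding TD Off_def offdiag_def sum.distrib[symmetric] sum_subtractf[symmetric]
    by (intro sum.cong refl) (simp add: algebra_simps)
  moreover have "Lp_le P 2 (\<lambda>x. offdiag ?I ?I ?w (\<lambda>t x. DL L t x - bw.D t x) (DL L) x + offdiag ?I ?I ?w bw.D (\<lambda>t x. DL L t x - bw.D t x) x)
     (4 * e * (2 * S) * sqrt 1 + 4 * (2 * S + e) * e * sqrt 1)"
    by (intro Lp_le_add offdiag_bound)
       (use e0 S_nonneg wt_total[OF n m] in \<open>auto simp: DL_mdiff bw.D_mdiff DL_bound et Db intro: mdiff_diff\<close>)
  ultimately show ?thesis by simp
qed

definition sgL :: "nat \<Rightarrow> real" where "sgL L = (\<integral>x. (DL L 0 x)\<^sup>2 \<partial>P)"

lemma sg_close: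
  assumes bw: "bounded_window \<mu> d W B" and e: "Lp_le P 4 (\<lambda>x. DL L 0 x - d x) e"
  shows "\<bar>bounded_window.sg \<mu> d - sgL L\<bar> \<le> e * (4 * S + e)"
proof -
  interpret bw: bounded_window \<mu> d W B by (rule bw)
  have D: "Lp_le P 2 (DL L 0) (2 * S)" by (rule L4_L2[OF DL_bound])
  have d: "Lp_le P 2 d (2 * S + e)"
    by (rule L4_L2, rule Lp_le_cong[OF Lp_le_diff[OF DL_bound[of L 0] e]]) auto
  have "Lp_le P 2 (\<lambda>x. DL L 0 x + d x) (2 * S + (2 * S + e))" by (intro Lp_le_add D d) simp
  from L2_prod_bound[OF L4_L2[OF e] this]
  have "\<bar>\<integral>x. (DL L 0 x - d x) * (DL L 0 x + d x) \<partial>P\<bar> \<le> e * (4 * S + e)" by simp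
  also have "(\<integral>x. (DL L 0 x - d x) * (DL L 0 x + d x) \<partial>P) = (\<integral>x. (DL L 0 x)\<^sup>2 - (d x)\<^sup>2 \<partial>P)"
    by (simp add: power2_eq_square algebra_simps)
  also have "\<dots> = sgL L - bw.sg"
    unfolding sgL_def bw.sg_def using D d by (subst Bochner_Integration.integral_diff) (auto simp: Lp_le_def)
  finally show ?thesis by (simp add: abs_minus_commute)
qed

section \<open>Autocovariances and the long-run variance\<close>

definition gam :: "int \<Rightarrow> real" where "gam h = (\<integral>x. X h x * X 0 x \<partial>P)"

lemma gam_shift: "(\<integral>x. X (t + h) x * X t x \<partial>P) = gam h"
proof -
  have "(\<integral>x. X h (shift t x) * X 0 (shift t x) \<partial>P) = gam h"
    unfolding gam_def by (rule integral_shift[of "\<lambda>x. X h x * X 0 x"]) measurable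
  then show ?thesis by (simp add: X_shift add.commute)
qed

lemma gam_minus: "gam (- h) = gam h"
  using gam_shift[of h "- h"] by (simp add: gam_def mult.commute)

text \<open>X_0 is a function of the past up to time 0, so X_h may be replaced by its forecast from
  that past, which is bounded by \<open>c h\<close>. Symmetry covers negative lags.\<close>

lemma gam_bound: "\<bar>gam h\<bar> \<le> nrm * c (nat \<bar>h\<bar>)"
proof -
  have *: "\<bar>gam (int k)\<bar> \<le> nrm * c k" for k
  proof -
    have "gam (int k) = (\<integral>x. X 0 x * cexp {..0} (X (int k)) x \<partial>P)"
      unfolding gam_def
      by (subst integral_mult_cexp[OF X_dep]) (auto intro: L4_mult_integrable[OF X_a X_a] simp: mult.commute)
    also have "\<bar>\<dots>\<bar> \<le> nrm * c k"
      by (rule L2_prod_bound[OF L4_L2[OF X_a] L4_L2[OF X_coup_disjoint]]) auto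
    finally show ?thesis .
  qed
  show ?thesis
  proof (cases "0 \<le> h")
    case True
    then show ?thesis using *[of "nat h"] by simp
  next
    case False
    then show ?thesis using *[of "nat (- h)"] gam_minus[of h] by simp
  qed
qed

lemma gam_abs_summable: "(\<lambda>h. norm (gam h)) summable_on UNIV"
proof (rule nonneg_bdd_above_summable_on)
  show "bdd_above (sum (\<lambda>h. norm (gam h)) ` {F. F \<subseteq> UNIV \<and> finite F})"
  proof (rule bdd_aboveI2)
    fix F :: "int set" assume F: "F \<in> {F. F \<subseteq> UNIV \<and> finite F}"
    have "(\<Sum>h\<in>F. norm (gam h)) \<le> (\<Sum>h\<in>F. nrm * c (nat \<bar>0 - h\<bar>))"
      using gam_bound by (intro sum_mono) simp
    also have "\<dots> \<le> nrm * (2 * suminf c)"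
      unfolding sum_distrib_left[symmetric] using F c_nonneg nrm_nonneg
      by (intro mult_left_mono sum_abs_diff_le_suminf c_summable) auto
    finally show "(\<Sum>h\<in>F. norm (gam h)) \<le> nrm * (2 * suminf c)" .
  qed
qed simp

text \<open>The long-run variance, 2 pi f(0).\<close>

definition Gam :: real where "Gam = (\<Sum>\<^sub>\<infinity>h\<in>UNIV. gam h)"

lemma Gam_lim: "(\<lambda>L. \<Sum>h\<in>{- int L<..<int L}. gam h) \<longlonglongrightarrow> Gam"
proof -
  have "(gam has_sum Gam) UNIV"
    unfolding Gam_def by (rule has_sum_infsum) (rule abs_summable_summable[OF gam_abs_summable])
  then show ?thesis unfolding has_sum_def by (rule filterlim_compose[OF _ filterlim_int_window])
qed

text \<open>For \<open>XL\<close> the identity is exact: orthogonality keeps, in the autocovariance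
  at lag \<open>h\<close>, only the pairs with h = k - l. Replacing \<open>XL\<close> by
  \<open>X\<close> costs a multiple of \<open>c L\<close> at each of fewer than 2 L lags.\<close>

lemma sgL_gam: "\<bar>sgL L - (\<Sum>h\<in>{- int L<..<int L}. gam h)\<bar> \<le> 2 * real L * (c L * (2 * nrm + c L))"
proof -
  let ?H = "{- int L<..<int L}"
  let ?r = "\<lambda>k l. \<integral>x. Y k 0 x * Y l 0 x \<partial>P"
  have YYi: "integrable P (\<lambda>x. Y k u x * Y l v x)" for k l u v
    by (rule L4_mult_integrable[OF Y_bound Y_bound])
  have r: "(\<integral>x. Y k u x * Y l u x \<partial>P) = ?r k l" for k l u
  proof -
    have "(\<integral>x. Y k u x * Y l u x \<partial>P) = (\<integral>x. Y k 0 (shift u x) * Y l 0 (shift u x) \<partial>P)"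
      by (intro Bochner_Integration.integral_cong refl) (simp add: Y_shift[of _ _ u])
    also have "\<dots> = ?r k l" by (rule integral_shift[of "\<lambda>x. Y k 0 x * Y l 0 x"]) measurable
    finally show ?thesis .
  qed
  have XX: "(\<integral>x. XL L h x * XL L 0 x \<partial>P) = (\<Sum>k<L. \<Sum>l<L. if h = int k - int l then ?r k l else 0)" for h
  proof -
    have "(\<integral>x. XL L h x * XL L 0 x \<partial>P) = (\<Sum>k<L. \<Sum>l<L. \<integral>x. Y k (h - int k) x * Y l (- int l) x \<partial>P)"
      unfolding XL_def sum_product using YYi by (simp add: Bochner_Integration.integral_sum)
    also have "\<dots> = (\<Sum>k<L. \<Sum>l<L. if h = int k - int l then ?r k l else 0)"
    proof (intro sum.cong refl)
      fix k l
      show "(\<integral>x. Y k (h - int k) x * Y l (- int l) x \<partial>P) = (if h = int k - int l then ?r k l else 0)"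
      proof (cases "h = int k - int l")
        case True
        then have hk: "h - int k = - int l" by simp
        show ?thesis unfolding hk using True r[of k "- int l" l] by simp
      next
        case False
        then have "h - int k \<noteq> - int l" by linarith
        then show ?thesis using False by (simp add: mdiff_orth[OF Y_mdiff Y_mdiff])
      qed
    qed
    finally show ?thesis .
  qed
  have "(\<Sum>h\<in>?H. \<integral>x. XL L h x * XL L 0 x \<partial>P) = (\<Sum>k<L. \<Sum>l<L. \<Sum>h\<in>?H. if h = int k - int l then ?r k l else 0)"
    unfolding XX by (rule trans[OF sum.swap], rule sum.cong[OF refl], rule sum.swap)
  \<comment> \<open>Each pair k, l < L meets exactly one lag of the window, namely k - l.\<close>
  also have "\<dots> = (\<Sum>k<L. \<Sum>l<L. ?r k l)"
    by (intro sum.cong refl) auto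
  also have "\<dots> = sgL L"
    unfolding sgL_def DL_def power2_eq_square sum_product using YYi by (simp add: Bochner_Integration.integral_sum)
  finally have sg: "sgL L = (\<Sum>h\<in>?H. \<integral>x. XL L h x * XL L 0 x \<partial>P)" by simp
  have d: "\<bar>(\<integral>x. XL L h x * XL L 0 x \<partial>P) - gam h\<bar> \<le> c L * (2 * nrm + c L)" for h
  proof -
    have "Lp_le P 2 (\<lambda>x. R L h x * X 0 x + XL L h x * R L 0 x) (c L * nrm + (nrm + c L) * c L)"
      by (intro Lp_le_add L4_mult R_bound X_a XL_bound) simp
    then have "Lp_le P 2 (\<lambda>x. X h x * X 0 x - XL L h x * XL L 0 x) (c L * nrm + (nrm + c L) * c L)"
    proof (rule Lp_le_cong)
      fix x
      have "R L h x = X h x - XL L h x" "R L 0 x = X 0 x - XL L 0 x" using X_decomp[of _ x L] by simp_all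
      then show "R L h x * X 0 x + XL L h x * R L 0 x = X h x * X 0 x - XL L h x * XL L 0 x"
        by (simp only:) (simp add: algebra_simps)
    qed
    then have "\<bar>\<integral>x. X h x * X 0 x - XL L h x * XL L 0 x \<partial>P\<bar> \<le> c L * nrm + (nrm + c L) * c L"
      by (rule L2_abs_integral)
    also have "(\<integral>x. X h x * X 0 x - XL L h x * XL L 0 x \<partial>P) = gam h - (\<integral>x. XL L h x * XL L 0 x \<partial>P)"
      unfolding gam_def
      by (rule Bochner_Integration.integral_diff[OF L4_mult_integrable[OF X_a X_a] L4_mult_integrable[OF XL_bound XL_bound]])
    finally show ?thesis by (simp add: abs_minus_commute algebra_simps)
  qed
  have "\<bar>sgL L - (\<Sum>h\<in>?H. gam h)\<bar> \<le> (\<Sum>h\<in>?H. c L * (2 * nrm + c L))"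
    unfolding sg sum_subtractf[symmetric] by (rule order_trans[OF sum_abs]) (intro sum_mono d)
  also have "\<dots> = real (card ?H) * (c L * (2 * nrm + c L))" by simp
  also have "\<dots> \<le> (2 * real L) * (c L * (2 * nrm + c L))"
    using c_nonneg nrm_nonneg by (intro mult_right_mono) auto
  finally show ?thesis .
qed

lemma c_sq_lim: "(\<lambda>k. (real k + 1)\<^sup>2 * c k) \<longlonglongrightarrow> 0"
  by (rule summable_LIMSEQ_zero[OF c_sq])

lemma c_lim: "c \<longlonglongrightarrow> 0"
  by (rule summable_LIMSEQ_zero[OF c_summable])

lemma sgL_lim: "sgL \<longlonglongrightarrow> Gam"
proof -
  have "(\<lambda>L. sgL L - (\<Sum>h\<in>{- int L<..<int L}. gam h)) \<longlonglongrightarrow> 0"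
  proof (rule Lim_null_comparison)
    show "eventually (\<lambda>L. norm (sgL L - (\<Sum>h\<in>{- int L<..<int L}. gam h)) \<le> 2 * ((real L + 1)\<^sup>2 * c L) * (2 * nrm + c L)) sequentially"
    proof (intro always_eventually allI)
      fix L
      have "real L \<le> (real L + 1)\<^sup>2" by (simp add: power2_eq_square algebra_simps)
      then have "2 * real L * (c L * (2 * nrm + c L)) \<le> 2 * (real L + 1)\<^sup>2 * (c L * (2 * nrm + c L))"
        using c_nonneg nrm_nonneg by (intro mult_right_mono) auto
      then show "norm (sgL L - (\<Sum>h\<in>{- int L<..<int L}. gam h)) \<le> 2 * ((real L + 1)\<^sup>2 * c L) * (2 * nrm + c L)"
        using sgL_gam[of L] by (simp add: mult.assoc)
    qed
    have "(\<lambda>L. 2 * ((real L + 1)\<^sup>2 * c L) * (2 * nrm + c L)) \<longlonglongrightarrow> 2 * 0 * (2 * nrm + 0)"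
      by (intro tendsto_intros c_sq_lim c_lim)
    then show "(\<lambda>L. 2 * ((real L + 1)\<^sup>2 * c L) * (2 * nrm + c L)) \<longlonglongrightarrow> 0" by simp
  qed
  from tendsto_add[OF this Gam_lim] show ?thesis by simp
qed

lemma tail_lim: "tail \<longlonglongrightarrow> 0"
proof -
  have "(\<lambda>L. \<Sum>k<L. c k) \<longlonglongrightarrow> S" unfolding S_def by (rule summable_LIMSEQ[OF c_summable])
  then have "(\<lambda>L. S\<^sup>2 - (\<Sum>k<L. c k)\<^sup>2) \<longlonglongrightarrow> S\<^sup>2 - S\<^sup>2" by (intro tendsto_intros)
  then show ?thesis by (simp add: tail_def[abs_def])
qed

end

section \<open>Bias and convergence of characteristic functions\<close>

context shift_process
begin

section \<open>Bias of the averaged periodogram\<close>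

definition M2 :: real where "M2 = (\<Sum>k. (real k + 1)\<^sup>2 * c k)"

lemma M2_nonneg: "0 \<le> M2"
  unfolding M2_def by (intro suminf_nonneg c_sq) (simp add: c_nonneg)

lemma sum_gam_weighted:
  assumes "finite H" shows "(\<Sum>h\<in>H. (\<bar>real_of_int h\<bar> + 1)\<^sup>2 * \<bar>gam h\<bar>) \<le> 2 * nrm * M2"
proof -
  have "(\<Sum>h\<in>H. (\<bar>real_of_int h\<bar> + 1)\<^sup>2 * \<bar>gam h\<bar>) \<le> (\<Sum>h\<in>H. nrm * ((real (nat \<bar>0 - h\<bar>) + 1)\<^sup>2 * c (nat \<bar>0 - h\<bar>)))"
  proof (rule sum_mono)
    fix h
    have "(\<bar>real_of_int h\<bar> + 1)\<^sup>2 * \<bar>gam h\<bar> \<le> (\<bar>real_of_int h\<bar> + 1)\<^sup>2 * (nrm * c (nat \<bar>h\<bar>))"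
      by (intro mult_left_mono gam_bound) simp
    then show "(\<bar>real_of_int h\<bar> + 1)\<^sup>2 * \<bar>gam h\<bar> \<le> nrm * ((real (nat \<bar>0 - h\<bar>) + 1)\<^sup>2 * c (nat \<bar>0 - h\<bar>))"
      by (simp add: ac_simps)
  qed
  also have "\<dots> \<le> nrm * (2 * M2)"
    unfolding M2_def sum_distrib_left[symmetric] using c_nonneg nrm_nonneg assms
    by (intro mult_left_mono sum_abs_diff_le_suminf[where c = "\<lambda>k. (real k + 1)\<^sup>2 * c k"] c_sq) auto
  finally show ?thesis by simp
qed

text \<open>Outside the window |h| is at least n, so a factor 1 / n can be drawn from the weighted
  sum of autocovariances.\<close>

lemma Gam_tail:
  assumes n: "n > 0"
  shows "\<bar>Gam - (\<Sum>h\<in>{- int n<..<int n}. gam h)\<bar> \<le> 2 * nrm * M2 / real n"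
proof -
  let ?H = "\<lambda>N. {- int N<..<int N}"
  have "(\<lambda>N. \<bar>(\<Sum>h\<in>?H N. gam h) - (\<Sum>h\<in>?H n. gam h)\<bar>) \<longlonglongrightarrow> \<bar>Gam - (\<Sum>h\<in>?H n. gam h)\<bar>"
    by (intro tendsto_intros Gam_lim)
  moreover have "eventually (\<lambda>N. \<bar>(\<Sum>h\<in>?H N. gam h) - (\<Sum>h\<in>?H n. gam h)\<bar> \<le> 2 * nrm * M2 / real n) sequentially"
  proof (rule eventually_sequentiallyI)
    fix N assume N: "n \<le> N"
    have "(\<Sum>h\<in>?H N. gam h) - (\<Sum>h\<in>?H n. gam h) = (\<Sum>h\<in>?H N - ?H n. gam h)"
      using N by (subst sum_diff) auto
    then have "\<bar>(\<Sum>h\<in>?H N. gam h) - (\<Sum>h\<in>?H n. gam h)\<bar> \<le> (\<Sum>h\<in>?H N - ?H n. \<bar>gam h\<bar>)"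
      by simp
    also have "\<dots> \<le> (\<Sum>h\<in>?H N - ?H n. ((\<bar>real_of_int h\<bar> + 1)\<^sup>2 * \<bar>gam h\<bar>) / real n)"
    proof (rule sum_mono)
      fix h assume "h \<in> ?H N - ?H n"
      then have "real n \<le> \<bar>real_of_int h\<bar>" by auto
      also have "\<dots> \<le> (\<bar>real_of_int h\<bar> + 1)\<^sup>2" by (simp add: power2_eq_square algebra_simps)
      finally have "real n * \<bar>gam h\<bar> \<le> (\<bar>real_of_int h\<bar> + 1)\<^sup>2 * \<bar>gam h\<bar>" by (intro mult_right_mono) auto
      then show "\<bar>gam h\<bar> \<le> ((\<bar>real_of_int h\<bar> + 1)\<^sup>2 * \<bar>gam h\<bar>) / real n"
        using n by (simp add: pos_le_divide_eq mult.commute)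
    qed
    also have "\<dots> \<le> 2 * nrm * M2 / real n"
      unfolding sum_divide_distrib[symmetric] by (intro divide_right_mono sum_gam_weighted) auto
    finally show "\<bar>(\<Sum>h\<in>?H N. gam h) - (\<Sum>h\<in>?H n. gam h)\<bar> \<le> 2 * nrm * M2 / real n" .
  qed
  ultimately show ?thesis by (rule tendsto_upperbound) simp
qed

lemma QF_mean: "(\<integral>x. QF m n X x \<partial>P) = (\<Sum>h\<in>{- int n<..<int n}. (real n - \<bar>real_of_int h\<bar>) * (wt m n h * gam h))"
proof -
  have i: "integrable P (\<lambda>x. X s x * X t x)" for s t by (rule L4_mult_integrable[OF X_a X_a])
  have g: "(\<integral>x. X s x * X t x \<partial>P) = gam (s - t)" for s t
    using gam_shift[of t "s - t"] by simp
  have "(\<integral>x. QF m n X x \<partial>P) = (\<Sum>t\<in>{1..int n}. \<Sum>s\<in>{1..int n}. wt m n (s - t) * gam (s - t))"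
    unfolding QF_def using i by (simp add: Bochner_Integration.integral_sum g)
  also have "\<dots> = (\<Sum>h\<in>{- int n<..<int n}. (real n - \<bar>real_of_int h\<bar>) * (wt m n h * gam h))"
    by (rule sum_diff_window)
  finally show ?thesis .
qed

text \<open>In the mean the lag \<open>h\<close> has the factor q h = (1 - |h| / n) kern / m. The
  first part differs from 1 by order 1 / n, the second by order m^2 / n^2 since the cosine is flat
  at 0. The second moment of the autocovariances absorbs both.\<close>

lemma bias_bound:
  assumes m: "m > 0" and n: "n > 0"
  shows "\<bar>(\<integral>x. QF m n X x \<partial>P) - sqrt (real m) * (Gam / (2 * pi))\<bar> \<le>
    sqrt (real m) * (2 * nrm * M2 * (2 / real n + 32 * (real m)\<^sup>2 / (real n)\<^sup>2))"
proof -
  let ?H = "{- int n<..<int n}"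
  define q where "q h = (1 - \<bar>real_of_int h\<bar> / real n) * (kern m n h / real m)" for h
  have qe: "(real n - \<bar>real_of_int h\<bar>) * (wt m n h * gam h) = sqrt (real m) / (2 * pi) * (q h * gam h)" for h
  proof -
    have "sqrt (real m) / real m = 1 / sqrt (real m)" using m by (simp add: real_div_sqrt field_simps)
    moreover have "sqrt (real m) / (2 * pi) * (q h * gam h) =
       (sqrt (real m) / real m) * ((1 - \<bar>real_of_int h\<bar> / real n) * kern m n h * gam h / (2 * pi))"
      by (simp add: q_def)
    moreover have "(real n - \<bar>real_of_int h\<bar>) * (wt m n h * gam h) = 
       1 / sqrt (real m) * ((1 - \<bar>real_of_int h\<bar> / real n) * kern m n h * gam h / (2 * pi))"
    proof -
      have "real n - \<bar>real_of_int h\<bar> = real n * (1 - \<bar>real_of_int h\<bar> / real n)" using n by (simp add: right_diff_distrib)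
      then show ?thesis using n by (simp add: wt_def mult_ac)
    qed
    ultimately show ?thesis by simp
  qed
  have q1: "\<bar>q h - 1\<bar> \<le> (1 / real n + 32 * (real m)\<^sup>2 / (real n)\<^sup>2) * (\<bar>real_of_int h\<bar> + 1)\<^sup>2" if h: "h \<in> ?H" for h
  proof -
    let ?k = "kern m n h / real m" and ?x = "\<bar>real_of_int h\<bar> / real n"
    have x: "0 \<le> ?x" using n by simp
    have k1: "\<bar>?k\<bar> \<le> 1" using kern_abs_le[of m n h] m by simp
    have k2: "0 \<le> 1 - ?k" using kern_near_0(1)[OF n, of m h] m by (simp add: field_simps)
    have k3: "1 - ?k \<le> (2 * pi * real m * real_of_int h / real n)\<^sup>2 / 2"
    proof -
      have "real m * (1 - ?k) = real m - kern m n h" using m by (simp add: right_diff_distrib)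
      then have "real m * (1 - ?k) \<le> real m * ((2 * pi * real m * real_of_int h / real n)\<^sup>2 / 2)"
        using kern_near_0(2)[OF n, of m h] by simp
      then show ?thesis using m by (simp only: mult_le_cancel_left_pos of_nat_0_less_iff)
    qed
    have "q h - 1 = - (1 - ?k) - ?x * ?k" by (simp add: q_def algebra_simps)
    also have "\<bar>\<dots>\<bar> \<le> (1 - ?k) + ?x * 1"
    proof -
      have "\<bar>?x * ?k\<bar> \<le> ?x * 1" unfolding abs_mult using x k1 by (intro mult_mono) auto
      then show ?thesis using k2 by linarith
    qed
    also have "\<dots> \<le> (2 * pi * real m * real_of_int h / real n)\<^sup>2 / 2 + ?x" using k3 by simp
    also have "\<dots> \<le> (32 * (real m)\<^sup>2 / (real n)\<^sup>2) * (\<bar>real_of_int h\<bar> + 1)\<^sup>2 + (1 / real n) * (\<bar>real_of_int h\<bar> + 1)\<^sup>2"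
    proof (intro add_mono)
      have hh: "\<bar>real_of_int h\<bar>\<^sup>2 \<le> (\<bar>real_of_int h\<bar> + 1)\<^sup>2" by (intro power_mono) auto
      \<comment> \<open>The constant 32 is 2 pi^2 estimated with pi < 4.\<close>
      have pp: "4 * pi\<^sup>2 / 2 \<le> 32"
      proof -
        have "pi\<^sup>2 \<le> 4\<^sup>2" using pi_less_4 by (intro power_mono) auto
        then show ?thesis by simp
      qed
      have "(2 * pi * real m * real_of_int h / real n)\<^sup>2 / 2 = (4 * pi\<^sup>2 / 2) * ((real m)\<^sup>2 / (real n)\<^sup>2) * \<bar>real_of_int h\<bar>\<^sup>2"
        by (simp add: power_mult_distrib power_divide)
      also have "\<dots> \<le> 32 * ((real m)\<^sup>2 / (real n)\<^sup>2) * (\<bar>real_of_int h\<bar> + 1)\<^sup>2"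
        using hh pp by (intro mult_mono mult_right_mono) auto
      finally show "(2 * pi * real m * real_of_int h / real n)\<^sup>2 / 2 \<le> (32 * (real m)\<^sup>2 / (real n)\<^sup>2) * (\<bar>real_of_int h\<bar> + 1)\<^sup>2"
        by simp
      have "\<bar>real_of_int h\<bar> \<le> (\<bar>real_of_int h\<bar> + 1)\<^sup>2" by (simp add: power2_eq_square algebra_simps)
      then show "?x \<le> (1 / real n) * (\<bar>real_of_int h\<bar> + 1)\<^sup>2" using n by (simp add: divide_right_mono)
    qed
    finally show ?thesis by (simp add: algebra_simps)
  qed
  have A: "\<bar>(\<Sum>h\<in>?H. q h * gam h) - (\<Sum>h\<in>?H. gam h)\<bar> \<le> (1 / real n + 32 * (real m)\<^sup>2 / (real n)\<^sup>2) * (2 * nrm * M2)"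
  proof -
    have "\<bar>(\<Sum>h\<in>?H. q h * gam h) - (\<Sum>h\<in>?H. gam h)\<bar> = \<bar>\<Sum>h\<in>?H. (q h - 1) * gam h\<bar>"
      by (simp add: sum_subtractf left_diff_distrib)
    also have "\<dots> \<le> (\<Sum>h\<in>?H. (1 / real n + 32 * (real m)\<^sup>2 / (real n)\<^sup>2) * ((\<bar>real_of_int h\<bar> + 1)\<^sup>2 * \<bar>gam h\<bar>))"
    proof (rule order_trans[OF sum_abs], rule sum_mono)
      fix h assume "h \<in> ?H"
      from mult_right_mono[OF q1[OF this], of "\<bar>gam h\<bar>"]
      show "\<bar>(q h - 1) * gam h\<bar> \<le> (1 / real n + 32 * (real m)\<^sup>2 / (real n)\<^sup>2) * ((\<bar>real_of_int h\<bar> + 1)\<^sup>2 * \<bar>gam h\<bar>)"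
        by (simp add: abs_mult mult.assoc)
    qed
    also have "\<dots> \<le> (1 / real n + 32 * (real m)\<^sup>2 / (real n)\<^sup>2) * (2 * nrm * M2)"
      unfolding sum_distrib_left[symmetric] by (intro mult_left_mono sum_gam_weighted) auto
    finally show ?thesis .
  qed
  have "(\<integral>x. QF m n X x \<partial>P) - sqrt (real m) * (Gam / (2 * pi)) = sqrt (real m) / (2 * pi) * ((\<Sum>h\<in>?H. q h * gam h) - Gam)"
    unfolding QF_mean qe sum_distrib_left[symmetric] by (simp add: right_diff_distrib)
  also have "\<bar>\<dots>\<bar> = sqrt (real m) / (2 * pi) * \<bar>(\<Sum>h\<in>?H. q h * gam h) - Gam\<bar>"
    by (simp add: abs_mult)
  also have "\<dots> \<le> sqrt (real m) * ((1 / real n + 32 * (real m)\<^sup>2 / (real n)\<^sup>2) * (2 * nrm * M2) + 2 * nrm * M2 / real n)"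
  proof (intro mult_mono)
    show "sqrt (real m) / (2 * pi) \<le> sqrt (real m)" using pi_gt3 by (simp add: divide_le_eq mult_le_cancel_left1)
    show "\<bar>(\<Sum>h\<in>?H. q h * gam h) - Gam\<bar> \<le> (1 / real n + 32 * (real m)\<^sup>2 / (real n)\<^sup>2) * (2 * nrm * M2) + 2 * nrm * M2 / real n"
      using A Gam_tail[OF n] by linarith
  qed auto
  also have "\<dots> = sqrt (real m) * (2 * nrm * M2 * (2 / real n + 32 * (real m)\<^sup>2 / (real n)\<^sup>2))"
    by (simp add: algebra_simps add_divide_distrib)
  finally show ?thesis .
qed

text \<open>For fixed \<open>L\<close>, n sqrt m * c n is dominated by (n + 1)^2 c n, and all other
  terms are powers of m / n or 1 / n; only the tail of the majorant does not depend on n.\<close>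

lemma beta_lim:
  fixes m :: "nat \<Rightarrow> nat"
  assumes mn: "(\<lambda>n. real (m n) / real n) \<longlonglongrightarrow> 0" and ev: "eventually (\<lambda>n. 2 * m n < n \<and> m n > 0) sequentially"
  shows "(\<lambda>n. beta L (m n) n) \<longlonglongrightarrow> 16 * tail L"
proof -
  have inv: "(\<lambda>n. 1 / real n) \<longlonglongrightarrow> 0" by (rule lim_1_over_n)
  have A: "(\<lambda>n. real n * sqrt (real (m n)) * c n) \<longlonglongrightarrow> 0"
  proof (rule tendsto_sandwich[where f = "\<lambda>_. 0", OF _ _ tendsto_const c_sq_lim])
    show "eventually (\<lambda>n. real n * sqrt (real (m n)) * c n \<le> (real n + 1)\<^sup>2 * c n) sequentially"
      using ev
    proof eventually_elim
      case (elim n)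
      have "sqrt (real (m n)) \<le> sqrt ((real n + 1)\<^sup>2)"
      proof (rule real_sqrt_le_mono)
        have "real (m n) \<le> real n" using elim by simp
        also have "\<dots> \<le> (real n + 1)\<^sup>2" by (simp add: power2_eq_square algebra_simps)
        finally show "real (m n) \<le> (real n + 1)\<^sup>2" .
      qed
      then have "real n * sqrt (real (m n)) \<le> (real n + 1) * (real n + 1)" by (intro mult_mono) auto
      then show ?case using c_nonneg by (intro mult_right_mono) (auto simp: power2_eq_square)
    qed
  qed (auto intro!: always_eventually simp: c_nonneg)
  have E: "(\<lambda>n. err L (m n) n) \<longlonglongrightarrow> 0"
  proof -
    have "(\<lambda>n. 2 * (real L)\<^sup>2 * (real (m n) / real n)\<^sup>2 + 8 * real L * (1 / real n)) \<longlonglongrightarrow> 2 * (real L)\<^sup>2 * 0\<^sup>2 + 8 * real L * 0"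
      by (intro tendsto_intros mn inv)
    then show ?thesis by (simp add: err_def[abs_def] power_divide power_mult_distrib mult.commute mult.left_commute)
  qed
  have "(\<lambda>n. 2 * (real n * sqrt (real (m n)) * c n * (2 * nrm + c n)) + sqrt (real (m n) / real n) * sqrt (128 * c 0 * S) * Sq\<^sup>2
     + (16 * S\<^sup>2 * sqrt (err L (m n) n) + 16 * tail L)) \<longlonglongrightarrow>
     2 * (0 * (2 * nrm + 0)) + sqrt 0 * sqrt (128 * c 0 * S) * Sq\<^sup>2 + (16 * S\<^sup>2 * sqrt 0 + 16 * tail L)"
    by (intro tendsto_intros A E mn c_lim)
  then show ?thesis by (simp add: beta_def[abs_def])
qed

lemma QF_meas: "QF m n X \<in> borel_measurable P"
  using QF_X_L2 Lp_le_measurable by blast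

text \<open>The parameters are chosen in the order \<open>L\<close>, \<epsilon>, then
  \<open>B\<close> and \<open>W\<close>, and n tends to infinity last. \<open>L\<close> controls the
  tail and the variance of the infinite series, \<epsilon> the passage to a bounded
  difference.\<close>

theorem phi_QF:
  fixes m :: "nat \<Rightarrow> nat"
  assumes m: "filterlim m at_top at_top" and mn: "(\<lambda>n. real (m n) / real n) \<longlonglongrightarrow> 0"
  shows "(\<lambda>n. phi (\<lambda>x. QF (m n) n X x - (\<integral>x. QF (m n) n X x \<partial>P)) \<theta>) \<longlonglongrightarrow> of_real (exp (- (\<theta>\<^sup>2 * (Gam\<^sup>2 / (4 * pi\<^sup>2)) / 2)))"
proof (rule LIMSEQ_I)
  fix e :: real assume e: "0 < e"
  define g where "g y = exp (- (\<theta>\<^sup>2 * (y\<^sup>2 / (4 * pi\<^sup>2)) / 2))" for y :: real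
  let ?Z = "\<lambda>n x. QF (m n) n X x - (\<integral>x. QF (m n) n X x \<partial>P)"
  note ev = eventually_double_less[OF m mn]
  have "isCont g Gam" unfolding g_def by (intro continuous_intros) simp_all
  then obtain \<delta> where \<delta>: "\<delta> > 0" "\<And>y. \<bar>y - Gam\<bar> < \<delta> \<Longrightarrow> \<bar>g y - g Gam\<bar> < e / 4"
    using e unfolding continuous_at_eps_delta dist_real_def by (metis zero_less_divide_iff zero_less_numeral)
  obtain L where L: "\<bar>sgL L - Gam\<bar> < \<delta> / 2" "\<bar>\<theta>\<bar> * (16 * tail L) < e / 8"
  proof -
    have "(\<lambda>L. \<bar>\<theta>\<bar> * (16 * tail L)) \<longlonglongrightarrow> \<bar>\<theta>\<bar> * (16 * 0)" by (intro tendsto_intros tail_lim)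
    then have "eventually (\<lambda>L. \<bar>\<theta>\<bar> * (16 * tail L) < e / 8) sequentially" using e by (intro order_tendstoD(2)) auto
    moreover have "eventually (\<lambda>L. \<bar>sgL L - Gam\<bar> < \<delta> / 2) sequentially"
      using tendstoD[OF sgL_lim, of "\<delta> / 2"] \<delta>(1) by (simp add: dist_real_def)
    ultimately have "eventually (\<lambda>L. \<bar>sgL L - Gam\<bar> < \<delta> / 2 \<and> \<bar>\<theta>\<bar> * (16 * tail L) < e / 8) sequentially"
      by eventually_elim auto
    then show thesis using that eventually_happens'[OF sequentially_bot] by blast
  qed
  define k where "k \<epsilon> = 4 * \<epsilon> * (2 * S) + 4 * (2 * S + \<epsilon>) * \<epsilon>" for \<epsilon>
  obtain \<epsilon> where \<epsilon>: "\<epsilon> > 0" "\<bar>\<theta>\<bar> * k \<epsilon> < e / 8" "\<epsilon> * (4 * S + \<epsilon>) < \<delta> / 2"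
  proof -
    have "((\<lambda>\<epsilon>. \<bar>\<theta>\<bar> * k \<epsilon>) \<longlongrightarrow> \<bar>\<theta>\<bar> * k 0) (at_right 0)"
      unfolding k_def by (intro tendsto_intros)
    then have "eventually (\<lambda>\<epsilon>. \<bar>\<theta>\<bar> * k \<epsilon> < e / 8) (at_right 0)"
      using e by (intro order_tendstoD(2)) (auto simp: k_def)
    moreover have "((\<lambda>\<epsilon>. \<epsilon> * (4 * S + \<epsilon>)) \<longlongrightarrow> 0 * (4 * S + 0)) (at_right 0)"
      by (intro tendsto_intros)
    then have "eventually (\<lambda>\<epsilon>. \<epsilon> * (4 * S + \<epsilon>) < \<delta> / 2) (at_right 0)"
      using \<delta>(1) by (intro order_tendstoD(2)) auto
    moreover have "eventually (\<lambda>\<epsilon>::real. \<epsilon> > 0) (at_right 0)" by (rule eventually_at_right_less)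
    ultimately have "eventually (\<lambda>\<epsilon>. \<epsilon> > 0 \<and> \<bar>\<theta>\<bar> * k \<epsilon> < e / 8 \<and> \<epsilon> * (4 * S + \<epsilon>) < \<delta> / 2) (at_right 0)"
      by eventually_elim auto
    then show thesis using that eventually_happens'[OF trivial_limit_at_right_real] by blast
  qed
  obtain W B where WB: "0 < W" "0 \<le> B" "Lp_le P 4 (\<lambda>x. DL L 0 x - dd L W B x) \<epsilon>"
  proof -
    \<comment> \<open>Window and truncation may each cost \<open>r\<close> in both projections of
      \<open>L\<close> summands, 4 L r in all. The 1 added to L keeps the quotient defined for L =
      0.\<close>
    define r where "r = \<epsilon> / (4 * (real L + 1))"
    have r: "r > 0" using \<epsilon>(1) by (simp add: r_def)
    obtain B where B: "B > 0" "Lp_le P 4 (\<lambda>x. f x - trunc B (f x)) r" using trunc_L4[OF r] by blast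
    have "eventually (\<lambda>W. W > 0 \<and> c W < r) sequentially"
      by (intro eventually_conj eventually_gt_at_top order_tendstoD(2)[OF c_lim] r)
    then obtain W where W: "W > 0" "c W < r" using eventually_happens'[OF sequentially_bot] by blast
    have "Lp_le P 4 (\<lambda>x. DL L 0 x - dd L W B x) (real L * (2 * (c W + r)))"
      by (rule dd_close) (use B in auto)
    then have "Lp_le P 4 (\<lambda>x. DL L 0 x - dd L W B x) \<epsilon>"
    proof (rule Lp_le_mono)
      have "real L * (2 * (c W + r)) \<le> (real L + 1) * (2 * (r + r))"
        using W r c_nonneg[of W] by (intro mult_mono) auto
      also have "\<dots> = \<epsilon>" by (simp add: r_def divide_simps)
      finally show "real L * (2 * (c W + r)) \<le> \<epsilon>" .
    qed
    then show thesis using that[of W B] W B by auto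
  qed
  interpret bw: bounded_window \<mu> "dd L W B" W "real L * (2 * B)"
    by (rule bounded_window_dd[OF WB(1,2)])
  have "\<bar>bw.sg - Gam\<bar> < \<delta>"
    using sg_close[OF bw.bounded_window_axioms WB(3)] \<epsilon>(3) L(1) by linarith
  then have gg: "\<bar>g bw.sg - g Gam\<bar> < e / 4" by (rule \<delta>(2))
  have "(\<lambda>n. phi (bw.TD (m n) n) \<theta>) \<longlonglongrightarrow> of_real (g bw.sg)"
    unfolding g_def by (rule bw.clt_quad[OF m mn])
  from tendstoD[OF this, of "e / 4"] e
  have ev1: "eventually (\<lambda>n. cmod (phi (bw.TD (m n) n) \<theta> - of_real (g bw.sg)) < e / 4) sequentially"
    by (simp add: dist_norm)
  have "(\<lambda>n. \<bar>\<theta>\<bar> * beta L (m n) n) \<longlonglongrightarrow> \<bar>\<theta>\<bar> * (16 * tail L)" by (intro tendsto_intros beta_lim[OF mn ev])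
  then have ev2: "eventually (\<lambda>n. \<bar>\<theta>\<bar> * beta L (m n) n < e / 8) sequentially"
    using L(2) by (rule order_tendstoD(2))
  have "eventually (\<lambda>n. norm (phi (?Z n) \<theta> - of_real (g Gam)) < e) sequentially"
    using ev ev1 ev2 eventually_ge_at_top[of L]
  proof eventually_elim
    case (elim n)
    have "Lp_le P 2 (\<lambda>x. (?Z n x - Off L (m n) n x) + (Off L (m n) n x - bw.TD (m n) n x)) 
       (beta L (m n) n + (k \<epsilon>))"
      unfolding k_def using elim by (intro Lp_le_add main_approx Off_close[OF _ _ bw.bounded_window_axioms WB(3)]) auto
    then have "Lp_le P 2 (\<lambda>x. ?Z n x - bw.TD (m n) n x) (beta L (m n) n + (k \<epsilon>))"
      by (rule Lp_le_cong) simp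
    then have "cmod (phi (?Z n) \<theta> - phi (bw.TD (m n) n) \<theta>) \<le> \<bar>\<theta>\<bar> * (beta L (m n) n + (k \<epsilon>))"
      by (intro phi_diff bw.TD_meas) (use QF_meas in measurable)
    also have "\<dots> < e / 8 + e / 8" using elim(3) \<epsilon>(2) by (simp only: distrib_left)
    finally have 1: "cmod (phi (?Z n) \<theta> - phi (bw.TD (m n) n) \<theta>) \<le> e / 4" by simp
    have 2: "cmod (phi (bw.TD (m n) n) \<theta> - of_real (g bw.sg)) \<le> e / 4" using elim(2) by simp
    have 3: "cmod (of_real (g bw.sg) - of_real (g Gam)) \<le> e / 4"
      unfolding of_real_diff[symmetric] norm_of_real using gg by simp
    have "norm (phi (?Z n) \<theta> - of_real (g Gam)) \<le> e / 4 + e / 4 + e / 4"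
      by (rule norm_diff_triangle_le[OF norm_diff_triangle_le[OF 1 2] 3])
    then show ?case using e by simp
  qed
  then show "\<exists>no. \<forall>n\<ge>no. norm (phi (?Z n) \<theta> - of_real (exp (- (\<theta>\<^sup>2 * (Gam\<^sup>2 / (4 * pi\<^sup>2)) / 2)))) < e"
    by (simp add: eventually_sequentially g_def)
qed

theorem phi_QF_normalized:
  fixes m :: "nat \<Rightarrow> nat"
  assumes m: "filterlim m at_top at_top" and o: "(\<lambda>n. real (m n)) \<in> o(\<lambda>n. real n powr (4 / 5))" and G: "Gam > 0"
  defines "f0 \<equiv> Gam / (2 * pi)"
  shows "(\<lambda>n. phi (\<lambda>x. (QF (m n) n X x - sqrt (real (m n)) * f0) / f0) \<theta>) \<longlonglongrightarrow> of_real (exp (- (\<theta>\<^sup>2 / 2)))"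
proof -
  define r where "r n = real (m n) / real n powr (4 / 5)" for n
  have r: "r \<longlonglongrightarrow> 0" unfolding r_def using smalloD_tendsto[OF o] .
  have f0: "f0 > 0" using G by (simp add: f0_def)
  have mr: "real (m n) = r n * real n powr (4 / 5)" if "n > 0" for n using that by (simp add: r_def)
  have mn: "(\<lambda>n. real (m n) / real n) \<longlonglongrightarrow> 0"
  proof -
    have "(\<lambda>n. r n * real n powr (- 1 / 5)) \<longlonglongrightarrow> 0"
    proof (intro tendsto_mult_zero r)
      show "(\<lambda>n. real n powr (- 1 / 5)) \<longlonglongrightarrow> 0"
        by (rule tendsto_neg_powr[OF _ filterlim_real_sequentially]) simp
    qed
    moreover have "eventually (\<lambda>n. r n * real n powr (- 1 / 5) = real (m n) / real n) sequentially"
      using eventually_gt_at_top[of 0]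
    proof eventually_elim
      case (elim n)
      have "real n powr (4 / 5) = real n powr (- 1 / 5) * real n"
        using powr_add[of "real n" "- 1 / 5" 1] elim by simp
      moreover have "real n powr (- 1 / 5) > 0" using elim by simp
      ultimately show ?case by (simp add: r_def)
    qed
    ultimately show ?thesis by (rule Lim_transform_eventually)
  qed
  have mpos: "eventually (\<lambda>n. m n > 0) sequentially"
    using m unfolding filterlim_at_top by (auto dest!: spec[of _ 1] elim: eventually_mono)
  define bi where "bi n = (\<integral>x. QF (m n) n X x \<partial>P) - sqrt (real (m n)) * f0" for n
  have bi: "bi \<longlonglongrightarrow> 0"
  proof (rule Lim_null_comparison)
    show "eventually (\<lambda>n. norm (bi n) \<le> 2 * nrm * M2 * (2 * (real (m n) / real n) + 32 * sqrt (r n ^ 5))) sequentially"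
      using mpos eventually_gt_at_top[of 0]
    proof eventually_elim
      case (elim n)
      have s1: "sqrt (real (m n)) * (2 / real n) \<le> 2 * (real (m n) / real n)"
      proof -
        have "sqrt (real (m n)) \<le> real (m n)" using elim by (intro sqrt_le_self) simp
        then show ?thesis by (simp add: divide_right_mono)
      qed
      \<comment> \<open>The origin of the exponent 4/5: sqrt m * m^2 / n^2 is the square root of m^5
        / n^4, the fifth power of m / n^(4/5).\<close>
      have s2: "sqrt (real (m n)) * (32 * (real (m n))\<^sup>2 / (real n)\<^sup>2) = 32 * sqrt (r n ^ 5)"
      proof -
        have p: "(real n powr (4 / 5)) ^ 5 = real n ^ 4"
          using elim by (simp add: powr_power)
        have "r n ^ 5 = real (m n) ^ 5 / real n ^ 4" unfolding r_def power_divide p ..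
        also have "\<dots> = real (m n) * ((real (m n))\<^sup>2 / (real n)\<^sup>2)\<^sup>2"
          by (simp add: power_divide eval_nat_numeral)
        finally have "sqrt (r n ^ 5) = sqrt (real (m n)) * ((real (m n))\<^sup>2 / (real n)\<^sup>2)"
          by (simp add: real_sqrt_mult)
        then show ?thesis by simp
      qed
      have "norm (bi n) \<le> sqrt (real (m n)) * (2 * nrm * M2 * (2 / real n + 32 * (real (m n))\<^sup>2 / (real n)\<^sup>2))"
        unfolding bi_def f0_def real_norm_def using elim by (intro bias_bound) auto
      also have "\<dots> = 2 * nrm * M2 * (sqrt (real (m n)) * (2 / real n) + sqrt (real (m n)) * (32 * (real (m n))\<^sup>2 / (real n)\<^sup>2))"
        by (simp add: algebra_simps)
      also have "\<dots> \<le> 2 * nrm * M2 * (2 * (real (m n) / real n) + 32 * sqrt (r n ^ 5))"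
        unfolding s2 using s1 nrm_nonneg M2_nonneg by (intro mult_left_mono add_right_mono) auto
      finally show ?case .
    qed
    have "(\<lambda>n. 2 * nrm * M2 * (2 * (real (m n) / real n) + 32 * sqrt (r n ^ 5))) \<longlonglongrightarrow> 2 * nrm * M2 * (2 * 0 + 32 * sqrt (0 ^ 5))"
      by (intro tendsto_intros mn r)
    then show "(\<lambda>n. 2 * nrm * M2 * (2 * (real (m n) / real n) + 32 * sqrt (r n ^ 5))) \<longlonglongrightarrow> 0" by simp
  qed
  let ?Z = "\<lambda>n x. QF (m n) n X x - (\<integral>x. QF (m n) n X x \<partial>P)"
  let ?V = "\<lambda>n x. QF (m n) n X x - sqrt (real (m n)) * f0"
  have lim: "(\<lambda>n. phi (?Z n) (\<theta> / f0)) \<longlonglongrightarrow> of_real (exp (- ((\<theta> / f0)\<^sup>2 * (Gam\<^sup>2 / (4 * pi\<^sup>2)) / 2)))"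
    by (rule phi_QF[OF m mn])
  have e: "(\<theta> / f0)\<^sup>2 * (Gam\<^sup>2 / (4 * pi\<^sup>2)) = \<theta>\<^sup>2"
    using G by (simp add: f0_def power_divide power_mult_distrib)
  have "(\<lambda>n. phi (?V n) (\<theta> / f0) - phi (?Z n) (\<theta> / f0)) \<longlonglongrightarrow> 0"
  proof (rule Lim_null_comparison)
    show "eventually (\<lambda>n. cmod (phi (?V n) (\<theta> / f0) - phi (?Z n) (\<theta> / f0)) \<le> \<bar>\<theta> / f0\<bar> * \<bar>bi n\<bar>) sequentially"
    proof (intro always_eventually allI phi_diff)
      show "Lp_le P 2 (\<lambda>x. ?V n x - ?Z n x) \<bar>bi n\<bar>" for n
        using Lp_le_const[of 2 "bi n"] by (simp add: bi_def algebra_simps)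
    qed (use QF_meas in measurable)
    have "(\<lambda>n. \<bar>\<theta> / f0\<bar> * \<bar>bi n\<bar>) \<longlonglongrightarrow> \<bar>\<theta> / f0\<bar> * \<bar>0\<bar>" by (intro tendsto_intros bi)
    then show "(\<lambda>n. \<bar>\<theta> / f0\<bar> * \<bar>bi n\<bar>) \<longlonglongrightarrow> 0" by simp
  qed
  from tendsto_add[OF this lim[unfolded e]] have "(\<lambda>n. phi (?V n) (\<theta> / f0)) \<longlonglongrightarrow> of_real (exp (- (\<theta>\<^sup>2 / 2)))"
    by simp
  moreover have "phi (?V n) (\<theta> / f0) = phi (\<lambda>x. ?V n x / f0) \<theta>" for n
    by (simp add: phi_def)
  ultimately show ?thesis by simp
qed

end

section \<open>The averaged periodogram\<close>

lemma cmod_trig_sum_sq: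
  fixes x :: "nat \<Rightarrow> real"
  shows "(cmod (\<Sum>t=1..n. of_real (x t) * exp (- \<i> * of_nat t * of_real w)))\<^sup>2 =
    (\<Sum>t=1..n. \<Sum>s=1..n. x s * x t * cos ((real s - real t) * w))"
proof -
  have e: "of_real (x t) * exp (- \<i> * of_nat t * of_real w) = Complex (x t * cos (real t * w)) (- (x t * sin (real t * w)))" for t
  proof -
    have "exp (- \<i> * of_nat t * of_real w) = cis (- (real t * w))"
      by (simp add: cis_conv_exp mult.assoc)
    then show ?thesis by (simp add: complex_eq_iff)
  qed
  have "(cmod (\<Sum>t=1..n. of_real (x t) * exp (- \<i> * of_nat t * of_real w)))\<^sup>2 =
    (\<Sum>t=1..n. x t * cos (real t * w))\<^sup>2 + (\<Sum>t=1..n. x t * sin (real t * w))\<^sup>2"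
    unfolding e by (simp add: cmod_power2 sum_negf)
  also have "\<dots> = (\<Sum>t=1..n. \<Sum>s=1..n. x s * x t * cos ((real s - real t) * w))"
    by (simp add: power2_eq_square sum_product sum.distrib[symmetric] left_diff_distrib cos_diff algebra_simps)
  finally show ?thesis .
qed

lemma sum_nat_int: "(\<Sum>t\<in>{1..int n}. F t) = (\<Sum>t=1..n. F (int t))"
  by (rule sum.reindex_bij_witness[of _ int nat]) auto

lemma averaged_periodogram_eq:
  assumes m: "m > 0" and n: "n > 0"
  shows "sqrt (real m) * averaged_periodogram X n m \<omega> =
    (\<Sum>t\<in>{1..int n}. \<Sum>s\<in>{1..int n}. wt m n (s - t) * (X s \<omega> * X t \<omega>))"
proof -
  let ?x = "\<lambda>t::nat. X (int t) \<omega>"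
  have per: "periodogram X n (fourier_frequency n j) \<omega> =
    (\<Sum>t=1..n. \<Sum>s=1..n. ?x s * ?x t * cos (2 * pi * real j * real_of_int (int s - int t) / real n)) / (2 * pi * real n)" for j
  proof -
    have "periodogram X n (fourier_frequency n j) \<omega> =
      (cmod (\<Sum>t=1..n. of_real (?x t) * exp (- \<i> * of_nat t * of_real (fourier_frequency n j))))\<^sup>2 / (2 * pi * real n)"
      unfolding periodogram_def norm_mult power_mult_distrib by (simp add: norm_divide power_divide)
    also have "(cmod (\<Sum>t=1..n. of_real (?x t) * exp (- \<i> * of_nat t * of_real (fourier_frequency n j))))\<^sup>2 =
      (\<Sum>t=1..n. \<Sum>s=1..n. ?x s * ?x t * cos ((real s - real t) * fourier_frequency n j))"
      by (rule cmod_trig_sum_sq)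
    finally show ?thesis by (simp add: fourier_frequency_def mult_ac)
  qed
  have "(\<Sum>j=1..m. periodogram X n (fourier_frequency n j) \<omega>) =
    (\<Sum>t=1..n. \<Sum>s=1..n. \<Sum>j=1..m. ?x s * ?x t * cos (2 * pi * real j * real_of_int (int s - int t) / real n)) / (2 * pi * real n)"
    unfolding per sum_divide_distrib[symmetric]
    by (rule arg_cong[where f = "\<lambda>z. z / (2 * pi * real n)"], rule trans[OF sum.swap], rule sum.cong[OF refl], rule sum.swap)
  also have "\<dots> = (\<Sum>t=1..n. \<Sum>s=1..n. ?x s * ?x t * kern m n (int s - int t)) / (2 * pi * real n)"
    unfolding kern_def sum_distrib_left ..
  finally have "sqrt (real m) * averaged_periodogram X n m \<omega> =
     (sqrt (real m) / real m) * ((\<Sum>t=1..n. \<Sum>s=1..n. ?x s * ?x t * kern m n (int s - int t)) / (2 * pi * real n))"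
    by (simp add: averaged_periodogram_def)
  also have "sqrt (real m) / real m = 1 / sqrt (real m)" using m by (simp add: real_div_sqrt field_simps)
  also have "1 / sqrt (real m) * ((\<Sum>t=1..n. \<Sum>s=1..n. ?x s * ?x t * kern m n (int s - int t)) / (2 * pi * real n)) =
    (\<Sum>t=1..n. \<Sum>s=1..n. wt m n (int s - int t) * (?x s * ?x t))"
    unfolding wt_def by (simp add: sum_divide_distrib sum_distrib_left mult_ac)
  finally show ?thesis by (simp add: sum_nat_int)
qed

section \<open>From an asymptotic rate to a summable majorant\<close>

lemma powr_mult_const_summable:
  assumes "s < -1" shows "summable (\<lambda>k. C * (real k + 1) powr s)"
proof -
  have "summable (\<lambda>k. real (Suc k) powr s)"
    using assms by (subst summable_Suc_iff) (simp add: summable_real_powr_iff)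
  then show ?thesis by (intro summable_mult) (simp add: add.commute)
qed

text \<open>The asymptotic rate is silent about small \<open>l\<close>, where the uniform bound
  \<open>b\<close> steps in. The base l + 1 is needed because \<open>0 powr (- \<eta>)\<close> is
  0.\<close>

lemma bigo_powr_uniform:
  fixes N :: "nat \<Rightarrow> real"
  assumes N: "N \<in> O(\<lambda>l. real l powr (- \<eta>))" and b: "\<And>l. N l \<le> b" and \<eta>: "\<eta> > 0" and b0: "0 \<le> b"
  obtains C where "0 \<le> C" "\<And>l. N l \<le> C * (real l + 1) powr (- \<eta>)"
proof -
  obtain K where K: "K > 0" "eventually (\<lambda>l. norm (N l) \<le> K * norm (real l powr (- \<eta>))) sequentially"
    using N by (rule landau_o.bigE)
  then obtain l0 where l0: "\<And>l. l0 \<le> l \<Longrightarrow> norm (N l) \<le> K * norm (real l powr (- \<eta>))"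
    by (auto simp: eventually_sequentially)
  \<comment> \<open>The first summand uses (l + 1) / 2 \<le> l for l \<ge> 1; the second covers l <
    l0 and l = 0, where l + 1 is at most l0 + 2.\<close>
  define C where "C = K * 2 powr \<eta> + b * (real l0 + 2) powr \<eta>"
  have C0: "0 \<le> C" using K b0 by (simp add: C_def)
  have "N l \<le> C * (real l + 1) powr (- \<eta>)" for l
  proof (cases "l0 \<le> l \<and> 1 \<le> l")
    case True
    have "N l \<le> K * real l powr (- \<eta>)" using l0[of l] True by simp
    also have "\<dots> \<le> K * ((real l + 1) / 2) powr (- \<eta>)"
      using True K \<eta> by (intro mult_left_mono powr_mono2') auto
    also have "((real l + 1) / 2) powr (- \<eta>) = 2 powr \<eta> * (real l + 1) powr (- \<eta>)"
      by (simp add: powr_divide powr_minus_divide)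
    also have "K * (2 powr \<eta> * (real l + 1) powr (- \<eta>)) \<le> C * (real l + 1) powr (- \<eta>)"
      unfolding C_def using b0 by (simp add: distrib_right)
    finally show ?thesis .
  next
    case False
    then have "real l + 1 \<le> real l0 + 2" by linarith
    then have "(real l0 + 2) powr (- \<eta>) \<le> (real l + 1) powr (- \<eta>)"
      using \<eta> by (intro powr_mono2') auto
    moreover have "(real l0 + 2) powr \<eta> * (real l0 + 2) powr (- \<eta>) = 1" by (simp flip: powr_add)
    ultimately have "1 \<le> (real l0 + 2) powr \<eta> * (real l + 1) powr (- \<eta>)"
      by (metis mult_left_mono powr_ge_zero)
    then have "b * 1 \<le> b * ((real l0 + 2) powr \<eta> * (real l + 1) powr (- \<eta>))"
      using b0 by (rule mult_left_mono)
    also have "\<dots> \<le> C * (real l + 1) powr (- \<eta>)"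
      unfolding C_def using K by (simp add: distrib_right)
    finally show ?thesis using b[of l] by simp
  qed
  with C0 that show thesis by blast
qed

lemma normalized_sum_eq:
  fixes I :: "nat \<Rightarrow> real"
  assumes "m > 0" "f \<noteq> 0"
  shows "sqrt (real m) / f * (1 / real m * (\<Sum>j=1..m. I j) - f) = 1 / sqrt (real m) * (\<Sum>j=1..m. I j / f - 1)"
proof -
  define r where "r = sqrt (real m)"
  have r: "real m = r * r" "r \<noteq> 0" using assms(1) by (simp_all add: r_def)
  have "(\<Sum>j=1..m. I j / f - 1) = (\<Sum>j=1..m. I j) / f - real m"
    by (simp add: sum_subtractf sum_divide_distrib)
  then show ?thesis
    unfolding r_def[symmetric] r(1) using r(2) assms(2) by (simp only:) (simp add: field_simps)
qed

theorem theorem1: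
  fixes M :: "'a measure"
    and S :: "'s measure"
    and e e' :: "int \<Rightarrow> 'a \<Rightarrow> 's"
    and g :: "(nat \<Rightarrow> 's) \<Rightarrow> real"
    and X :: "int \<Rightarrow> 'a \<Rightarrow> real"
    and \<eta> :: real
    and m :: "nat \<Rightarrow> nat"
  assumes "prob_space M"
    and "iid_sequence M S e"
    and "independent_copy M S e e'"
    and "g \<in> borel_measurable (Pi\<^sub>M UNIV (\<lambda>_. S))"
    and "X = bernoulli_shift g e"
    and "(\<integral>\<omega>. X 0 \<omega> \<partial>M) = 0"
    and "integrable M (\<lambda>\<omega>. \<bar>X 0 \<omega>\<bar> ^ 4)"
    and "\<eta> > 3"
    and "\<forall>t. (\<lambda>l. Lp_norm M 4 (\<lambda>\<omega>. X t \<omega> - coupled_shift g e e' l t \<omega>))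
               \<in> O(\<lambda>l. real l powr (- \<eta>))"
    and "spectral_density M X 0 > 0"
    and "\<forall>n\<ge>1. m n > 0"
    and "filterlim m at_top at_top"
    and "(\<lambda>n. real (m n)) \<in> o(\<lambda>n. real n powr (4 / 5))"
  shows "(\<forall>n\<ge>1. \<forall>\<omega>\<in>space M.
            sqrt (real (m n)) / spectral_density M X 0
              * (averaged_periodogram X n (m n) \<omega> - spectral_density M X 0)
            = 1 / sqrt (real (m n))
              * (\<Sum>j = 1..m n. periodogram X n (fourier_frequency n j) \<omega>
                                 / spectral_density M X 0 - 1))
       \<and> weak_conv_m
           (\<lambda>n. distr M borel (\<lambda>\<omega>. sqrt (real (m n)) / spectral_density M X 0
              * (averaged_periodogram X n (m n) \<omega> - spectral_density M X 0)))
           std_normal_distribution"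
proof
  show "\<forall>n\<ge>1. \<forall>\<omega>\<in>space M.
            sqrt (real (m n)) / spectral_density M X 0
              * (averaged_periodogram X n (m n) \<omega> - spectral_density M X 0)
            = 1 / sqrt (real (m n))
              * (\<Sum>j = 1..m n. periodogram X n (fourier_frequency n j) \<omega>
                                 / spectral_density M X 0 - 1)"
  proof (intro allI impI ballI)
    fix n :: nat and \<omega> assume "1 \<le> n"
    then have "m n > 0" using assms(11) by blast
    then show "sqrt (real (m n)) / spectral_density M X 0
              * (averaged_periodogram X n (m n) \<omega> - spectral_density M X 0)
            = 1 / sqrt (real (m n))
              * (\<Sum>j = 1..m n. periodogram X n (fourier_frequency n j) \<omega>
                                 / spectral_density M X 0 - 1)"
      unfolding averaged_periodogram_def by (rule normalized_sum_eq) (use assms(10) in simp)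
  qed
next
  interpret M: prob_space M by fact
  \<comment> \<open>By \<open>dE\<close> below the random sequence \<open>E\<close> has the product
    law of copies of this measure, so expectations over \<open>M\<close> can be computed over
    \<open>P\<close>.\<close>
  define \<mu> where "\<mu> = distr M S (e 0)"
  define E where "E \<omega> t = e t \<omega>" for \<omega> t
  define E' where "E' \<omega> t = e' t \<omega>" for \<omega> t
  let ?PS = "Pi\<^sub>M UNIV (\<lambda>_::int. S)"
  have indep: "M.indep_vars (\<lambda>_. S) e UNIV" and same: "distr M S (e t) = \<mu>" for t
    using assms(2) unfolding iid_sequence_def \<mu>_def by blast+
  have e_meas [measurable]: "e t \<in> M \<rightarrow>\<^sub>M S" for t
    using indep unfolding M.indep_vars_def by simp
  interpret iid_space \<mu>
    by (rule iid_space.intro) (unfold \<mu>_def, rule M.prob_space_distr, rule e_meas)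
  have sets_\<mu> [measurable_cong]: "sets \<mu> = sets S" by (simp add: \<mu>_def)
  have sets_P [measurable_cong]: "sets P = sets ?PS" by (intro sets_PiM_cong) (auto simp: sets_\<mu>)
  have copy: "M.indep_var ?PS E ?PS E'" "distr M ?PS E' = distr M ?PS E"
    using assms(3) unfolding independent_copy_def E_def[abs_def] E'_def[abs_def] by auto
  have E_PS: "E \<in> M \<rightarrow>\<^sub>M ?PS" and E'_PS: "E' \<in> M \<rightarrow>\<^sub>M ?PS"
    using M.indep_var_rv1[OF copy(1)] M.indep_var_rv2[OF copy(1)] by auto
  have E_meas [measurable]: "E \<in> M \<rightarrow>\<^sub>M P" and E'_meas [measurable]: "E' \<in> M \<rightarrow>\<^sub>M P"
    using E_PS E'_PS measurable_cong_sets[OF refl sets_P] by auto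
  have dE_PS: "distr M ?PS E = P"
  proof -
    have "distr M ?PS (\<lambda>x. \<lambda>i\<in>UNIV. e i x) = (\<Pi>\<^sub>M i\<in>UNIV. distr M S (e i))"
      using indep by (subst (asm) M.indep_vars_iff_distr_eq_PiM) auto
    moreover have "(\<lambda>x. \<lambda>i\<in>UNIV. e i x) = E" by (auto simp: E_def fun_eq_iff)
    ultimately show ?thesis by (simp add: same)
  qed
  have dist_cong: "distr M P h = distr M ?PS h" for h by (rule distr_cong) (auto simp: sets_P)
  have dE: "distr M P E = P" unfolding dist_cong by (rule dE_PS)
  \<comment> \<open>Independence of the copy makes the joint law a product of two copies of
    \<open>P\<close>, so that the coupled process corresponds to \<open>mix\<close> on
    pairs.\<close>
  have dEE: "distr M (P \<Otimes>\<^sub>M P) (\<lambda>\<omega>. (E \<omega>, E' \<omega>)) = P \<Otimes>\<^sub>M P"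
  proof -
    have "distr M (P \<Otimes>\<^sub>M P) (\<lambda>\<omega>. (E \<omega>, E' \<omega>)) = distr M (?PS \<Otimes>\<^sub>M ?PS) (\<lambda>\<omega>. (E \<omega>, E' \<omega>))"
      by (rule distr_cong) (auto simp: sets_P intro!: sets_pair_measure_cong)
    also have "\<dots> = distr M ?PS E \<Otimes>\<^sub>M distr M ?PS E'"
      using copy(1) unfolding M.indep_var_distribution_eq by simp
    finally show ?thesis by (simp add: copy(2) dE_PS)
  qed
  \<comment> \<open>Extending g to two-sided sequences lets time shifts act on its argument.\<close>
  define f where "f x = g (\<lambda>k. x (- int k))" for x :: "int \<Rightarrow> 's"
  have f_meas [measurable]: "f \<in> borel_measurable P"
  proof -
    have "(\<lambda>x k. x (- int k)) \<in> P \<rightarrow>\<^sub>M Pi\<^sub>M UNIV (\<lambda>_::nat. S)"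
      by (rule measurable_PiM_single') (auto simp: space_PiM PiE_iff sets_eq_imp_space_eq[OF sets_\<mu>, symmetric])
    from measurable_compose[OF this assms(4)] show ?thesis by (simp add: f_def[abs_def])
  qed
  have X_eq: "X t \<omega> = f (shift t (E \<omega>))" for t \<omega>
    by (simp add: assms(5) bernoulli_shift_def f_def shift_def E_def add.commute)
  have cp_eq: "coupled_shift g e e' l 0 \<omega> = f (mix {- int l<..} (E \<omega>) (E' \<omega>))" for l \<omega>
    by (simp add: coupled_shift_def f_def mix_def E_def E'_def if_distrib cong: if_cong)
  have X_meas [measurable]: "X t \<in> borel_measurable M" for t
    unfolding X_eq[abs_def] by measurable
  have intP: "(\<integral>x. h x \<partial>P) = (\<integral>\<omega>. h (E \<omega>) \<partial>M)" if "h \<in> borel_measurable P" for h :: "(int \<Rightarrow> 's) \<Rightarrow> real"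
    using integral_distr[OF E_meas that] by (simp add: dE)
  have f4: "integrable P (\<lambda>x. \<bar>f x\<bar> ^ 4)"
    using assms(7) integrable_distr_eq[OF E_meas, of "\<lambda>x. \<bar>f x\<bar> ^ 4"] by (simp add: dE X_eq)
  have f_mean: "(\<integral>x. f x \<partial>P) = 0" using intP[OF f_meas] assms(6) by (simp add: X_eq)
  define b where "b = root 4 (\<integral>x. \<bar>f x\<bar> ^ 4 \<partial>P)"
  have f_b: "Lp_le P 4 f b" unfolding b_def by (rule Lp_leI_root) (use f4 in auto)
  let ?\<Delta> = "\<lambda>l z. f (fst z) - f (mix {- int l<..} (fst z) (snd z))"
  define N where "N l = Lp_norm M 4 (\<lambda>\<omega>. X 0 \<omega> - coupled_shift g e e' l 0 \<omega>)" for l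
  have \<Delta>b: "Lp_le (P \<Otimes>\<^sub>M P) 4 (?\<Delta> l) (b + b)" for l
  proof -
    have "Lp_le (P \<Otimes>\<^sub>M P) 4 (\<lambda>z. f (fst z)) b"
      using Lp_le_mix[OF f_b, of UNIV] by (simp add: mix_def[abs_def])
    then show ?thesis by (intro Lp_le_diff Lp_le_mix f_b) auto
  qed
  have N_eq: "N l = (\<integral>z. \<bar>?\<Delta> l z\<bar> ^ 4 \<partial>(P \<Otimes>\<^sub>M P)) powr (1 / 4)" for l
  proof -
    have [measurable]: "?\<Delta> l \<in> borel_measurable (P \<Otimes>\<^sub>M P)" using \<Delta>b Lp_le_measurable by blast
    have "(\<integral>z. \<bar>?\<Delta> l z\<bar> ^ 4 \<partial>(P \<Otimes>\<^sub>M P)) = (\<integral>\<omega>. \<bar>X 0 \<omega> - coupled_shift g e e' l 0 \<omega>\<bar> ^ 4 \<partial>M)"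
      using integral_distr[of "\<lambda>\<omega>. (E \<omega>, E' \<omega>)" M "P \<Otimes>\<^sub>M P" "\<lambda>z. \<bar>?\<Delta> l z\<bar> ^ 4"] by (simp add: dEE X_eq cp_eq)
    then show ?thesis by (simp add: N_def Lp_norm_def)
  qed
  have N4: "N l ^ 4 = (\<integral>z. \<bar>?\<Delta> l z\<bar> ^ 4 \<partial>(P \<Otimes>\<^sub>M P))" "0 \<le> N l" for l
  proof -
    have "(z powr (1 / 4)) ^ 4 = z" if "0 \<le> z" for z :: real
      using that by (cases "z = 0") (simp_all add: powr_power)
    from this[OF integral_nonneg_AE[of "\<lambda>z. \<bar>?\<Delta> l z\<bar> ^ 4" "P \<Otimes>\<^sub>M P"]]
    show "N l ^ 4 = (\<integral>z. \<bar>?\<Delta> l z\<bar> ^ 4 \<partial>(P \<Otimes>\<^sub>M P))" unfolding N_eq by simp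
    show "0 \<le> N l" by (simp add: N_eq)
  qed
  have N_Lp: "Lp_le (P \<Otimes>\<^sub>M P) 4 (?\<Delta> l) (N l)" for l
    using \<Delta>b[of l] N4[of l] unfolding Lp_le_def by auto
  have N_le: "N l \<le> 2 * b" for l
  proof -
    have "N l ^ 4 \<le> (b + b) ^ 4" unfolding N4(1) by (rule Lp_le_integral[OF \<Delta>b])
    then have "N l \<le> b + b" using Lp_le_nonneg[OF f_b] by (intro power_le_imp_le_base[of "N l" 3]) (auto simp: eval_nat_numeral)
    then show ?thesis by simp
  qed
  obtain C where C: "0 \<le> C" "\<And>l. N l \<le> C * (real l + 1) powr (- \<eta>)"
  proof (rule bigo_powr_uniform[of N \<eta> "2 * b"])
    show "N \<in> O(\<lambda>l. real l powr (- \<eta>))" using assms(9) unfolding N_def[abs_def] by blast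
  qed (use N_le Lp_le_nonneg[OF f_b] assms(8) in auto)
  \<comment> \<open>Replacing the coupling distances by this envelope yields the monotonicity that
    \<open>shift_process\<close> demands.\<close>
  define c where "c l = C * (real l + 1) powr (- \<eta>)" for l
  interpret sp: shift_process \<mu> f c
  proof unfold_locales
    show "dep {..0} f" by (auto simp: dep_def f_def intro!: arg_cong[of _ _ g])
    show "L4 f" by (rule L4I[OF f_b])
    show "(\<integral>x. f x \<partial>P) = 0" by (rule f_mean)
    show "Lp_le (P \<Otimes>\<^sub>M P) 4 (?\<Delta> l) (c l)" for l
      unfolding c_def by (rule Lp_le_mono[OF N_Lp C(2)])
    show "decseq c"
      unfolding decseq_def c_def using C(1) assms(8) by (auto intro!: mult_left_mono powr_mono2')
    have "sqrt (c k) = sqrt C * (real k + 1) powr (- \<eta> / 2)" for k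
      by (simp add: c_def real_sqrt_mult powr_half_sqrt[symmetric] powr_powr)
    then show "summable (\<lambda>k. sqrt (c k))"
      using powr_mult_const_summable[of "- \<eta> / 2" "sqrt C"] assms(8) by simp
    \<comment> \<open>The resulting exponent 2 - \<eta> is below -1 exactly when \<eta> > 3.\<close>
    have "(real k + 1)\<^sup>2 * c k = C * (real k + 1) powr (2 - \<eta>)" for k
      by (simp add: c_def powr_diff powr_minus_divide)
    then show "summable (\<lambda>k. (real k + 1)\<^sup>2 * c k)"
      using powr_mult_const_summable[of "2 - \<eta>" C] assms(8) by simp
  qed
  have spX: "sp.X t (E \<omega>) = X t \<omega>" for t \<omega> by (simp add: sp.X_def X_eq)
  have mean: "(\<integral>\<omega>. X t \<omega> \<partial>M) = 0" for t
    using intP[OF sp.X_meas, of t] sp.X_mean[of t] by (simp add: spX)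
  have acov: "autocovariance M X h = sp.gam h" for h
    unfolding autocovariance_def covariance_def mean sp.gam_def
    by (subst intP) (auto simp: spX)
  define f0 where "f0 = sp.Gam / (2 * pi)"
  have sd: "spectral_density M X 0 = f0"
  proof -
    have "(\<Sum>\<^sub>\<infinity>h\<in>UNIV. complex_of_real (sp.gam h)) = complex_of_real sp.Gam"
      unfolding sp.Gam_def
      by (intro infsumI has_sum_of_real has_sum_infsum abs_summable_summable[OF sp.gam_abs_summable])
    then show ?thesis by (simp add: spectral_density_def acov f0_def)
  qed
  have Gam: "sp.Gam > 0" using assms(10) unfolding sd f0_def by (simp add: zero_less_divide_iff)
  define Z where "Z n \<omega> = sqrt (real (m n)) / f0 * (averaged_periodogram X n (m n) \<omega> - f0)" for n \<omega>
  have Z_meas [measurable]: "Z n \<in> borel_measurable M" for n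
    unfolding Z_def averaged_periodogram_def periodogram_def by measurable
  define V where "V n x = (sp.QF (m n) n sp.X x - sqrt (real (m n)) * f0) / f0" for n x
  have V_meas [measurable]: "V n \<in> borel_measurable P" for n
    unfolding V_def using sp.QF_meas by measurable
  have ZV: "Z n \<omega> = V n (E \<omega>)" if "n \<ge> 1" for n \<omega>
  proof -
    have "sqrt (real (m n)) * averaged_periodogram X n (m n) \<omega> = sp.QF (m n) n sp.X (E \<omega>)"
      using averaged_periodogram_eq[of "m n" n X \<omega>] assms(11) that by (simp add: sp.QF_def spX)
    then show ?thesis by (simp add: Z_def V_def right_diff_distrib diff_divide_distrib)
  qed
  have char_eq: "char (distr M borel (Z n)) \<theta> = phi (V n) \<theta>" if "n \<ge> 1" for n \<theta>
  proof -
    have "distr M borel (Z n) = distr (distr M P E) borel (V n)"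
      by (subst distr_distr) (auto simp: comp_def ZV[OF that] intro!: distr_cong)
    then show ?thesis by (simp add: dE phi_char)
  qed
  have "weak_conv_m (\<lambda>n. distr M borel (Z n)) std_normal_distribution"
  proof (rule levy_continuity)
    show "real_distribution (distr M borel (Z n))" for n by (rule M.real_distribution_distr) measurable
    show "real_distribution std_normal_distribution" by (rule real_dist_normal_dist)
    fix \<theta>
    have "(\<lambda>n. phi (V n) \<theta>) \<longlonglongrightarrow> of_real (exp (- (\<theta>\<^sup>2 / 2)))"
      unfolding V_def f0_def by (rule sp.phi_QF_normalized[OF assms(12,13) Gam])
    moreover have "eventually (\<lambda>n. phi (V n) \<theta> = char (distr M borel (Z n)) \<theta>) sequentially"
      using eventually_ge_at_top[of 1] by eventually_elim (simp add: char_eq)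
    ultimately have "(\<lambda>n. char (distr M borel (Z n)) \<theta>) \<longlonglongrightarrow> of_real (exp (- (\<theta>\<^sup>2 / 2)))"
      by (rule Lim_transform_eventually)
    then show "(\<lambda>n. char (distr M borel (Z n)) \<theta>) \<longlonglongrightarrow> char std_normal_distribution \<theta>"
      by (simp add: char_std_normal_distribution)
  qed
  then show "weak_conv_m
           (\<lambda>n. distr M borel (\<lambda>\<omega>. sqrt (real (m n)) / spectral_density M X 0
              * (averaged_periodogram X n (m n) \<omega> - spectral_density M X 0)))
           std_normal_distribution"
    by (simp add: sd Z_def[abs_def])
qed

end
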